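(* There exist a universal constant $C_{\mathsf{ps}}>0$ and, for each $d\in\{1,2,\dots\}$, an estimator $\hat\gamma_{\mathsf{ps}}$ (a family of functions, one for each trajectory length $m$, mapping $[d]^m$ to $\mathbb{R}$) such that for all $0<\varepsilon<1$ and $0<\delta<1$ the following holds. Let $(M,\mu)$ be any ergodic $d$-state Markov chain with minimum stationary probability $\pi_\star$ and pseudo-spectral gap $\gamma_{\mathsf{ps}}$, and let $X=(X_1,\dots,X_m)$ be drawn according to $(M,\mu)$, with $$m\ \ge\ m_{\mathrm{UB}}:=\frac{C_{\mathsf{ps}}}{\pi_\star\varepsilon^2}\max\left\{\frac{1}{\gamma_{\mathsf{ps}}},\ \mathcal{C}(M)\right\}\ln\left(\frac{d\sqrt{\pi_\star^{-1}}}{\varepsilon^2\delta}\right),$$ where $$\mathcal{C}(M)=\|M\|_\pi\max_{1\le k\le\lceil 2/\varepsilon\rceil}\frac{\|M^k\|_1}{k},\qquad \|M\|_\pi=\max_{(i,j)\in[d]^2}\frac{\pi_i}{\pi_j}.$$ Then $|\hat\gamma_{\mathsf{ps}}(X)-\gamma_{\mathsf{ps}}|<\varepsilon$ holds with probability at least $1-\delta$. Moreover $\mathcal{C}(M)\le\|M\|_\pi\min\{d,\|M\|_\pi\}$.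
   Context: $[d]=\{1,\dots,d\}$. A $d$-state Markov chain is a pair $(M,\mu)$ with $M$ a $d\times d$ row-stochastic matrix and $\mu$ a probability distribution on $[d]$; $(X_1,\dots,X_m)\sim(M,\mu)$ means $\mathbf{P}((X_1,\dots,X_m)=(x_1,\dots,x_m))=\mu(x_1)\prod_{t=1}^{m-1}M(x_t,x_{t+1})$. The chain is ergodic if $M^k$ is entry-wise positive for some $k\ge1$; it then has a unique stationary distribution $\pi$, and $\pi_\star=\min_i\pi_i>0$. The time reversal of $M$ is $M^\dagger(i,j)=\pi(j)M(j,i)/\pi(i)$. For a reversible chain with real eigenvalues $1=\lambda_1\ge\lambda_2\ge\dots\ge\lambda_d$ (with multiplicity), $\gamma=1-\lambda_2$. The chain $(M^\dagger)^kM^k$ is always reversible, and the pseudo-spectral gap is $\gamma_{\mathsf{ps}}=\max_{k\ge1}\frac{\gamma((M^\dagger)^kM^k)}{k}$. For a matrix $A$, $\|A\|_1=\max_j\sum_i|A(i,j)|$ (maximum absolute column sum). The estimator knows $d$ but not $M$ or $\mu$. *)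

theory Defs
  imports
    "HOL-Probability.Probability"
    "Jordan_Normal_Form.Char_Poly"
begin

unbundle no vec_syntax

text \<open>
  The state space of a \<open>d\<close>-state chain is \<open>{..<d}\<close>, matching the 0-based indices of
  \<open>'a mat\<close> and \<open>'a vec\<close>. Below, \<open>\<pi>\<close> always stands for the stationary distribution
  of \<open>M\<close>; for an ergodic \<open>M\<close> it is the unique vector with
  \<open>stationary_distribution d M \<pi>\<close>.
\<close>

definition prob_vec :: "nat \<Rightarrow> real vec \<Rightarrow> bool" where
  "prob_vec d \<mu> \<longleftrightarrow> \<mu> \<in> carrier_vec d \<and> (\<forall>i<d. \<mu> $ i \<ge> 0) \<and> (\<Sum>i<d. \<mu> $ i) = 1"

definition row_stochastic :: "nat \<Rightarrow> real mat \<Rightarrow> bool" where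
  "row_stochastic d M \<longleftrightarrow> M \<in> carrier_mat d d \<and>
     (\<forall>i<d. \<forall>j<d. M $$ (i, j) \<ge> 0) \<and> (\<forall>i<d. (\<Sum>j<d. M $$ (i, j)) = 1)"

definition markov_chain :: "nat \<Rightarrow> real mat \<Rightarrow> real vec \<Rightarrow> bool" where
  "markov_chain d M \<mu> \<longleftrightarrow> row_stochastic d M \<and> prob_vec d \<mu>"

definition ergodic :: "nat \<Rightarrow> real mat \<Rightarrow> bool" where
  "ergodic d M \<longleftrightarrow> row_stochastic d M \<and>
     (\<exists>k\<ge>1. \<forall>i<d. \<forall>j<d. (M ^\<^sub>m k) $$ (i, j) > 0)"

definition stationary_distribution :: "nat \<Rightarrow> real mat \<Rightarrow> real vec \<Rightarrow> bool" where
  "stationary_distribution d M \<pi> \<longleftrightarrow> prob_vec d \<pi> \<and> transpose_mat M *\<^sub>v \<pi> = \<pi>"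

definition min_prob :: "real vec \<Rightarrow> real" where
  "min_prob \<pi> = Min ((\<lambda>i. \<pi> $ i) ` {..<dim_vec \<pi>})"

definition trajectories :: "nat \<Rightarrow> nat \<Rightarrow> nat list set" where
  "trajectories d m = {xs. length xs = m \<and> set xs \<subseteq> {..<d}}"

definition trajectory_prob :: "real mat \<Rightarrow> real vec \<Rightarrow> nat list \<Rightarrow> real" where
  "trajectory_prob M \<mu> xs =
     \<mu> $ (xs ! 0) * (\<Prod>t<length xs - 1. M $$ (xs ! t, xs ! Suc t))"

text \<open>The joint law of \<open>(X\<^sub>1, \<dots>, X\<^sub>m)\<close>, meaningful for \<open>m \<ge> 1\<close>.\<close>

definition trajectory_law :: "nat \<Rightarrow> real mat \<Rightarrow> real vec \<Rightarrow> nat \<Rightarrow> nat list measure" where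
  "trajectory_law d M \<mu> m =
     point_measure (trajectories d m) (\<lambda>xs. ennreal (trajectory_prob M \<mu> xs))"

definition time_reversal :: "real vec \<Rightarrow> real mat \<Rightarrow> real mat" where
  "time_reversal \<pi> M =
     mat (dim_vec \<pi>) (dim_vec \<pi>) (\<lambda>(i, j). \<pi> $ j * M $$ (j, i) / \<pi> $ i)"

text \<open>
  Real eigenvalues in decreasing order, repeated according to algebraic multiplicity. A reversible
  chain is diagonalisable over the reals, so there are exactly \<open>d\<close> of them and algebraic
  and geometric multiplicities agree.
\<close>

definition real_eigenvalues :: "real mat \<Rightarrow> real list" where
  "real_eigenvalues A = rev (sorted_list_of_multiset (proots (char_poly A)))"

text \<open>
  The second eigenvalue is entry 1 of the 0-based list. For \<open>d = 1\<close> it does not exist; the gap is then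
  taken to be 1, the value for a chain that is stationary after one step.
\<close>

definition spectral_gap :: "real mat \<Rightarrow> real" where
  "spectral_gap A = (if dim_row A \<ge> 2 then 1 - real_eigenvalues A ! 1 else 1)"

text \<open>
  The supremum is a maximum for ergodic \<open>M\<close>: each gap lies in \<open>[0, 1]\<close>, so the terms
  tend to 0, and the gap is positive as soon as \<open>M ^\<^sub>m k\<close> is entry-wise positive.
\<close>

definition pseudo_spectral_gap :: "real vec \<Rightarrow> real mat \<Rightarrow> real" where
  "pseudo_spectral_gap \<pi> M =
     (SUP k\<in>{1..}. spectral_gap ((time_reversal \<pi> M) ^\<^sub>m k * M ^\<^sub>m k) / real k)"

definition max_col_sum_norm :: "real mat \<Rightarrow> real" where
  "max_col_sum_norm A = Max ((\<lambda>j. \<Sum>i<dim_row A. \<bar>A $$ (i, j)\<bar>) ` {..<dim_col A})"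

definition stationary_ratio :: "real vec \<Rightarrow> real" where
  "stationary_ratio \<pi> =
     Max ((\<lambda>(i, j). \<pi> $ i / \<pi> $ j) ` ({..<dim_vec \<pi>} \<times> {..<dim_vec \<pi>}))"

definition complexity :: "real \<Rightarrow> real vec \<Rightarrow> real mat \<Rightarrow> real" where
  "complexity \<epsilon> \<pi> M = stationary_ratio \<pi> *
     Max ((\<lambda>k. max_col_sum_norm (M ^\<^sub>m k) / real k) ` {1..nat \<lceil>2 / \<epsilon>\<rceil>})"

definition sample_bound :: "real \<Rightarrow> nat \<Rightarrow> real \<Rightarrow> real \<Rightarrow> real vec \<Rightarrow> real mat \<Rightarrow> real" where
  "sample_bound C d \<epsilon> \<delta> \<pi> M =
     C / (min_prob \<pi> * \<epsilon>\<^sup>2) *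
       max (1 / pseudo_spectral_gap \<pi> M) (complexity \<epsilon> \<pi> M) *
       ln (real d * sqrt (1 / min_prob \<pi>) / (\<epsilon>\<^sup>2 * \<delta>))"

lemma finite_trajectories: "finite (trajectories d m)"
proof -
  have "trajectories d m = {xs. set xs \<subseteq> {..<d} \<and> length xs = m}"
    by (auto simp: trajectories_def)
  then show ?thesis
    using finite_lists_length_eq[of "{..<d}" m] by simp
qed

lemma trajectory_prob_snoc:
  assumes "xs \<noteq> []"
  shows "trajectory_prob M \<mu> (xs @ [x]) = trajectory_prob M \<mu> xs * M $$ (last xs, x)"
proof -
  obtain n where n: "length xs = Suc n"
    using assms by (cases xs) auto
  show ?thesis
    using assms by (simp add: trajectory_prob_def n nth_append last_conv_nth)
qed

lemma sum_trajectory_prob: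
  assumes "markov_chain d M \<mu>"
  shows "(\<Sum>xs\<in>trajectories d (Suc m). trajectory_prob M \<mu> xs) = 1"
proof (induction m)
  case 0
  have "trajectories d (Suc 0) = (\<lambda>x. [x]) ` {..<d}"
    by (auto simp: trajectories_def length_Suc_conv)
  then show ?case
    using assms
    by (simp add: sum.reindex inj_on_def trajectory_prob_def markov_chain_def prob_vec_def)
next
  case (Suc m)
  let ?T = "trajectories d (Suc m)"
  have eq: "trajectories d (Suc (Suc m)) = (\<lambda>(xs, x). xs @ [x]) ` (?T \<times> {..<d})"
  proof (intro equalityI subsetI)
    fix xs assume xs: "xs \<in> trajectories d (Suc (Suc m))"
    then have ne: "xs \<noteq> []"
      by (auto simp: trajectories_def)
    have "butlast xs \<in> ?T" "last xs < d"
      using xs last_in_set[OF ne] by (auto simp: trajectories_def dest: in_set_butlastD)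
    then show "xs \<in> (\<lambda>(xs, x). xs @ [x]) ` (?T \<times> {..<d})"
      by (intro image_eqI[of _ _ "(butlast xs, last xs)"]) (use ne in auto)
  qed (auto simp: trajectories_def)
  have inj: "inj_on (\<lambda>(xs, x). xs @ [x]) (?T \<times> {..<d})"
    by (auto simp: inj_on_def)
  have "(\<Sum>xs\<in>trajectories d (Suc (Suc m)). trajectory_prob M \<mu> xs) =
        (\<Sum>(xs, x)\<in>?T \<times> {..<d}. trajectory_prob M \<mu> (xs @ [x]))"
    unfolding eq sum.reindex[OF inj] by (simp add: case_prod_unfold)
  also have "\<dots> = (\<Sum>xs\<in>?T. \<Sum>x<d. trajectory_prob M \<mu> (xs @ [x]))"
    by (simp add: sum.cartesian_product)
  also have "\<dots> = (\<Sum>xs\<in>?T. trajectory_prob M \<mu> xs)"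
  proof (rule sum.cong[OF refl])
    fix xs assume xs: "xs \<in> ?T"
    then have ne: "xs \<noteq> []"
      by (auto simp: trajectories_def)
    have "last xs < d"
      using xs last_in_set[OF ne] by (auto simp: trajectories_def)
    then have "(\<Sum>x<d. M $$ (last xs, x)) = 1"
      using assms by (simp add: markov_chain_def row_stochastic_def)
    then show "(\<Sum>x<d. trajectory_prob M \<mu> (xs @ [x])) = trajectory_prob M \<mu> xs"
      by (simp add: trajectory_prob_snoc[OF ne] sum_distrib_left[symmetric])
  qed
  also have "\<dots> = 1"
    by (rule Suc.IH)
  finally show ?case .
qed

lemma trajectory_prob_nonneg:
  assumes "markov_chain d M \<mu>" "xs \<in> trajectories d m" "m \<ge> 1"
  shows "trajectory_prob M \<mu> xs \<ge> 0"
proof -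
  have lt: "xs ! t < d" if "t < length xs" for t
    using assms(2) nth_mem[OF that] by (auto simp: trajectories_def)
  have "xs ! 0 < d"
    using assms lt by (auto simp: trajectories_def)
  moreover have "xs ! t < d" "xs ! Suc t < d" if "t < length xs - 1" for t
    using lt[of t] lt[of "Suc t"] that by auto
  ultimately show ?thesis
    using assms(1) unfolding trajectory_prob_def markov_chain_def row_stochastic_def prob_vec_def
    by (intro mult_nonneg_nonneg prod_nonneg) auto
qed

lemma prob_space_trajectory_law:
  assumes "markov_chain d M \<mu>" "m \<ge> 1"
  shows "prob_space (trajectory_law d M \<mu> m)"
proof
  obtain n where "m = Suc n"
    using assms(2) by (cases m) auto
  then show "emeasure (trajectory_law d M \<mu> m) (space (trajectory_law d M \<mu> m)) = 1"
    using sum_trajectory_prob[OF assms(1), of n] trajectory_prob_nonneg[OF assms(1) _ assms(2)]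
    by (simp add: trajectory_law_def space_point_measure emeasure_point_measure_finite
        finite_trajectories sum_ennreal)
qed

end

theory Submission
  imports Defs "Jordan_Normal_Form.Spectral_Radius"
begin

text \<open>
  Put \<open>L(i, j) = sqrt (\<pi> i) M(i, j) / sqrt (\<pi> j)\<close>. The spectrum of \<open>(M\<^sup>\<dagger>)\<^sup>k M\<^sup>k\<close> is that of
  \<open>(L\<^sup>T)\<^sup>k L\<^sup>k\<close>. As \<open>L\<close> is a contraction, a perturbation of \<open>L\<close> of operator norm \<open>\<Delta>\<close>
  moves the second eigenvalue of that matrix by at most \<open>2 k \<Delta>\<close>, so after division by \<open>k\<close> the
  pseudo-spectral gap is \<open>2\<close>-Lipschitz in \<open>L\<close>. It therefore suffices to estimate \<open>L\<close> in operator norm.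

  The empirical matrix \<open>N(i, j) / sqrt (N(i) N(j))\<close> does so once the visit counts \<open>N(i)\<close> are within a
  factor \<open>1 \<plusminus> \<eta>\<close> of their means and the centred transition counts, a matrix martingale, have operator
  norm at most \<open>\<eta>\<close>. The first event has high probability by an exponential moment bound for additive
  functionals, split into the residue classes of a \<open>k\<close> that nearly attains \<open>\<gamma>\<^sub>p\<^sub>s\<close>; the second by a
  matrix Freedman inequality, whose predictable variance is controlled by the visit counts and \<open>\<parallel>M\<parallel>\<^sub>1\<close>.
\<close>

section \<open>Spectral theorem for real symmetric matrices\<close>

text \<open>Three obstacles shape the argument. The gap is a supremum over infinitely many powers,
  so estimating the powers one by one would need a union over \<open>k\<close>; the perturbation
  grows only linearly in \<open>k\<close>, and division by \<open>k\<close> reduces everything to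
  the single matrix \<open>L\<close>. The empirical matrix need not come from an ergodic chain and
  may have no gap of its own; it serves as a common reference point for all chains that could have
  produced the data, each graded by its own tolerance \<eta>.

  The start is arbitrary: exponential moments are controlled in \<open>L2(\<pi>)\<close>, and
  passing to a fixed initial state costs a factor of order \<open>1 / sqrt (min_prob \<pi>)\<close>,
  which the logarithm in the sample size absorbs. The complexity term enters through its entry
  \<open>k = 1\<close>, which dominates \<open>max_col_sum_norm M\<close> and bounds the column part
  of the matrix variance.\<close>

definition ip :: "nat \<Rightarrow> (nat \<Rightarrow> real) \<Rightarrow> (nat \<Rightarrow> real) \<Rightarrow> real" where
  "ip n u v = (\<Sum>i<n. u i * v i)"

text \<open>Bare functions, read only at indices below \<open>n\<close>, avoid carrier side
  conditions; values beyond \<open>n\<close> are arbitrary, hence the congruence rules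
  below.\<close>

definition mv :: "nat \<Rightarrow> (nat \<Rightarrow> nat \<Rightarrow> real) \<Rightarrow> (nat \<Rightarrow> real) \<Rightarrow> nat \<Rightarrow> real" where
  "mv n A v = (\<lambda>i. \<Sum>j<n. A i j * v j)"

definition symmetric_on :: "nat \<Rightarrow> (nat \<Rightarrow> nat \<Rightarrow> real) \<Rightarrow> bool" where
  "symmetric_on n A \<longleftrightarrow> (\<forall>i<n. \<forall>j<n. A i j = A j i)"

text \<open>Rows and columns of the square array are both required to be orthonormal: the second
  clause is the resolution of the identity, from which Parseval and the expansion follow by
  exchanging sums.\<close>

definition orthonormal_basis :: "nat \<Rightarrow> (nat \<Rightarrow> nat \<Rightarrow> real) \<Rightarrow> bool" where
  "orthonormal_basis n E \<longleftrightarrow>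
     (\<forall>a<n. \<forall>b<n. ip n (E a) (E b) = of_bool (a = b)) \<and>
     (\<forall>i<n. \<forall>j<n. (\<Sum>a<n. E a i * E a j) = of_bool (i = j))"

definition eigensystem ::
  "nat \<Rightarrow> (nat \<Rightarrow> nat \<Rightarrow> real) \<Rightarrow> (nat \<Rightarrow> nat \<Rightarrow> real) \<Rightarrow> (nat \<Rightarrow> real) \<Rightarrow> bool" where
  "eigensystem n A E l \<longleftrightarrow> orthonormal_basis n E \<and>
     (\<forall>a<n. \<forall>i<n. mv n A (E a) i = l a * E a i)"

lemma ip_commute: "ip n u v = ip n v u"
  by (simp add: ip_def mult.commute)

lemma ip_cong: "(\<And>i. i < n \<Longrightarrow> u i = u' i) \<Longrightarrow> (\<And>i. i < n \<Longrightarrow> v i = v' i) \<Longrightarrow> ip n u v = ip n u' v'"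
  by (simp add: ip_def)

lemma mv_cong: "(\<And>i. i < n \<Longrightarrow> v i = v' i) \<Longrightarrow> mv n A v = mv n A v'"
  by (simp add: mv_def)

lemma ip_nonneg: "ip n u u \<ge> 0"
  by (simp add: ip_def sum_nonneg)

lemma ip_eq_0_iff: "ip n u u = 0 \<longleftrightarrow> (\<forall>i<n. u i = 0)"
  by (auto simp: ip_def sum_nonneg_eq_0_iff)

lemma ip_add_left: "ip n (\<lambda>i. u i + u' i) v = ip n u v + ip n u' v"
  by (simp add: ip_def sum.distrib algebra_simps)

lemma ip_add_right: "ip n v (\<lambda>i. u i + u' i) = ip n v u + ip n v u'"
  by (simp add: ip_def sum.distrib algebra_simps)

lemma ip_diff_left: "ip n (\<lambda>i. u i - u' i) v = ip n u v - ip n u' v"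
  by (simp add: ip_def sum_subtractf algebra_simps)

lemma ip_diff_right: "ip n v (\<lambda>i. u i - u' i) = ip n v u - ip n v u'"
  by (simp add: ip_def sum_subtractf algebra_simps)

lemma ip_scale_left: "ip n (\<lambda>i. c * u i) v = c * ip n u v"
  by (simp add: ip_def sum_distrib_left algebra_simps)

lemma ip_scale_right: "ip n v (\<lambda>i. c * u i) = c * ip n v u"
  by (simp add: ip_def sum_distrib_left algebra_simps)

lemma ip_sum_left: "ip n (\<lambda>i. \<Sum>a\<in>S. f a i) v = (\<Sum>a\<in>S. ip n (f a) v)"
  unfolding ip_def sum_distrib_right by (rule sum.swap)

lemma ip_sum_right: "ip n v (\<lambda>i. \<Sum>a\<in>S. f a i) = (\<Sum>a\<in>S. ip n v (f a))"
  unfolding ip_def sum_distrib_left by (rule sum.swap)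

lemma ip_Cauchy_Schwarz: "(ip n u v)\<^sup>2 \<le> ip n u u * ip n v v"
  using Cauchy_Schwarz_ineq_sum[of u v "{..<n}"] by (simp add: ip_def power2_eq_square)

lemma mv_add: "mv n A (\<lambda>i. u i + v i) = (\<lambda>i. mv n A u i + mv n A v i)"
  by (simp add: mv_def sum.distrib algebra_simps)

lemma mv_diff: "mv n A (\<lambda>i. u i - v i) = (\<lambda>i. mv n A u i - mv n A v i)"
  by (simp add: mv_def sum_subtractf algebra_simps)

lemma mv_scale: "mv n A (\<lambda>i. c * u i) = (\<lambda>i. c * mv n A u i)"
  by (simp add: mv_def sum_distrib_left algebra_simps)

lemma mv_sum: "mv n A (\<lambda>i. \<Sum>a\<in>S. f a i) = (\<lambda>i. \<Sum>a\<in>S. mv n A (f a) i)"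
  unfolding mv_def sum_distrib_left by (rule ext, rule sum.swap)

lemma mv_mat_add: "mv n (\<lambda>i j. A i j + B i j) v = (\<lambda>i. mv n A v i + mv n B v i)"
  by (simp add: mv_def sum.distrib algebra_simps)

lemma mv_mat_scale: "mv n (\<lambda>i j. c * A i j) v = (\<lambda>i. c * mv n A v i)"
  by (simp add: mv_def sum_distrib_left algebra_simps)

lemma mv_mat_diff: "mv n (\<lambda>i j. A i j - B i j) v = (\<lambda>i. mv n A v i - mv n B v i)"
  by (simp add: mv_def sum_subtractf algebra_simps)

lemma symmetric_on_ip:
  assumes "symmetric_on n A"
  shows "ip n (mv n A u) v = ip n u (mv n A v)"
proof -
  have "ip n (mv n A u) v = (\<Sum>i<n. \<Sum>j<n. A i j * u j * v i)"
    by (simp add: ip_def mv_def sum_distrib_right)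
  also have "\<dots> = (\<Sum>j<n. \<Sum>i<n. A i j * u j * v i)"
    by (rule sum.swap)
  also have "\<dots> = ip n u (mv n A v)"
    using assms by (simp add: ip_def mv_def sum_distrib_left symmetric_on_def algebra_simps)
  finally show ?thesis .
qed

lemma orthonormal_basis_parseval:
  assumes "orthonormal_basis n E"
  shows "(\<Sum>a<n. ip n (E a) u * ip n (E a) v) = ip n u v"
proof -
  have "(\<Sum>a<n. ip n (E a) u * ip n (E a) v) = (\<Sum>a<n. \<Sum>i<n. \<Sum>j<n. (E a i * E a j) * (u i * v j))"
    by (simp add: ip_def sum_product algebra_simps)
  also have "\<dots> = (\<Sum>i<n. \<Sum>a<n. \<Sum>j<n. (E a i * E a j) * (u i * v j))"
    by (rule sum.swap)
  also have "\<dots> = (\<Sum>i<n. \<Sum>j<n. \<Sum>a<n. (E a i * E a j) * (u i * v j))"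
    by (rule sum.cong[OF refl], rule sum.swap)
  also have "\<dots> = (\<Sum>i<n. \<Sum>j<n. of_bool (i = j) * (u i * v j))"
    using assms by (simp add: sum_distrib_right[symmetric] orthonormal_basis_def)
  also have "\<dots> = ip n u v"
    by (simp add: ip_def of_bool_def if_distrib[of "\<lambda>x. x * _"] sum.delta cong: if_cong)
  finally show ?thesis .
qed

lemma orthonormal_basis_expand:
  assumes "orthonormal_basis n E" "i < n"
  shows "(\<Sum>a<n. ip n (E a) v * E a i) = v i"
proof -
  have "(\<Sum>a<n. ip n (E a) v * E a i) = (\<Sum>a<n. \<Sum>j<n. (E a i * E a j) * v j)"
    unfolding ip_def sum_distrib_right by (intro sum.cong refl) simp
  also have "\<dots> = (\<Sum>j<n. (\<Sum>a<n. E a i * E a j) * v j)"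
    unfolding sum_distrib_right by (rule sum.swap)
  also have "\<dots> = (\<Sum>j<n. of_bool (i = j) * v j)"
    using assms by (simp add: orthonormal_basis_def)
  also have "\<dots> = v i"
    using assms(2) by (simp add: of_bool_def if_distrib[of "\<lambda>x. x * _"] sum.delta cong: if_cong)
  finally show ?thesis .
qed

text \<open>The transpose is a right inverse of the square matrix of basis vectors, hence also a
  left inverse, and that is the second clause of the definition.\<close>

lemma orthonormal_basisI:
  assumes "\<And>a b. a < n \<Longrightarrow> b < n \<Longrightarrow> ip n (E a) (E b) = of_bool (a = b)"
  shows "orthonormal_basis n E"
proof -
  let ?P = "mat n n (\<lambda>(a, i). E a i)"
  have P: "?P \<in> carrier_mat n n" by simp
  have "?P * transpose_mat ?P = 1\<^sub>m n"
  proof (rule eq_matI)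
    fix a b assume "a < dim_row (1\<^sub>m n)" "b < dim_col (1\<^sub>m n)"
    then show "(?P * transpose_mat ?P) $$ (a, b) = 1\<^sub>m n $$ (a, b)"
      using assms[of a b] by (simp add: scalar_prod_def ip_def atLeast0LessThan)
  qed auto
  then have "transpose_mat ?P * ?P = 1\<^sub>m n"
    using mat_mult_left_right_inverse[OF P] by simp
  then have *: "(transpose_mat ?P * ?P) $$ (i, j) = 1\<^sub>m n $$ (i, j)" for i j
    by simp
  have "(\<Sum>a<n. E a i * E a j) = of_bool (i = j)" if "i < n" "j < n" for i j
    using *[of i j] that by (simp add: scalar_prod_def atLeast0LessThan of_bool_def)
  with assms show ?thesis
    by (simp add: orthonormal_basis_def)
qed

text \<open>Householder reflection exchanging \<open>e\<close> with the last standard basis vector.\<close>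

lemma orthonormal_basis_extending:
  assumes e: "ip (Suc n) e e = 1"
  shows "\<exists>h. orthonormal_basis (Suc n) h \<and> (\<forall>i<Suc n. h n i = e i)"
proof -
  define w where "w i = e i - of_bool (i = n)" for i
  \<comment> \<open>Here \<open>2 / 0 = 0\<close>: if \<open>e\<close> is already the last basis
    vector, \<open>h\<close> is the identity.\<close>
  define c where "c = 2 / ip (Suc n) w w"
  define h where "h j i = of_bool (i = j) - c * w i * w j" for j i
  have delta: "ip (Suc n) (\<lambda>i. of_bool (i = a)) v = v a" if "a < Suc n" for a v
    using that by (simp add: ip_def of_bool_def if_distrib[of "\<lambda>x. x * _"] sum.delta cong: if_cong)
  have delta': "ip (Suc n) v (\<lambda>i. of_bool (i = a)) = v a" if "a < Suc n" for a v
    using delta[OF that] by (subst ip_commute)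
  have w: "w = (\<lambda>i. e i - of_bool (i = n))" by (simp add: w_def fun_eq_iff)
  have ww: "ip (Suc n) w w = 2 - 2 * e n"
    unfolding w by (simp only: ip_diff_left ip_diff_right) (simp add: delta delta' e)
  have cc: "c * c * ip (Suc n) w w = 2 * c"
    by (simp add: c_def)
  have h: "h a = (\<lambda>i. of_bool (i = a) - (c * w a) * w i)" for a
    by (auto simp: h_def algebra_simps)
  have "ip (Suc n) (h a) (h b) = of_bool (a = b)" if "a < Suc n" "b < Suc n" for a b
  proof -
    have "ip (Suc n) (h a) (h b) =
        of_bool (a = b) - 2 * c * w a * w b + (c * c * ip (Suc n) w w) * (w a * w b)"
      unfolding h
      by (simp only: ip_diff_left ip_diff_right ip_scale_left ip_scale_right)
        (simp add: delta delta' that algebra_simps)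
    also have "\<dots> = of_bool (a = b)"
      unfolding cc by simp
    finally show ?thesis .
  qed
  then have "orthonormal_basis (Suc n) h"
    by (rule orthonormal_basisI)
  moreover have "h n i = e i" if "i < Suc n" for i
  proof (cases "ip (Suc n) w w = 0")
    case True
    then have "w i = 0" using that by (simp only: ip_eq_0_iff)
    then show ?thesis by (simp add: h_def w_def)
  next
    case False
    then have "c * w n = -1"
      unfolding c_def ww by (simp add: w_def field_simps)
    then have "h n i = of_bool (i = n) - (-1) * w i"
      unfolding h by simp
    then show ?thesis by (simp add: w_def)
  qed
  ultimately show ?thesis by blast
qed

text \<open>For a complex eigenvector \<open>x + i y\<close> with eigenvalue \<open>k\<close>,
  symmetry of the form on \<open>x\<close> and \<open>y\<close> forces
  \<open>Im k (|x|^2 + |y|^2) = 0\<close>. Hence \<open>k\<close> is real, and whichever of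
  \<open>x\<close>, \<open>y\<close> is nonzero is a real eigenvector.\<close>

lemma symmetric_real_eigenvector:
  assumes n: "n > 0" and sym: "symmetric_on n A"
  shows "\<exists>e l. ip n e e = 1 \<and> (\<forall>i<n. mv n A e i = l * e i)"
proof -
  let ?C = "mat n n (\<lambda>(i, j). complex_of_real (A i j))"
  have C: "?C \<in> carrier_mat n n" by simp
  from spectrum_non_empty[OF C n] obtain k where "k \<in> spectrum ?C" by blast
  then obtain z where z: "eigenvector ?C z k"
    by (auto simp: spectrum_def eigenvalue_def)
  have dz: "dim_vec z = n" and z0: "z \<noteq> 0\<^sub>v n" and eq: "?C *\<^sub>v z = k \<cdot>\<^sub>v z"
    using z by (auto simp: eigenvector_def)
  have comp: "(\<Sum>j<n. complex_of_real (A i j) * z $ j) = k * z $ i" if "i < n" for i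
  proof -
    have "(?C *\<^sub>v z) $ i = (k \<cdot>\<^sub>v z) $ i" by (simp add: eq)
    then show ?thesis using that dz by (simp add: scalar_prod_def atLeast0LessThan)
  qed
  define x where "x i = Re (z $ i)" for i
  define y where "y i = Im (z $ i)" for i
  have ex: "mv n A x i = Re k * x i - Im k * y i" if "i < n" for i
    using arg_cong[OF comp[OF that], of Re] by (simp add: mv_def x_def y_def)
  have ey: "mv n A y i = Re k * y i + Im k * x i" if "i < n" for i
    using arg_cong[OF comp[OF that], of Im] by (simp add: mv_def x_def y_def algebra_simps)
  have "ip n (mv n A x) y = Re k * ip n x y - Im k * ip n y y"
    using ip_cong[of n "mv n A x" "\<lambda>i. Re k * x i - Im k * y i" y y] ex
    by (simp add: ip_diff_left ip_scale_left)
  moreover have "ip n x (mv n A y) = Re k * ip n x y + Im k * ip n x x"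
    using ip_cong[of n x x "mv n A y" "\<lambda>i. Re k * y i + Im k * x i"] ey
    by (simp add: ip_add_right ip_scale_right)
  ultimately have "Im k * (ip n x x + ip n y y) = 0"
    using symmetric_on_ip[OF sym, of x y] by (simp add: algebra_simps)
  moreover have pos: "ip n x x > 0 \<or> ip n y y > 0"
  proof (rule ccontr)
    assume "\<not> ?thesis"
    then have "ip n x x = 0" "ip n y y = 0" using ip_nonneg[of n x] ip_nonneg[of n y] by auto
    then have "z $ i = 0" if "i < n" for i
      using that by (simp add: ip_eq_0_iff x_def y_def complex_eq_iff)
    then have "z = 0\<^sub>v n" using dz by (intro eq_vecI) auto
    with z0 show False by simp
  qed
  ultimately have "Im k = 0"
    using ip_nonneg[of n x] ip_nonneg[of n y] by (auto simp: add_nonneg_eq_0_iff)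
  then obtain u where u: "ip n u u > 0" "\<And>i. i < n \<Longrightarrow> mv n A u i = Re k * u i"
    using pos ex ey by force
  define e where "e i = (1 / sqrt (ip n u u)) * u i" for i
  have "ip n e e = 1"
    unfolding e_def[abs_def] ip_scale_left ip_scale_right using u(1) by simp
  moreover have "mv n A e i = Re k * e i" if "i < n" for i
    unfolding e_def[abs_def] mv_scale using u(2)[OF that] by simp
  ultimately show ?thesis by blast
qed

text \<open>Deflation: one unit eigenvector \<open>e\<close> is split off, and the compression of
  \<open>A\<close> to its orthogonal complement is symmetric again, of size
  \<open>n\<close>.\<close>

theorem spectral_theorem:
  assumes "symmetric_on n A"
  shows "\<exists>E l. eigensystem n A E l"
  using assms
proof (induction n arbitrary: A)
  case 0
  then show ?case by (auto simp: eigensystem_def orthonormal_basis_def)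
next
  case (Suc n)
  obtain e l0 where e: "ip (Suc n) e e = 1" "\<And>i. i < Suc n \<Longrightarrow> mv (Suc n) A e i = l0 * e i"
    using symmetric_real_eigenvector[OF _ Suc.prems] by auto
  obtain h where h: "orthonormal_basis (Suc n) h" "\<And>i. i < Suc n \<Longrightarrow> h n i = e i"
    using orthonormal_basis_extending[OF e(1)] by auto
  have ho: "ip (Suc n) (h a) (h b) = of_bool (a = b)" if "a < Suc n" "b < Suc n" for a b
    using h(1) that by (simp add: orthonormal_basis_def)
  \<comment> \<open>The compression of \<open>A\<close>, in the coordinates \<open>h 0\<close>, ...,
    \<open>h (n - 1)\<close> of the complement of \<open>e\<close>; \<open>G\<close> below lifts its
    eigenvectors back.\<close>
  define B where "B i j = ip (Suc n) (h i) (mv (Suc n) A (h j))" for i j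
  have "symmetric_on n B"
    unfolding symmetric_on_def B_def
    using symmetric_on_ip[OF Suc.prems] by (metis ip_commute)
  then obtain F l where F: "eigensystem n B F l"
    using Suc.IH by blast
  have Fo: "ip n (F a) (F b) = of_bool (a = b)" if "a < n" "b < n" for a b
    using F that by (simp add: eigensystem_def orthonormal_basis_def)
  have Fe: "mv n B (F a) i = l a * F a i" if "a < n" "i < n" for a i
    using F that by (simp add: eigensystem_def)
  define G where "G a = (\<lambda>i. \<Sum>j<n. F a j * h j i)" for a
  define E where "E a = (if a < n then G a else h n)" for a
  define l' where "l' a = (if a < n then l a else l0)" for a
  have hG: "ip (Suc n) (h i) (G a) = (if i < n then F a i else 0)" if "i < Suc n" for i a
  proof -
    have "ip (Suc n) (h i) (G a) = (\<Sum>j<n. F a j * of_bool (i = j))"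
      using that unfolding G_def ip_sum_right ip_scale_right by (simp add: ho)
    also have "\<dots> = (if i < n then F a i else 0)"
      by (simp add: of_bool_def if_distrib[of "\<lambda>x. _ * x"] sum.delta cong: if_cong)
    finally show ?thesis .
  qed
  have Gs: "G a = (\<lambda>i. \<Sum>j<n. F a j * h j i)" for a by (simp add: G_def)
  have GG: "ip (Suc n) (G a) (G b) = of_bool (a = b)" if "a < n" "b < n" for a b
  proof -
    have "ip (Suc n) (G a) (G b) = (\<Sum>j<n. F a j * ip (Suc n) (h j) (G b))"
      by (subst Gs) (simp add: ip_sum_left ip_scale_left)
    also have "\<dots> = ip n (F a) (F b)"
      by (simp add: hG ip_def[of n])
    finally show ?thesis using Fo that by simp
  qed
  have on: "orthonormal_basis (Suc n) E"
  proof (rule orthonormal_basisI)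
    fix a b assume "a < Suc n" "b < Suc n"
    then show "ip (Suc n) (E a) (E b) = of_bool (a = b)"
      using GG hG[of n b] hG[of n a] ho[of n n]
      by (auto simp: E_def less_Suc_eq ip_commute[of "Suc n" "G a" "h n"])
  qed
  have "mv (Suc n) A (E a) i = l' a * E a i" if "a < Suc n" "i < Suc n" for a i
  proof (cases "a < n")
    case False
    then have "a = n" using that by simp
    moreover have "mv (Suc n) A (h n) = mv (Suc n) A e"
      using h(2) by (intro mv_cong) auto
    ultimately show ?thesis
      using that e(2) h(2) by (simp add: E_def l'_def)
  next
    case True
    \<comment> \<open>In the basis \<open>h\<close>, the first \<open>n\<close> coordinates of
      \<open>A (G a)\<close> are those of \<open>B\<close>; the last vanishes because
      \<open>h n\<close> is an eigenvector orthogonal to \<open>G a\<close>.\<close>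
    have coef: "ip (Suc n) (h i) (mv (Suc n) A (G a)) = l a * (if i < n then F a i else 0)"
      if i: "i < Suc n" for i
    proof (cases "i < n")
      case True': True
      have "ip (Suc n) (h i) (mv (Suc n) A (G a)) = (\<Sum>j<n. F a j * B i j)"
        by (simp add: Gs mv_sum mv_scale ip_sum_right ip_scale_right B_def)
      also have "\<dots> = mv n B (F a) i" by (simp add: mv_def mult.commute)
      finally show ?thesis using Fe[OF True True'] True' by simp
    next
      case False
      then have "i = n" using i by simp
      have "ip (Suc n) (h n) (mv (Suc n) A (G a)) = ip (Suc n) (mv (Suc n) A (h n)) (G a)"
        using symmetric_on_ip[OF Suc.prems] by metis
      also have "mv (Suc n) A (h n) = mv (Suc n) A e"
        using h(2) by (intro mv_cong) auto
      also have "ip (Suc n) (mv (Suc n) A e) (G a) = ip (Suc n) (\<lambda>i. l0 * h n i) (G a)"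
        using e(2) h(2) by (intro ip_cong) auto
      also have "\<dots> = 0" by (simp add: ip_scale_left hG)
      finally show ?thesis using \<open>i = n\<close> by simp
    qed
    have "mv (Suc n) A (G a) i = (\<Sum>b<Suc n. ip (Suc n) (h b) (mv (Suc n) A (G a)) * h b i)"
      using orthonormal_basis_expand[OF h(1) that(2)] by simp
    also have "\<dots> = (\<Sum>b<Suc n. l a * (if b < n then F a b else 0) * h b i)"
      using coef by (intro sum.cong refl) (simp only: lessThan_iff)
    also have "\<dots> = l a * G a i"
      by (simp add: G_def sum_distrib_left algebra_simps)
    finally show ?thesis using True by (simp add: E_def l'_def)
  qed
  with on have "eigensystem (Suc n) A E l'"
    by (simp add: eigensystem_def)
  then show ?case by blast
qed

section \<open>A supermartingale for the trace exponential\<close>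

text \<open>The trace of the matrix exponential, expressed through eigenvalues instead of a series;
  \<open>trace_exp_eigensystem\<close> resolves the choice.\<close>

definition trace_exp :: "nat \<Rightarrow> (nat \<Rightarrow> nat \<Rightarrow> real) \<Rightarrow> real" where
  "trace_exp n A = (\<Sum>a<n. exp (snd (SOME (E, l). eigensystem n A E l) a))"

lemma trace_exp_eigensystem:
  assumes "symmetric_on n A"
  obtains E l where "eigensystem n A E l" "trace_exp n A = (\<Sum>a<n. exp (l a))"
proof -
  obtain E l where "eigensystem n A E l"
    using spectral_theorem[OF assms] by blast
  then have "case (SOME (E, l). eigensystem n A E l) of (E, l) \<Rightarrow> eigensystem n A E l"
    by (intro someI[of "\<lambda>(E, l). eigensystem n A E l" "(E, l)"]) simp
  then show ?thesis
    by (intro that[of "fst (SOME (E, l). eigensystem n A E l)"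
          "snd (SOME (E, l). eigensystem n A E l)"])
      (auto simp: trace_exp_def case_prod_beta)
qed

lemma eigensystem_ip_mv:
  assumes sym: "symmetric_on n A" and es: "eigensystem n A E l" and b: "b < n"
  shows "ip n (E b) (mv n A u) = l b * ip n (E b) u"
proof -
  have "ip n (E b) (mv n A u) = ip n (mv n A (E b)) u"
    by (simp add: symmetric_on_ip[OF sym])
  also have "\<dots> = ip n (\<lambda>i. l b * E b i) u"
    using es b by (intro ip_cong) (auto simp: eigensystem_def)
  finally show ?thesis by (simp add: ip_scale_left)
qed

lemma eigensystem_quadratic_form:
  assumes sym: "symmetric_on n A" and es: "eigensystem n A E l"
  shows "ip n u (mv n A u) = (\<Sum>a<n. l a * (ip n (E a) u)\<^sup>2)"
proof -
  have "ip n u (mv n A u) = (\<Sum>a<n. ip n (E a) u * ip n (E a) (mv n A u))"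
    using es orthonormal_basis_parseval[of n E] by (simp add: eigensystem_def)
  also have "\<dots> = (\<Sum>a<n. l a * (ip n (E a) u)\<^sup>2)"
    using eigensystem_ip_mv[OF sym es] by (simp add: power2_eq_square algebra_simps)
  finally show ?thesis .
qed

lemma eigensystem_sum_squares:
  assumes "eigensystem n A E l"
  shows "(\<Sum>a<n. (ip n (E a) u)\<^sup>2) = ip n u u"
  using assms orthonormal_basis_parseval[of n E u u] by (simp add: eigensystem_def power2_eq_square)

lemma eigensystem_unit:
  assumes "eigensystem n A E l" "a < n"
  shows "ip n (E a) (E a) = 1"
  using assms by (simp add: eigensystem_def orthonormal_basis_def)

lemma symmetric_on_add:
  "symmetric_on n A \<Longrightarrow> symmetric_on n B \<Longrightarrow> symmetric_on n (\<lambda>i j. A i j + B i j)"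
  by (simp add: symmetric_on_def)

lemma symmetric_on_diff:
  "symmetric_on n A \<Longrightarrow> symmetric_on n B \<Longrightarrow> symmetric_on n (\<lambda>i j. A i j - B i j)"
  by (simp add: symmetric_on_def)

lemma symmetric_on_scale: "symmetric_on n A \<Longrightarrow> symmetric_on n (\<lambda>i j. c * A i j)"
  by (simp add: symmetric_on_def)

lemma exp_tangent: "exp x + exp x * (y - x) \<le> exp (y :: real)"
proof -
  have "exp x * (1 + (y - x)) \<le> exp x * exp (y - x)"
    by (intro mult_left_mono exp_ge_add_one_self) auto
  then show ?thesis by (simp add: exp_diff algebra_simps)
qed

text \<open>Two tangent inequalities take the place of the mean value theorem. The symmetric factor
  \<open>exp x + exp y\<close> is what later separates into a sum over each of the two
  spectra.\<close>

lemma exp_diff_abs_le: "\<bar>exp y - exp x\<bar> \<le> (exp x + exp y) * \<bar>y - x :: real\<bar>"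
proof -
  have *: "exp x - exp y \<le> exp x * \<bar>y - x\<bar>" for x y :: real
  proof -
    have "exp x - exp y \<le> exp x * (x - y)"
      using exp_tangent[of x y] by (simp add: algebra_simps)
    also have "\<dots> \<le> exp x * \<bar>y - x\<bar>"
      by (intro mult_left_mono) auto
    finally show ?thesis .
  qed
  have "\<bar>exp y - exp x\<bar> \<le> exp x * \<bar>y - x\<bar> + exp y * \<bar>y - x\<bar>"
    using *[of x y] *[of y x] by (auto simp: abs_minus_commute abs_le_iff intro: add_increasing add_increasing2)
  then show ?thesis by (simp add: algebra_simps)
qed

lemma exp_bregman_le: "exp y - exp x - exp x * (y - x) \<le> (exp x + exp y) * (y - x :: real)\<^sup>2"
proof -
  have "exp y - exp x - exp x * (y - x) \<le> exp y * (y - x) - exp x * (y - x)"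
    using exp_tangent[of y x] by (simp add: algebra_simps)
  also have "\<dots> = (exp y - exp x) * (y - x)" by (simp add: algebra_simps)
  also have "\<dots> \<le> \<bar>exp y - exp x\<bar> * \<bar>y - x\<bar>"
    by (metis abs_ge_self abs_mult)
  also have "\<dots> \<le> (exp x + exp y) * \<bar>y - x\<bar> * \<bar>y - x\<bar>"
    by (intro mult_right_mono exp_diff_abs_le) auto
  also have "\<dots> = (exp x + exp y) * (y - x)\<^sup>2"
    by (simp add: power2_eq_square)
  finally show ?thesis .
qed

text \<open>
  The squared inner products of two eigenbases form a doubly stochastic matrix, which reduces trace
  inequalities for \<open>A\<close> and \<open>A + X\<close> to scalar inequalities between eigenvalues.
\<close>

lemma trace_exp_bregman:
  assumes symA: "symmetric_on n A" and symX: "symmetric_on n X"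
    and EA: "eigensystem n A E \<alpha>" and EB: "eigensystem n (\<lambda>i j. A i j + X i j) F \<beta>"
  shows "(\<Sum>b<n. exp (\<beta> b)) - (\<Sum>a<n. exp (\<alpha> a)) - (\<Sum>a<n. exp (\<alpha> a) * ip n (E a) (mv n X (E a))) =
    (\<Sum>a<n. \<Sum>b<n. (ip n (E a) (F b))\<^sup>2 *
       (exp (\<beta> b) - exp (\<alpha> a) - exp (\<alpha> a) * (\<beta> b - \<alpha> a)))"
proof -
  let ?B = "\<lambda>i j. A i j + X i j"
  let ?w = "\<lambda>a b. (ip n (E a) (F b))\<^sup>2"
  have symB: "symmetric_on n ?B" by (rule symmetric_on_add[OF symA symX])
  have wb: "(\<Sum>b<n. ?w a b) = 1" if "a < n" for a
    using eigensystem_sum_squares[OF EB, of "E a"] eigensystem_unit[OF EA that] by (simp add: ip_commute)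
  have wa: "(\<Sum>a<n. ?w a b) = 1" if "b < n" for b
    using eigensystem_sum_squares[OF EA, of "F b"] eigensystem_unit[OF EB that] by simp
  have X: "ip n (E a) (mv n X (E a)) = (\<Sum>b<n. \<beta> b * ?w a b) - \<alpha> a" if a: "a < n" for a
  proof -
    have "ip n (E a) (mv n ?B (E a)) = ip n (E a) (mv n A (E a)) + ip n (E a) (mv n X (E a))"
      by (simp add: mv_mat_add ip_add_right)
    moreover have "ip n (E a) (mv n ?B (E a)) = (\<Sum>b<n. \<beta> b * ?w a b)"
      using eigensystem_quadratic_form[OF symB EB, of "E a"] by (simp add: ip_commute)
    moreover have "ip n (E a) (mv n A (E a)) = \<alpha> a"
      using eigensystem_ip_mv[OF symA EA a, of "E a"] eigensystem_unit[OF EA a] by simp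
    ultimately show ?thesis by simp
  qed
  have "(\<Sum>a<n. \<Sum>b<n. ?w a b * (exp (\<beta> b) - exp (\<alpha> a) - exp (\<alpha> a) * (\<beta> b - \<alpha> a))) =
      (\<Sum>a<n. \<Sum>b<n. ?w a b * exp (\<beta> b)) - (\<Sum>a<n. \<Sum>b<n. ?w a b * exp (\<alpha> a)) -
      (\<Sum>a<n. \<Sum>b<n. ?w a b * (exp (\<alpha> a) * (\<beta> b - \<alpha> a)))"
    by (simp add: sum_subtractf right_diff_distrib)
  also have "(\<Sum>a<n. \<Sum>b<n. ?w a b * exp (\<beta> b)) = (\<Sum>b<n. \<Sum>a<n. ?w a b * exp (\<beta> b))"
    by (rule sum.swap)
  also have "\<dots> = (\<Sum>b<n. exp (\<beta> b))"
    by (intro sum.cong refl) (simp add: sum_distrib_right[symmetric] wa)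
  also have "(\<Sum>a<n. \<Sum>b<n. ?w a b * exp (\<alpha> a)) = (\<Sum>a<n. exp (\<alpha> a))"
    by (intro sum.cong refl) (simp add: sum_distrib_right[symmetric] wb)
  also have "(\<Sum>a<n. \<Sum>b<n. ?w a b * (exp (\<alpha> a) * (\<beta> b - \<alpha> a))) =
      (\<Sum>a<n. exp (\<alpha> a) * ((\<Sum>b<n. \<beta> b * ?w a b) - \<alpha> a * (\<Sum>b<n. ?w a b)))"
    by (simp add: sum_distrib_left sum_subtractf algebra_simps)
  also have "\<dots> = (\<Sum>a<n. exp (\<alpha> a) * ip n (E a) (mv n X (E a)))"
    by (intro sum.cong refl) (simp add: wb X)
  finally show ?thesis by simp
qed

text \<open>Klein's inequality: by convexity of \<open>exp\<close>, every term of the double sum in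
  \<open>trace_exp_bregman\<close> is nonnegative.\<close>

lemma trace_exp_klein:
  assumes symA: "symmetric_on n A" and symX: "symmetric_on n X"
    and EA: "eigensystem n A E \<alpha>"
  shows "(\<Sum>a<n. exp (\<alpha> a)) + (\<Sum>a<n. exp (\<alpha> a) * ip n (E a) (mv n X (E a)))
    \<le> trace_exp n (\<lambda>i j. A i j + X i j)"
proof -
  obtain F \<beta> where EB: "eigensystem n (\<lambda>i j. A i j + X i j) F \<beta>"
    and tr: "trace_exp n (\<lambda>i j. A i j + X i j) = (\<Sum>a<n. exp (\<beta> a))"
    using trace_exp_eigensystem[OF symmetric_on_add[OF symA symX]] by blast
  have "(\<Sum>a<n. \<Sum>b<n. (ip n (E a) (F b))\<^sup>2 *
       (exp (\<beta> b) - exp (\<alpha> a) - exp (\<alpha> a) * (\<beta> b - \<alpha> a))) \<ge> 0"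
  proof (intro sum_nonneg mult_nonneg_nonneg)
    fix a b
    show "exp (\<beta> b) - exp (\<alpha> a) - exp (\<alpha> a) * (\<beta> b - \<alpha> a) \<ge> 0"
      using exp_tangent[of "\<alpha> a" "\<beta> b"] by (simp add: algebra_simps)
  qed simp
  then show ?thesis
    using trace_exp_bregman[OF symA symX EA EB] tr by linarith
qed

text \<open>
  With \<open>p\<close> and \<open>q\<close> the weights \<open>tr (X\<^sup>2 exp A)\<close> and \<open>tr (X\<^sup>2 exp (A + X))\<close>, the second-order remainder of
  \<open>tr (exp (A + X))\<close> is at most \<open>p + q\<close>. A divided-difference estimate gives \<open>\<bar>q - p\<bar> \<le> (p + q) / 2\<close>, hence
  \<open>q \<le> 3 p\<close>, so the correlation between \<open>X\<close> and \<open>exp (A + X)\<close> is harmless and neither the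
  Golden-Thompson inequality nor Lieb's theorem is needed.
\<close>

lemma trace_exp_perturb_le:
  assumes symA: "symmetric_on n A" and symX: "symmetric_on n X"
    and small: "\<And>u. ip n (mv n X u) (mv n X u) \<le> ip n u u / 4"
    and EA: "eigensystem n A E \<alpha>"
  shows "trace_exp n (\<lambda>i j. A i j + X i j) \<le> (\<Sum>a<n. exp (\<alpha> a)) +
     (\<Sum>a<n. exp (\<alpha> a) * ip n (E a) (mv n X (E a))) +
     4 * (\<Sum>a<n. exp (\<alpha> a) * ip n (mv n X (E a)) (mv n X (E a)))"
proof -
  let ?B = "\<lambda>i j. A i j + X i j"
  obtain F \<beta> where EB: "eigensystem n ?B F \<beta>"
    and tr: "trace_exp n ?B = (\<Sum>a<n. exp (\<beta> a))"
    using trace_exp_eigensystem[OF symmetric_on_add[OF symA symX]] by blast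
  have symB: "symmetric_on n ?B" by (rule symmetric_on_add[OF symA symX])
  define Q where "Q v = ip n (mv n X v) (mv n X v)" for v
  define x where "x a b = ip n (E a) (mv n X (F b))" for a b
  define y where "y a b = ip n (mv n X (E a)) (mv n X (F b))" for a b
  define p where "p = (\<Sum>a<n. exp (\<alpha> a) * Q (E a))"
  define q where "q = (\<Sum>b<n. exp (\<beta> b) * Q (F b))"
  have x': "x a b = ip n (F b) (mv n X (E a))" for a b
    unfolding x_def by (metis symmetric_on_ip[OF symX] ip_commute)
  \<comment> \<open>A matrix element of \<open>X\<close> between eigenvectors of \<open>A\<close>
    and of \<open>A + X\<close>; it turns eigenvalue differences into square-summable
    quantities.\<close>
  have gap: "(\<beta> b - \<alpha> a) * ip n (E a) (F b) = x a b" if "a < n" "b < n" for a b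
  proof -
    have "ip n (F b) (mv n ?B (E a)) = \<beta> b * ip n (E a) (F b)"
      using eigensystem_ip_mv[OF symB EB that(2)] by (simp add: ip_commute)
    moreover have "ip n (F b) (mv n ?B (E a)) = ip n (F b) (mv n A (E a)) + x a b"
      by (simp add: mv_mat_add ip_add_right x')
    moreover have "ip n (F b) (mv n A (E a)) = \<alpha> a * ip n (E a) (F b)"
      using eigensystem_ip_mv[OF symA EA that(1), of "F b"] symmetric_on_ip[OF symA, of "F b" "E a"]
      by (simp add: ip_commute)
    ultimately show ?thesis by (simp add: algebra_simps)
  qed
  have xb: "(\<Sum>b<n. (x a b)\<^sup>2) = Q (E a)" for a
    unfolding x' Q_def by (rule eigensystem_sum_squares[OF EB])
  have xa: "(\<Sum>a<n. (x a b)\<^sup>2) = Q (F b)" for b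
    unfolding x_def Q_def by (rule eigensystem_sum_squares[OF EA])
  have QQ: "Q (mv n X v) \<le> Q v / 4" for v
    unfolding Q_def by (rule small)
  have yb: "(\<Sum>b<n. (y a b)\<^sup>2) \<le> Q (E a) / 4" for a
  proof -
    have "y a b = ip n (F b) (mv n X (mv n X (E a)))" for b
      unfolding y_def by (metis symmetric_on_ip[OF symX] ip_commute)
    then show ?thesis
      using eigensystem_sum_squares[OF EB, of "mv n X (mv n X (E a))"] QQ[of "E a"] by (simp add: Q_def)
  qed
  have ya: "(\<Sum>a<n. (y a b)\<^sup>2) \<le> Q (F b) / 4" for b
  proof -
    have "y a b = ip n (E a) (mv n X (mv n X (F b)))" for a
      unfolding y_def by (rule symmetric_on_ip[OF symX])
    then show ?thesis
      using eigensystem_sum_squares[OF EA, of "mv n X (mv n X (F b))"] QQ[of "F b"] by (simp add: Q_def)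
  qed
  \<comment> \<open>The weights in \<open>|x y| <= x^2 / 4 + y^2\<close> balance the two sums, since
    \<open>small\<close> makes the square sum of \<open>y\<close> at most a quarter of that of
    \<open>x\<close>.\<close>
  have xyb: "(\<Sum>b<n. \<bar>x a b * y a b\<bar>) \<le> Q (E a) / 2" for a
  proof -
    have "(\<Sum>b<n. \<bar>x a b * y a b\<bar>) \<le> (\<Sum>b<n. (x a b)\<^sup>2 / 4 + (y a b)\<^sup>2)"
    proof (rule sum_mono)
      fix b show "\<bar>x a b * y a b\<bar> \<le> (x a b)\<^sup>2 / 4 + (y a b)\<^sup>2"
        using sum_squares_ge_zero[of "\<bar>x a b\<bar> / 2 - \<bar>y a b\<bar>" 0]
        by (simp add: power2_eq_square abs_mult algebra_simps)
    qed
    also have "\<dots> = Q (E a) / 4 + (\<Sum>b<n. (y a b)\<^sup>2)"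
      by (simp add: sum.distrib sum_divide_distrib[symmetric] xb)
    finally show ?thesis using yb[of a] by simp
  qed
  have xya: "(\<Sum>a<n. \<bar>x a b * y a b\<bar>) \<le> Q (F b) / 2" for b
  proof -
    have "(\<Sum>a<n. \<bar>x a b * y a b\<bar>) \<le> (\<Sum>a<n. (x a b)\<^sup>2 / 4 + (y a b)\<^sup>2)"
    proof (rule sum_mono)
      fix a show "\<bar>x a b * y a b\<bar> \<le> (x a b)\<^sup>2 / 4 + (y a b)\<^sup>2"
        using sum_squares_ge_zero[of "\<bar>x a b\<bar> / 2 - \<bar>y a b\<bar>" 0]
        by (simp add: power2_eq_square abs_mult algebra_simps)
    qed
    also have "\<dots> = Q (F b) / 4 + (\<Sum>a<n. (y a b)\<^sup>2)"
      by (simp add: sum.distrib sum_divide_distrib[symmetric] xa)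
    finally show ?thesis using ya[of b] by simp
  qed
  have split: "(\<Sum>a<n. \<Sum>b<n. (exp (\<alpha> a) + exp (\<beta> b)) * f a b) =
      (\<Sum>a<n. exp (\<alpha> a) * (\<Sum>b<n. f a b)) + (\<Sum>b<n. exp (\<beta> b) * (\<Sum>a<n. f a b))" for f
  proof -
    have "(\<Sum>a<n. \<Sum>b<n. (exp (\<alpha> a) + exp (\<beta> b)) * f a b) =
        (\<Sum>a<n. \<Sum>b<n. exp (\<alpha> a) * f a b) + (\<Sum>a<n. \<Sum>b<n. exp (\<beta> b) * f a b)"
      by (simp add: sum.distrib algebra_simps)
    also have "(\<Sum>a<n. \<Sum>b<n. exp (\<beta> b) * f a b) = (\<Sum>b<n. \<Sum>a<n. exp (\<beta> b) * f a b)"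
      by (rule sum.swap)
    finally show ?thesis by (simp add: sum_distrib_left)
  qed
  have q': "q = (\<Sum>a<n. \<Sum>b<n. exp (\<beta> b) * (ip n (E a) (F b) * y a b))"
  proof -
    have "Q (F b) = (\<Sum>a<n. ip n (E a) (F b) * y a b)" for b
    proof -
      have "Q (F b) = ip n (F b) (mv n X (mv n X (F b)))"
        unfolding Q_def by (rule symmetric_on_ip[OF symX])
      also have "\<dots> = (\<Sum>a<n. ip n (E a) (F b) * ip n (E a) (mv n X (mv n X (F b))))"
        using EA by (subst orthonormal_basis_parseval) (auto simp: eigensystem_def)
      finally show ?thesis by (simp add: y_def symmetric_on_ip[OF symX])
    qed
    then have "q = (\<Sum>b<n. \<Sum>a<n. exp (\<beta> b) * (ip n (E a) (F b) * y a b))"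
      by (simp add: q_def sum_distrib_left)
    then show ?thesis by (subst sum.swap)
  qed
  have p': "p = (\<Sum>a<n. \<Sum>b<n. exp (\<alpha> a) * (ip n (E a) (F b) * y a b))"
  proof -
    have "Q (E a) = (\<Sum>b<n. ip n (E a) (F b) * y a b)" for a
    proof -
      have "Q (E a) = ip n (E a) (mv n X (mv n X (E a)))"
        unfolding Q_def by (rule symmetric_on_ip[OF symX])
      also have "\<dots> = (\<Sum>b<n. ip n (F b) (E a) * ip n (F b) (mv n X (mv n X (E a))))"
        using EB by (subst orthonormal_basis_parseval) (auto simp: eigensystem_def)
      also have "\<dots> = (\<Sum>b<n. ip n (E a) (F b) * y a b)"
        unfolding y_def by (metis symmetric_on_ip[OF symX] ip_commute)
      finally show ?thesis .
    qed
    then show ?thesis by (simp add: p_def sum_distrib_left)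
  qed
  \<comment> \<open>Both traces expand over the same overlaps, so their difference carries
    differences of \<open>exp\<close>; \<open>gap\<close> trades the resulting factor
    \<open>\<beta> b - \<alpha> a\<close> for \<open>x a b\<close>.\<close>
  have "q - p = (\<Sum>a<n. \<Sum>b<n. (exp (\<beta> b) - exp (\<alpha> a)) * (ip n (E a) (F b) * y a b))"
    unfolding p' q' by (simp add: sum_subtractf left_diff_distrib)
  also have "\<dots> \<le> (\<Sum>a<n. \<Sum>b<n. (exp (\<alpha> a) + exp (\<beta> b)) * \<bar>x a b * y a b\<bar>)"
  proof (intro sum_mono)
    fix a b assume ab: "a \<in> {..<n}" "b \<in> {..<n}"
    have "(exp (\<beta> b) - exp (\<alpha> a)) * (ip n (E a) (F b) * y a b) \<le>
        \<bar>exp (\<beta> b) - exp (\<alpha> a)\<bar> * (\<bar>ip n (E a) (F b)\<bar> * \<bar>y a b\<bar>)"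
      by (metis abs_ge_self abs_mult)
    also have "\<dots> \<le> ((exp (\<alpha> a) + exp (\<beta> b)) * \<bar>\<beta> b - \<alpha> a\<bar>) * (\<bar>ip n (E a) (F b)\<bar> * \<bar>y a b\<bar>)"
      by (intro mult_right_mono exp_diff_abs_le) auto
    also have "\<dots> = (exp (\<alpha> a) + exp (\<beta> b)) * \<bar>((\<beta> b - \<alpha> a) * ip n (E a) (F b)) * y a b\<bar>"
      by (simp add: abs_mult)
    finally show "(exp (\<beta> b) - exp (\<alpha> a)) * (ip n (E a) (F b) * y a b) \<le>
        (exp (\<alpha> a) + exp (\<beta> b)) * \<bar>x a b * y a b\<bar>"
      using gap ab by simp
  qed
  also have "\<dots> \<le> (\<Sum>a<n. exp (\<alpha> a) * (Q (E a) / 2)) + (\<Sum>b<n. exp (\<beta> b) * (Q (F b) / 2))"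
    unfolding split by (intro add_mono sum_mono mult_left_mono xya xyb) auto
  also have "\<dots> = (p + q) / 2"
    by (simp add: p_def q_def sum_divide_distrib[symmetric] add_divide_distrib)
  finally have q3p: "q \<le> 3 * p" by simp
  have "(\<Sum>a<n. \<Sum>b<n. (ip n (E a) (F b))\<^sup>2 *
       (exp (\<beta> b) - exp (\<alpha> a) - exp (\<alpha> a) * (\<beta> b - \<alpha> a))) \<le>
      (\<Sum>a<n. \<Sum>b<n. (exp (\<alpha> a) + exp (\<beta> b)) * (x a b)\<^sup>2)"
  proof (intro sum_mono)
    fix a b assume ab: "a \<in> {..<n}" "b \<in> {..<n}"
    have "(ip n (E a) (F b))\<^sup>2 * (exp (\<beta> b) - exp (\<alpha> a) - exp (\<alpha> a) * (\<beta> b - \<alpha> a)) \<le>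
        (ip n (E a) (F b))\<^sup>2 * ((exp (\<alpha> a) + exp (\<beta> b)) * (\<beta> b - \<alpha> a)\<^sup>2)"
      by (intro mult_left_mono exp_bregman_le) auto
    also have "\<dots> = (exp (\<alpha> a) + exp (\<beta> b)) * ((\<beta> b - \<alpha> a) * ip n (E a) (F b))\<^sup>2"
      by (simp add: power_mult_distrib)
    finally show "(ip n (E a) (F b))\<^sup>2 * (exp (\<beta> b) - exp (\<alpha> a) - exp (\<alpha> a) * (\<beta> b - \<alpha> a)) \<le>
        (exp (\<alpha> a) + exp (\<beta> b)) * (x a b)\<^sup>2"
      using gap ab by simp
  qed
  also have "\<dots> = p + q"
    unfolding split xa xb p_def q_def by simp
  finally show ?thesis
    using trace_exp_bregman[OF symA symX EA EB] tr q3p unfolding p_def Q_def by linarith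
qed

text \<open>Subtracting \<open>4 V\<close> in the exponent pays in advance for the second-order
  remainder, whose factor 4 is that of \<open>trace_exp_perturb_le\<close>. The first-order term
  vanishes by centring, and Klein's inequality puts \<open>4 V\<close> back.\<close>

lemma trace_exp_supermartingale_step:
  fixes H V :: "nat \<Rightarrow> nat \<Rightarrow> real" and X :: "'a \<Rightarrow> nat \<Rightarrow> nat \<Rightarrow> real" and p :: "'a \<Rightarrow> real"
  assumes Y: "\<And>y. y \<in> Y \<Longrightarrow> p y \<ge> 0" "(\<Sum>y\<in>Y. p y) = 1"
    and symH: "symmetric_on n H" and symV: "symmetric_on n V"
    and symX: "\<And>y. y \<in> Y \<Longrightarrow> symmetric_on n (X y)"
    and small: "\<And>y u. y \<in> Y \<Longrightarrow> ip n (mv n (X y) u) (mv n (X y) u) \<le> ip n u u / 4"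
    and centred: "\<And>i j. i < n \<Longrightarrow> j < n \<Longrightarrow> (\<Sum>y\<in>Y. p y * X y i j) = 0"
    and var: "\<And>u. (\<Sum>y\<in>Y. p y * ip n (mv n (X y) u) (mv n (X y) u)) \<le> ip n u (mv n V u)"
  shows "(\<Sum>y\<in>Y. p y * trace_exp n (\<lambda>i j. H i j - 4 * V i j + X y i j)) \<le> trace_exp n H"
proof -
  let ?A = "\<lambda>i j. H i j - 4 * V i j"
  have symA: "symmetric_on n ?A"
    by (intro symmetric_on_diff symmetric_on_scale symH symV)
  obtain E \<alpha> where EA: "eigensystem n ?A E \<alpha>"
    using spectral_theorem[OF symA] by blast
  have mean: "(\<Sum>y\<in>Y. p y * ip n (E a) (mv n (X y) (E a))) = 0" for a
  proof -
    have "(\<Sum>y\<in>Y. p y * ip n (E a) (mv n (X y) (E a))) =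
        (\<Sum>y\<in>Y. \<Sum>i<n. \<Sum>j<n. p y * X y i j * (E a i * E a j))"
      by (simp add: ip_def mv_def sum_distrib_left algebra_simps)
    also have "\<dots> = (\<Sum>i<n. \<Sum>y\<in>Y. \<Sum>j<n. p y * X y i j * (E a i * E a j))"
      by (rule sum.swap)
    also have "\<dots> = (\<Sum>i<n. \<Sum>j<n. \<Sum>y\<in>Y. p y * X y i j * (E a i * E a j))"
      by (rule sum.cong[OF refl], rule sum.swap)
    also have "\<dots> = 0"
      by (simp add: sum_distrib_right[symmetric] centred)
    finally show ?thesis .
  qed
  let ?e = "\<Sum>a<n. exp (\<alpha> a)"
  have "(\<Sum>y\<in>Y. p y * trace_exp n (\<lambda>i j. ?A i j + X y i j)) \<le>
     (\<Sum>y\<in>Y. p y * (?e + (\<Sum>a<n. exp (\<alpha> a) * ip n (E a) (mv n (X y) (E a))) +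
       4 * (\<Sum>a<n. exp (\<alpha> a) * ip n (mv n (X y) (E a)) (mv n (X y) (E a)))))"
    using Y(1) by (intro sum_mono mult_left_mono trace_exp_perturb_le symA symX small EA) auto
  also have "\<dots> = (\<Sum>y\<in>Y. p y * ?e) +
       (\<Sum>y\<in>Y. \<Sum>a<n. exp (\<alpha> a) * (p y * ip n (E a) (mv n (X y) (E a)))) +
       4 * (\<Sum>y\<in>Y. \<Sum>a<n. exp (\<alpha> a) * (p y * ip n (mv n (X y) (E a)) (mv n (X y) (E a))))"
    by (simp add: sum.distrib sum_distrib_left distrib_left mult.left_commute mult.commute mult.assoc)
  also have "(\<Sum>y\<in>Y. \<Sum>a<n. exp (\<alpha> a) * (p y * ip n (E a) (mv n (X y) (E a)))) =
      (\<Sum>a<n. exp (\<alpha> a) * (\<Sum>y\<in>Y. p y * ip n (E a) (mv n (X y) (E a))))"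
    unfolding sum_distrib_left by (rule sum.swap)
  also have "(\<Sum>y\<in>Y. \<Sum>a<n. exp (\<alpha> a) * (p y * ip n (mv n (X y) (E a)) (mv n (X y) (E a)))) =
      (\<Sum>a<n. exp (\<alpha> a) * (\<Sum>y\<in>Y. p y * ip n (mv n (X y) (E a)) (mv n (X y) (E a))))"
    unfolding sum_distrib_left by (rule sum.swap)
  also have "\<dots> \<le> (\<Sum>a<n. exp (\<alpha> a) * ip n (E a) (mv n V (E a)))"
    by (intro sum_mono mult_left_mono var) auto
  also have "(\<Sum>y\<in>Y. p y * ?e) = ?e"
    by (simp only: sum_distrib_right[symmetric] Y(2) mult_1_left)
  finally have "(\<Sum>y\<in>Y. p y * trace_exp n (\<lambda>i j. ?A i j + X y i j)) \<le>
      ?e + 4 * (\<Sum>a<n. exp (\<alpha> a) * ip n (E a) (mv n V (E a)))"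
    by (simp add: mean)
  also have "\<dots> = ?e + (\<Sum>a<n. exp (\<alpha> a) * ip n (E a) (mv n (\<lambda>i j. 4 * V i j) (E a)))"
    by (simp add: mv_mat_scale ip_scale_right sum_distrib_left mult.left_commute)
  also have "\<dots> \<le> trace_exp n (\<lambda>i j. ?A i j + 4 * V i j)"
    by (rule trace_exp_klein[OF symA symmetric_on_scale[OF symV] EA])
  finally show ?thesis by simp
qed

text \<open>Jensen's inequality for the spectral distribution of \<open>v\<close>, whose weights are
  at most 1. It converts a large value of the form at any unit vector into a large trace.\<close>

lemma exp_quadratic_form_le_trace_exp:
  assumes sym: "symmetric_on n A" and v: "ip n v v = 1"
  shows "exp (ip n v (mv n A v)) \<le> trace_exp n A"
proof -
  obtain E l where EA: "eigensystem n A E l" and tr: "trace_exp n A = (\<Sum>a<n. exp (l a))"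
    using trace_exp_eigensystem[OF sym] by blast
  let ?w = "\<lambda>a. (ip n (E a) v)\<^sup>2"
  let ?c = "ip n v (mv n A v)"
  have w: "(\<Sum>a<n. ?w a) = 1"
    using eigensystem_sum_squares[OF EA, of v] v by simp
  have c: "?c = (\<Sum>a<n. l a * ?w a)"
    by (rule eigensystem_quadratic_form[OF sym EA])
  \<comment> \<open>The added bracket is zero; it makes the tangent of \<open>exp\<close> at
    \<open>?c\<close> appear under each weight.\<close>
  have "exp ?c = (\<Sum>a<n. ?w a) * exp ?c + exp ?c * ((\<Sum>a<n. l a * ?w a) - ?c * (\<Sum>a<n. ?w a))"
    using c w by simp
  also have "\<dots> = (\<Sum>a<n. ?w a * (exp ?c + exp ?c * (l a - ?c)))"
    by (simp add: sum_distrib_left sum_distrib_right sum.distrib sum_subtractf algebra_simps)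
  also have "\<dots> \<le> (\<Sum>a<n. ?w a * exp (l a))"
    by (intro sum_mono mult_left_mono exp_tangent) auto
  also have "\<dots> \<le> (\<Sum>a<n. exp (l a))"
  proof (rule sum_mono)
    fix a assume "a \<in> {..<n}"
    then have "?w a \<le> 1"
      using w member_le_sum[of a "{..<n}" ?w] by auto
    then show "?w a * exp (l a) \<le> exp (l a)" by simp
  qed
  finally show ?thesis using tr by simp
qed

lemma trace_exp_0: "trace_exp n (\<lambda>i j. 0) = real n"
proof -
  have sym: "symmetric_on n (\<lambda>i j. 0)" by (simp add: symmetric_on_def)
  obtain E l where EA: "eigensystem n (\<lambda>i j. 0) E l"
    and tr: "trace_exp n (\<lambda>i j. 0) = (\<Sum>a<n. exp (l a))"
    using trace_exp_eigensystem[OF sym] by blast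
  have "l a = 0" if "a < n" for a
    using eigensystem_ip_mv[OF sym EA that, of "E a"] eigensystem_unit[OF EA that]
    by (simp add: mv_def ip_def)
  then show ?thesis using tr by simp
qed

section \<open>The second eigenvalue\<close>

lemma mset_real_eigenvalues: "mset (real_eigenvalues A) = proots (char_poly A)"
  by (simp add: real_eigenvalues_def)

lemma sorted_real_eigenvalues: "sorted (rev (real_eigenvalues A))"
  by (simp add: real_eigenvalues_def)

lemma char_poly_eigensystem:
  assumes A: "A \<in> carrier_mat n n" and es: "eigensystem n (\<lambda>i j. A $$ (i, j)) F m"
  shows "char_poly A = (\<Prod>a\<leftarrow>map m [0..<n]. [:- a, 1:])"
proof -
  let ?P = "mat n n (\<lambda>(i, a). F a i)" and ?D = "mat n n (\<lambda>(a, b). if a = b then m a else 0)"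
  have on: "orthonormal_basis n F" using es by (simp add: eigensystem_def)
  have QP: "transpose_mat ?P * ?P = 1\<^sub>m n"
    using on by (intro eq_matI) (auto simp: scalar_prod_def atLeast0LessThan orthonormal_basis_def ip_def)
  have PQ: "?P * transpose_mat ?P = 1\<^sub>m n"
    using on by (intro eq_matI) (auto simp: scalar_prod_def atLeast0LessThan orthonormal_basis_def)
  have "A * ?P = ?P * ?D"
  proof (rule eq_matI)
    fix i a assume "i < dim_row (?P * ?D)" "a < dim_col (?P * ?D)"
    then have ia: "i < n" "a < n" by auto
    have "(A * ?P) $$ (i, a) = mv n (\<lambda>i j. A $$ (i, j)) (F a) i"
      using ia A by (simp add: scalar_prod_def atLeast0LessThan mv_def)
    also have "\<dots> = m a * F a i" using es ia by (simp add: eigensystem_def)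
    also have "\<dots> = (?P * ?D) $$ (i, a)"
      using ia by (simp add: scalar_prod_def atLeast0LessThan if_distrib[of "\<lambda>x. _ * x"] sum.delta' sum.delta cong: if_cong)
    finally show "(A * ?P) $$ (i, a) = (?P * ?D) $$ (i, a)" .
  qed (use A in auto)
  then have "?P * ?D * transpose_mat ?P = A * (?P * transpose_mat ?P)"
    using A by (metis assoc_mult_mat mat_carrier transpose_carrier_mat)
  then have "A = ?P * ?D * transpose_mat ?P"
    using A by (simp add: PQ)
  then have "similar_mat A ?D"
    using A PQ QP by (intro similar_matI[of _ _ ?P "transpose_mat ?P" n]) auto
  then have "char_poly A = char_poly ?D"
    by (rule char_poly_similar)
  also have "\<dots> = (\<Prod>a\<leftarrow>diag_mat ?D. [:- a, 1:])"
    by (rule char_poly_upper_triangular[of _ n]) auto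
  also have "diag_mat ?D = map m [0..<n]"
    by (auto simp: diag_mat_def)
  finally show ?thesis .
qed

text \<open>The characteristic polynomial forces the sorted root list to be a permutation of the
  eigenvalues of an orthonormal eigenbasis; relabelling that basis matches the list entry by
  entry.\<close>

lemma eigensystem_real_eigenvalues:
  assumes A: "A \<in> carrier_mat n n" and sym: "symmetric_on n (\<lambda>i j. A $$ (i, j))"
  shows "\<exists>E. eigensystem n (\<lambda>i j. A $$ (i, j)) E (\<lambda>a. real_eigenvalues A ! a) \<and>
     length (real_eigenvalues A) = n"
proof -
  obtain F m where F: "eigensystem n (\<lambda>i j. A $$ (i, j)) F m"
    using spectral_theorem[OF sym] by blast
  let ?xs = "real_eigenvalues A" and ?ys = "map m [0..<n]"
  have "proots (\<Prod>a\<leftarrow>ys. [:- a, 1:]) = mset ys" for ys :: "real list"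
  proof (induction ys)
    case (Cons a ys)
    have "(\<Prod>a\<leftarrow>ys. [:- a, 1:]) \<noteq> 0" by (auto simp: prod_list_zero_iff)
    then show ?case using Cons by (simp add: proots_mult del: mult_pCons_left)
  qed simp
  then have "mset ?xs = mset ?ys"
    by (simp only: mset_real_eigenvalues char_poly_eigensystem[OF A F])
  then obtain p where p: "p permutes {..<length ?ys}" "permute_list p ?ys = ?xs"
    by (rule mset_eq_permutation)
  have p': "p permutes {..<n}" using p(1) by simp
  have len: "length ?xs = n" using p(2) by (metis length_map length_permute_list diff_zero length_upt)
  have pa: "p a < n" if "a < n" for a
    using permutes_in_image[OF p', of a] that by simp
  have xs: "?xs ! a = m (p a)" if "a < n" for a
    using permute_list_nth[OF p(1), of a] that p(2) pa[OF that] by simp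
  have "orthonormal_basis n (\<lambda>a. F (p a))"
  proof (rule orthonormal_basisI)
    fix a b assume ab: "a < n" "b < n"
    have "p a = p b \<longleftrightarrow> a = b" by (meson injD permutes_inj[OF p'])
    then show "ip n (F (p a)) (F (p b)) = of_bool (a = b)"
      using F pa[OF ab(1)] pa[OF ab(2)] by (simp add: eigensystem_def orthonormal_basis_def)
  qed
  then have "eigensystem n (\<lambda>i j. A $$ (i, j)) (\<lambda>a. F (p a)) (\<lambda>a. ?xs ! a)"
    using F pa xs by (simp add: eigensystem_def)
  with len show ?thesis by blast
qed

lemma second_eigenvalue:
  assumes A: "A \<in> carrier_mat n n" and sym: "symmetric_on n (\<lambda>i j. A $$ (i, j))" and n: "n \<ge> 2"
  obtains E l where "eigensystem n (\<lambda>i j. A $$ (i, j)) E l" "l 1 = real_eigenvalues A ! 1"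
    "l 0 \<ge> l 1" "\<And>a. 1 \<le> a \<Longrightarrow> a < n \<Longrightarrow> l a \<le> l 1"
proof -
  obtain E where E: "eigensystem n (\<lambda>i j. A $$ (i, j)) E (\<lambda>a. real_eigenvalues A ! a)"
    and len: "length (real_eigenvalues A) = n"
    using eigensystem_real_eigenvalues[OF A sym] by blast
  have mono: "real_eigenvalues A ! b \<le> real_eigenvalues A ! a" if "a \<le> b" "b < n" for a b
    using sorted_rev_nth_mono[OF sorted_real_eigenvalues that(1)] that(2) len by simp
  show ?thesis
    using E n by (intro that[of E "\<lambda>a. real_eigenvalues A ! a"]) (auto intro!: mono)
qed

section \<open>Euclidean norm, matrix powers as iterated operators, Gram matrices\<close>

definition nrm :: "nat \<Rightarrow> (nat \<Rightarrow> real) \<Rightarrow> real" where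
  "nrm n v = sqrt (ip n v v)"

lemma nrm_L2: "nrm n v = L2_set v {..<n}"
  by (simp add: nrm_def ip_def L2_set_def power2_eq_square)

lemma nrm_nonneg: "nrm n v \<ge> 0"
  by (simp add: nrm_L2)

lemma nrm_power2: "(nrm n v)\<^sup>2 = ip n v v"
  by (simp add: nrm_def ip_nonneg)

lemma nrm_cong: "(\<And>i. i < n \<Longrightarrow> u i = v i) \<Longrightarrow> nrm n u = nrm n v"
  by (simp add: nrm_def ip_def)

lemma nrm_add_le: "nrm n (\<lambda>i. u i + v i) \<le> nrm n u + nrm n v"
  unfolding nrm_L2 by (rule L2_set_triangle_ineq)

lemma nrm_scale: "nrm n (\<lambda>i. c * v i) = \<bar>c\<bar> * nrm n v"
  by (simp add: nrm_def ip_scale_left ip_scale_right real_sqrt_mult mult.assoc[symmetric])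

lemma mv_mat_mult:
  assumes "A \<in> carrier_mat n n" "B \<in> carrier_mat n n" "i < n"
  shows "mv n (\<lambda>i j. (A * B) $$ (i, j)) v i =
    mv n (\<lambda>i j. A $$ (i, j)) (mv n (\<lambda>i j. B $$ (i, j)) v) i"
proof -
  have "mv n (\<lambda>i j. (A * B) $$ (i, j)) v i = (\<Sum>j<n. \<Sum>k<n. A $$ (i, k) * B $$ (k, j) * v j)"
    using assms by (simp add: mv_def scalar_prod_def atLeast0LessThan sum_distrib_right)
  also have "\<dots> = (\<Sum>k<n. \<Sum>j<n. A $$ (i, k) * B $$ (k, j) * v j)"
    by (rule sum.swap)
  also have "\<dots> = mv n (\<lambda>i j. A $$ (i, j)) (mv n (\<lambda>i j. B $$ (i, j)) v) i"
    by (simp add: mv_def sum_distrib_left mult.assoc)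
  finally show ?thesis .
qed

lemma mv_mat_pow:
  assumes A: "A \<in> carrier_mat n n" and i: "i < n"
  shows "mv n (\<lambda>i j. (A ^\<^sub>m k) $$ (i, j)) v i = (mv n (\<lambda>i j. A $$ (i, j)) ^^ k) v i"
  using i
proof (induction k arbitrary: v i)
  case 0
  then have "mv n (\<lambda>i j. (A ^\<^sub>m 0) $$ (i, j)) v i = (\<Sum>j<n. of_bool (i = j) * v j)"
    unfolding mv_def using A by (intro sum.cong) auto
  then show ?case
    using 0 by (simp add: of_bool_def if_distrib[of "\<lambda>x. x * _"] sum.delta cong: if_cong)
next
  case (Suc k)
  then show ?case
    using mv_mat_mult[OF pow_carrier_mat[OF A] A Suc.prems]
    by (simp add: funpow_swap1)
qed

lemma ip_mv_transpose:
  assumes "A \<in> carrier_mat n n"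
  shows "ip n u (mv n (\<lambda>i j. (transpose_mat A) $$ (i, j)) w) = ip n (mv n (\<lambda>i j. A $$ (i, j)) u) w"
proof -
  have "ip n u (mv n (\<lambda>i j. (transpose_mat A) $$ (i, j)) w) = (\<Sum>i<n. \<Sum>j<n. A $$ (j, i) * u i * w j)"
    using assms by (simp add: ip_def mv_def sum_distrib_left algebra_simps)
  also have "\<dots> = (\<Sum>j<n. \<Sum>i<n. A $$ (j, i) * u i * w j)"
    by (rule sum.swap)
  finally show ?thesis by (simp add: ip_def mv_def sum_distrib_right)
qed

lemma ip_mv_pow_transpose:
  assumes A: "A \<in> carrier_mat n n"
  shows "ip n u ((mv n (\<lambda>i j. (transpose_mat A) $$ (i, j)) ^^ k) w) =
    ip n ((mv n (\<lambda>i j. A $$ (i, j)) ^^ k) u) w"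
proof (induction k arbitrary: u w)
  case (Suc k)
  then show ?case
    by (simp add: ip_mv_transpose[OF A] funpow_swap1)
qed simp

text \<open>Rewrites the Gram matrix of the \<open>k\<close>-th power through iterates of one
  operator, the shape in which contraction and perturbation arguments apply.\<close>

lemma ip_gram_pow:
  fixes k :: nat
  assumes A: "A \<in> carrier_mat n n"
  defines "G \<equiv> transpose_mat A ^\<^sub>m k * A ^\<^sub>m k"
  shows "ip n u (mv n (\<lambda>i j. G $$ (i, j)) v) =
    ip n ((mv n (\<lambda>i j. A $$ (i, j)) ^^ k) u) ((mv n (\<lambda>i j. A $$ (i, j)) ^^ k) v)"
proof -
  have At: "transpose_mat A \<in> carrier_mat n n" using A by simp
  have "ip n u (mv n (\<lambda>i j. G $$ (i, j)) v) =
      ip n u (mv n (\<lambda>i j. (transpose_mat A ^\<^sub>m k) $$ (i, j)) (mv n (\<lambda>i j. (A ^\<^sub>m k) $$ (i, j)) v))"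
    unfolding G_def using mv_mat_mult[OF pow_carrier_mat[OF At] pow_carrier_mat[OF A]]
    by (intro ip_cong) auto
  also have "\<dots> = ip n u ((mv n (\<lambda>i j. (transpose_mat A) $$ (i, j)) ^^ k) (mv n (\<lambda>i j. (A ^\<^sub>m k) $$ (i, j)) v))"
    by (intro ip_cong mv_mat_pow[OF At]) auto
  also have "\<dots> = ip n ((mv n (\<lambda>i j. A $$ (i, j)) ^^ k) u) (mv n (\<lambda>i j. (A ^\<^sub>m k) $$ (i, j)) v)"
    by (rule ip_mv_pow_transpose[OF A])
  also have "\<dots> = ip n ((mv n (\<lambda>i j. A $$ (i, j)) ^^ k) u) ((mv n (\<lambda>i j. A $$ (i, j)) ^^ k) v)"
    by (intro ip_cong mv_mat_pow[OF A]) auto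
  finally show ?thesis .
qed

lemma symmetric_on_gram_pow:
  assumes A: "A \<in> carrier_mat n n"
  shows "symmetric_on n (\<lambda>i j. (transpose_mat A ^\<^sub>m k * A ^\<^sub>m k) $$ (i, j))"
  unfolding symmetric_on_def
proof (intro allI impI)
  fix i j assume ij: "i < n" "j < n"
  let ?G = "\<lambda>i j. (transpose_mat A ^\<^sub>m k * A ^\<^sub>m k) $$ (i, j)"
  have entry: "ip n (\<lambda>x. of_bool (x = i)) (mv n ?G (\<lambda>x. of_bool (x = j))) = ?G i j"
    if "i < n" "j < n" for i j
    using that by (simp add: ip_def mv_def of_bool_def if_distrib[of "\<lambda>x. _ * x"]
        if_distrib[of "\<lambda>x. x * _"] sum.delta sum.delta' cong: if_cong)
  show "?G i j = ?G j i"
    unfolding entry[OF ij, symmetric] entry[OF ij(2,1), symmetric] ip_gram_pow[OF A]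
    by (rule ip_commute)
qed

lemma similar_mat_wit_diag_conj:
  assumes "M \<in> carrier_mat n n" "\<And>i. i < n \<Longrightarrow> s i \<noteq> (0 :: real)"
  shows "similar_mat_wit (mat n n (\<lambda>(i, j). s i * M $$ (i, j) / s j)) M
    (mat n n (\<lambda>(i, j). if i = j then s i else 0)) (mat n n (\<lambda>(i, j). if i = j then 1 / s i else 0))"
proof (rule similar_mat_witI)
  let ?D = "mat n n (\<lambda>(i, j). if i = j then s i else 0)"
  let ?D' = "mat n n (\<lambda>(i, j). if i = j then 1 / s i else 0)"
  note simps = scalar_prod_def atLeast0LessThan if_distrib[of "\<lambda>x. _ * x"]
    if_distrib[of "\<lambda>x. x * _"] sum.delta sum.delta'
  show "?D * ?D' = 1\<^sub>m n" "?D' * ?D = 1\<^sub>m n"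
    using assms by (auto simp: simps cong: if_cong intro!: eq_matI)
  have DM: "?D * M = mat n n (\<lambda>(i, j). s i * M $$ (i, j))"
    using assms by (auto simp: simps cong: if_cong intro!: eq_matI)
  show "mat n n (\<lambda>(i, j). s i * M $$ (i, j) / s j) = ?D * M * ?D'"
    unfolding DM using assms by (auto simp: simps cong: if_cong intro!: eq_matI)
qed (use assms in auto)

section \<open>Stationary ergodic chains\<close>

lemma weighted_variance_identity:
  fixes w f :: "nat \<Rightarrow> real"
  assumes "(\<Sum>j<n. w j) = 1"
  shows "(\<Sum>j<n. w j * (f j - (\<Sum>j<n. w j * f j))\<^sup>2) = (\<Sum>j<n. w j * (f j)\<^sup>2) - (\<Sum>j<n. w j * f j)\<^sup>2"
proof -
  let ?m = "\<Sum>j<n. w j * f j"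
  have "(\<Sum>j<n. w j * (f j - ?m)\<^sup>2) = (\<Sum>j<n. w j * (f j)\<^sup>2 - 2 * ?m * (w j * f j) + ?m\<^sup>2 * w j)"
    by (intro sum.cong refl) (simp add: power2_eq_square algebra_simps)
  also have "\<dots> = (\<Sum>j<n. w j * (f j)\<^sup>2) - 2 * ?m * ?m + ?m\<^sup>2 * (\<Sum>j<n. w j)"
    by (simp add: sum.distrib sum_subtractf sum_distrib_left)
  finally show ?thesis using assms by (simp add: power2_eq_square)
qed

lemma conjugated_mat_mult:
  assumes "A \<in> carrier_mat n n" "B \<in> carrier_mat n n" "D \<in> carrier_mat n n" "D' \<in> carrier_mat n n"
    and "D' * D = 1\<^sub>m n"
  shows "(D * A * D') * (D * B * D') = D * (A * B) * (D' :: 'a :: semiring_1 mat)"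
proof -
  note assoc = assoc_mult_mat[of _ n n _ n _ n]
  have "(D * A * D') * (D * B * D') = D * A * ((D' * D) * (B * D'))"
    using assms(1-4) by (simp add: assoc)
  also have "\<dots> = D * (A * B) * D'"
    using assms by (simp add: assoc)
  finally show ?thesis .
qed

text \<open>Multiplication by \<open>sqrt \<pi>\<close> identifies \<open>L2(\<pi>)\<close> with
  Euclidean space; under it the time reversal becomes the transpose.\<close>

definition normalized_kernel :: "real vec \<Rightarrow> real mat \<Rightarrow> nat \<Rightarrow> nat \<Rightarrow> real" where
  "normalized_kernel \<pi> M i j = sqrt (\<pi> $ i) * M $$ (i, j) / sqrt (\<pi> $ j)"

definition power_gap :: "real vec \<Rightarrow> real mat \<Rightarrow> nat \<Rightarrow> real" where
  "power_gap \<pi> M k = spectral_gap (time_reversal \<pi> M ^\<^sub>m k * M ^\<^sub>m k)"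

locale stationary_chain =
  fixes d :: nat and M :: "real mat" and \<pi> :: "real vec"
  assumes erg: "ergodic d M" and stat: "stationary_distribution d M \<pi>"
begin

abbreviation "P k i j \<equiv> (M ^\<^sub>m k) $$ (i, j)"

lemma M_carrier: "M \<in> carrier_mat d d" and dim_M: "dim_row M = d" "dim_col M = d"
  and M_nonneg: "i < d \<Longrightarrow> j < d \<Longrightarrow> M $$ (i, j) \<ge> 0"
  and M_row: "i < d \<Longrightarrow> (\<Sum>j<d. M $$ (i, j)) = 1"
  using erg by (auto simp: ergodic_def row_stochastic_def)

lemma dim_pi: "dim_vec \<pi> = d" and pi_carrier: "\<pi> \<in> carrier_vec d" and pi_nonneg: "i < d \<Longrightarrow> \<pi> $ i \<ge> 0"
  and pi_sum: "(\<Sum>i<d. \<pi> $ i) = 1"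
  using stat by (auto simp: stationary_distribution_def prob_vec_def)

lemma pi_M: "j < d \<Longrightarrow> (\<Sum>i<d. \<pi> $ i * M $$ (i, j)) = \<pi> $ j"
proof -
  assume j: "j < d"
  have "(transpose_mat M *\<^sub>v \<pi>) $ j = \<pi> $ j"
    using stat by (simp add: stationary_distribution_def)
  then show ?thesis
    using j dim_pi dim_M by (simp add: scalar_prod_def atLeast0LessThan mult.commute)
qed

lemma P_Suc: "i < d \<Longrightarrow> j < d \<Longrightarrow> P (Suc k) i j = (\<Sum>l<d. P k i l * M $$ (l, j))"
  using dim_M M_carrier by (simp add: scalar_prod_def atLeast0LessThan)

lemma P_0: "i < d \<Longrightarrow> j < d \<Longrightarrow> P 0 i j = of_bool (i = j)"
  using dim_M by simp

lemma P_nonneg: "i < d \<Longrightarrow> j < d \<Longrightarrow> P k i j \<ge> 0"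
proof (induction k arbitrary: j)
  case 0 then show ?case using P_0 by simp
next
  case (Suc k)
  then show ?case unfolding P_Suc[OF Suc.prems]
    by (intro sum_nonneg mult_nonneg_nonneg M_nonneg) auto
qed

lemma P_row: "i < d \<Longrightarrow> (\<Sum>j<d. P k i j) = 1"
proof (induction k)
  case 0
  then have "(\<Sum>j<d. P 0 i j) = (\<Sum>j<d. of_bool (i = j))" using P_0 by (intro sum.cong) auto
  then show ?case using 0 by (simp add: of_bool_def sum.delta cong: if_cong)
next
  case (Suc k)
  have "(\<Sum>j<d. P (Suc k) i j) = (\<Sum>j<d. \<Sum>l<d. P k i l * M $$ (l, j))"
    using P_Suc[OF Suc.prems] by (intro sum.cong) auto
  also have "\<dots> = (\<Sum>l<d. P k i l * (\<Sum>j<d. M $$ (l, j)))"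
    by (subst sum.swap) (simp add: sum_distrib_left)
  also have "\<dots> = 1" using Suc M_row by simp
  finally show ?case .
qed

lemma P_le_1: "i < d \<Longrightarrow> j < d \<Longrightarrow> P k i j \<le> 1"
  using P_row[of i k] member_le_sum[of j "{..<d}" "P k i"] P_nonneg[of i _ k] by auto

lemma pi_P: "j < d \<Longrightarrow> (\<Sum>i<d. \<pi> $ i * P k i j) = \<pi> $ j"
proof (induction k arbitrary: j)
  case 0
  then have "(\<Sum>i<d. \<pi> $ i * P 0 i j) = (\<Sum>i<d. \<pi> $ i * of_bool (i = j))"
    using P_0 by (intro sum.cong) auto
  then show ?case using 0
    by (simp add: of_bool_def if_distrib[of "\<lambda>x. _ * x"] sum.delta cong: if_cong)
next
  case (Suc k)
  have "(\<Sum>i<d. \<pi> $ i * P (Suc k) i j) = (\<Sum>i<d. \<Sum>l<d. \<pi> $ i * P k i l * M $$ (l, j))"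
    using P_Suc[OF _ Suc.prems] by (intro sum.cong) (auto simp: sum_distrib_left mult.assoc)
  also have "\<dots> = (\<Sum>l<d. \<Sum>i<d. \<pi> $ i * P k i l * M $$ (l, j))" by (rule sum.swap)
  also have "\<dots> = (\<Sum>l<d. \<pi> $ l * M $$ (l, j))"
    using Suc.IH by (intro sum.cong refl) (simp add: sum_distrib_right[symmetric])
  finally show ?case using pi_M[OF Suc.prems] by simp
qed

lemma eventually_positive: obtains k where "k \<ge> 1" "\<And>i j. i < d \<Longrightarrow> j < d \<Longrightarrow> P k i j > 0"
  using erg by (auto simp: ergodic_def)

lemma pi_pos: "i < d \<Longrightarrow> \<pi> $ i > 0"
proof -
  assume i: "i < d"
  obtain k where k: "\<And>i j. i < d \<Longrightarrow> j < d \<Longrightarrow> P k i j > 0" using eventually_positive by metis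
  have "\<exists>l<d. \<pi> $ l > 0"
  proof (rule ccontr)
    assume "\<not> (\<exists>l<d. \<pi> $ l > 0)"
    then have "\<pi> $ l = 0" if "l < d" for l using that pi_nonneg[of l] by force
    then show False using pi_sum by simp
  qed
  then obtain l where l: "l < d" "\<pi> $ l > 0" by blast
  have "0 < \<pi> $ l * P k l i" using l k i by simp
  also have "\<dots> \<le> (\<Sum>j<d. \<pi> $ j * P k j i)"
    using l i k by (intro member_le_sum[of l "{..<d}" "\<lambda>j. \<pi> $ j * P k j i"]) (auto intro!: mult_nonneg_nonneg pi_nonneg P_nonneg)
  finally show ?thesis using pi_P[OF i] by simp
qed

end

text \<open>A second eigenvalue exists only for \<open>d >= 2\<close>; a single state is settled
  separately in the final theorem.\<close>

locale ergodic_chain = stationary_chain +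
  assumes d2: "d \<ge> 2"
begin

abbreviation "L \<equiv> normalized_kernel \<pi> M"
abbreviation "K \<equiv> mv d L"

lemma sqrt_pi_pos: "i < d \<Longrightarrow> sqrt (\<pi> $ i) > 0"
  using pi_pos by simp

lemma sqrt_pi_sq: "i < d \<Longrightarrow> sqrt (\<pi> $ i) * sqrt (\<pi> $ i) = \<pi> $ i"
  using pi_nonneg by simp

lemma K_pow: "i < d \<Longrightarrow> (K ^^ k) v i = sqrt (\<pi> $ i) * mv d (P k) (\<lambda>j. v j / sqrt (\<pi> $ j)) i"
proof (induction k arbitrary: v)
  case 0
  have "mv d (P 0) (\<lambda>j. v j / sqrt (\<pi> $ j)) i = (\<Sum>j<d. of_bool (i = j) * (v j / sqrt (\<pi> $ j)))"
    unfolding mv_def using 0 P_0 by (intro sum.cong) auto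
  also have "\<dots> = v i / sqrt (\<pi> $ i)"
    using sum.delta'[of "{..<d}" i "\<lambda>j. v j / sqrt (\<pi> $ j)"] 0
    by (simp only: of_bool_def if_distrib[of "\<lambda>x. x * _"] mult_1_left mult_zero_left finite_lessThan lessThan_iff if_True cong: if_cong)
  finally show ?case using sqrt_pi_pos[OF 0] by simp
next
  case (Suc k)
  have "(K ^^ Suc k) v i = (K ^^ k) (K v) i" by (simp add: funpow_swap1)
  also have "\<dots> = sqrt (\<pi> $ i) * mv d (P k) (\<lambda>j. K v j / sqrt (\<pi> $ j)) i"
    by (rule Suc.IH[OF Suc.prems])
  also have "mv d (P k) (\<lambda>j. K v j / sqrt (\<pi> $ j)) = mv d (P k) (mv d (\<lambda>i j. M $$ (i, j)) (\<lambda>j. v j / sqrt (\<pi> $ j)))"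
  proof (rule mv_cong)
    fix j assume "j < d"
    then have "sqrt (\<pi> $ j) \<noteq> 0" using sqrt_pi_pos by force
    then show "K v j / sqrt (\<pi> $ j) = mv d (\<lambda>i j. M $$ (i, j)) (\<lambda>j. v j / sqrt (\<pi> $ j)) j"
      by (simp add: mv_def normalized_kernel_def sum_divide_distrib)
  qed
  also have "\<dots> i = mv d (P (Suc k)) (\<lambda>j. v j / sqrt (\<pi> $ j)) i"
    using mv_mat_mult[OF pow_carrier_mat[OF M_carrier] M_carrier Suc.prems] by simp
  finally show ?case .
qed

lemma ip_pi: "ip d (\<lambda>i. sqrt (\<pi> $ i) * f i) (\<lambda>i. sqrt (\<pi> $ i) * g i) = (\<Sum>i<d. \<pi> $ i * (f i * g i))"
  unfolding ip_def
proof (intro sum.cong refl)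
  fix i assume "i \<in> {..<d}"
  then show "sqrt (\<pi> $ i) * f i * (sqrt (\<pi> $ i) * g i) = \<pi> $ i * (f i * g i)"
    using sqrt_pi_sq[of i] by (metis lessThan_iff mult.assoc mult.left_commute)
qed

lemma ip_K_pow:
  "ip d ((K ^^ k) v) ((K ^^ k) v) = (\<Sum>i<d. \<pi> $ i * (mv d (P k) (\<lambda>j. v j / sqrt (\<pi> $ j)) i)\<^sup>2)"
proof -
  let ?f = "mv d (P k) (\<lambda>j. v j / sqrt (\<pi> $ j))"
  have "ip d ((K ^^ k) v) ((K ^^ k) v) = ip d (\<lambda>i. sqrt (\<pi> $ i) * ?f i) (\<lambda>i. sqrt (\<pi> $ i) * ?f i)"
    using K_pow by (intro ip_cong) auto
  then show ?thesis by (simp add: ip_pi power2_eq_square)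
qed

lemma ip_div_sqrt_pi: "ip d v v = (\<Sum>i<d. \<pi> $ i * (v i / sqrt (\<pi> $ i))\<^sup>2)"
proof -
  have "ip d v v = ip d (\<lambda>i. sqrt (\<pi> $ i) * (v i / sqrt (\<pi> $ i))) (\<lambda>i. sqrt (\<pi> $ i) * (v i / sqrt (\<pi> $ i)))"
    using sqrt_pi_pos by (intro ip_cong) force+
  then show ?thesis by (simp only: ip_pi power2_eq_square)
qed

text \<open>Conditional variance decomposition under stationarity: the energy lost by
  \<open>P k\<close> is the mean conditional variance. It yields both the contraction property of
  \<open>K\<close> and, later, strict positivity of the gap.\<close>

lemma dirichlet_identity:
  "(\<Sum>i<d. \<pi> $ i * (f i)\<^sup>2) - (\<Sum>i<d. \<pi> $ i * (mv d (P k) f i)\<^sup>2) =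
   (\<Sum>i<d. \<pi> $ i * (\<Sum>j<d. P k i j * (f j - mv d (P k) f i)\<^sup>2))"
proof -
  have "(\<Sum>i<d. \<pi> $ i * (\<Sum>j<d. P k i j * (f j - mv d (P k) f i)\<^sup>2)) =
      (\<Sum>i<d. \<pi> $ i * ((\<Sum>j<d. P k i j * (f j)\<^sup>2) - (mv d (P k) f i)\<^sup>2))"
    using weighted_variance_identity[OF P_row] by (intro sum.cong refl) (simp add: mv_def)
  also have "\<dots> = (\<Sum>i<d. \<Sum>j<d. \<pi> $ i * P k i j * (f j)\<^sup>2) - (\<Sum>i<d. \<pi> $ i * (mv d (P k) f i)\<^sup>2)"
    by (simp add: right_diff_distrib sum_subtractf sum_distrib_left mult.assoc)
  also have "(\<Sum>i<d. \<Sum>j<d. \<pi> $ i * P k i j * (f j)\<^sup>2) = (\<Sum>j<d. \<Sum>i<d. \<pi> $ i * P k i j * (f j)\<^sup>2)"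
    by (rule sum.swap)
  also have "\<dots> = (\<Sum>j<d. \<pi> $ j * (f j)\<^sup>2)"
    using pi_P by (intro sum.cong refl) (simp add: sum_distrib_right[symmetric])
  finally show ?thesis by simp
qed

lemma ip_K_pow_le: "ip d ((K ^^ k) v) ((K ^^ k) v) \<le> ip d v v"
proof -
  let ?f = "\<lambda>j. v j / sqrt (\<pi> $ j)"
  have "0 \<le> (\<Sum>i<d. \<pi> $ i * (\<Sum>j<d. P k i j * (?f j - mv d (P k) ?f i)\<^sup>2))"
    by (intro sum_nonneg mult_nonneg_nonneg pi_nonneg P_nonneg) auto
  then show ?thesis
    using dirichlet_identity[where f = ?f and k = k] unfolding ip_K_pow ip_div_sqrt_pi[of v] by linarith
qed

lemma nrm_K_pow_le: "nrm d ((K ^^ k) v) \<le> nrm d v"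
  unfolding nrm_def using ip_K_pow_le by simp

text \<open>Conjugation by the diagonal matrix of \<open>sqrt \<pi>\<close> carries the time
  reversal to the transpose of \<open>N\<close>, so the product is similar to a Gram matrix and has
  the same root list. Afterwards the gap is handled through this quadratic form.\<close>

lemma power_gap_second_eigenvalue:
  obtains E l where "orthonormal_basis d E" "l 1 = 1 - power_gap \<pi> M k" "l 0 \<ge> l (1::nat)"
    "\<forall>a. 1 \<le> a \<longrightarrow> a < d \<longrightarrow> l a \<le> l 1"
    "\<forall>v. ip d ((K ^^ k) v) ((K ^^ k) v) = (\<Sum>a<d. l a * (ip d (E a) v)\<^sup>2)"
proof -
  let ?D = "mat d d (\<lambda>(i, j). if i = j then sqrt (\<pi> $ i) else 0)"
  let ?D' = "mat d d (\<lambda>(i, j). if i = j then 1 / sqrt (\<pi> $ i) else 0)"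
  let ?R = "time_reversal \<pi> M"
  define N where "N = mat d d (\<lambda>(i, j). sqrt (\<pi> $ i) * M $$ (i, j) / sqrt (\<pi> $ j))"
  have N: "N \<in> carrier_mat d d" by (simp add: N_def)
  have R: "?R \<in> carrier_mat d d" by (simp add: time_reversal_def dim_pi)
  have s0: "sqrt (\<pi> $ i) \<noteq> 0" if "i < d" for i using sqrt_pi_pos[OF that] by simp
  have Nt: "transpose_mat N = mat d d (\<lambda>(i, j). sqrt (\<pi> $ i) * ?R $$ (i, j) / sqrt (\<pi> $ j))"
  proof (rule eq_matI)
    fix i j
    assume "i < dim_row (mat d d (\<lambda>(i, j). sqrt (\<pi> $ i) * ?R $$ (i, j) / sqrt (\<pi> $ j)))"
      "j < dim_col (mat d d (\<lambda>(i, j). sqrt (\<pi> $ i) * ?R $$ (i, j) / sqrt (\<pi> $ j)))"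
    then have ij: "i < d" "j < d" by auto
    have "sqrt (\<pi> $ j) * M $$ (j, i) / sqrt (\<pi> $ i) =
        sqrt (\<pi> $ i) * (sqrt (\<pi> $ j) * sqrt (\<pi> $ j) * M $$ (j, i) / (sqrt (\<pi> $ i) * sqrt (\<pi> $ i))) / sqrt (\<pi> $ j)"
      using s0[OF ij(1)] s0[OF ij(2)] by (simp add: field_simps)
    then show "transpose_mat N $$ (i, j) =
        mat d d (\<lambda>(i, j). sqrt (\<pi> $ i) * ?R $$ (i, j) / sqrt (\<pi> $ j)) $$ (i, j)"
      using ij pi_nonneg[of i] pi_nonneg[of j] by (simp add: N_def time_reversal_def dim_pi sqrt_pi_sq)
  qed (simp_all add: N_def)
  have w1: "similar_mat_wit (N ^\<^sub>m k) (M ^\<^sub>m k) ?D ?D'"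
    unfolding N_def by (rule similar_mat_wit_pow[OF similar_mat_wit_diag_conj[OF M_carrier s0]])
  have w2: "similar_mat_wit (transpose_mat N ^\<^sub>m k) (?R ^\<^sub>m k) ?D ?D'"
    unfolding Nt by (rule similar_mat_wit_pow[OF similar_mat_wit_diag_conj[OF R s0]])
  let ?A = "transpose_mat N ^\<^sub>m k * N ^\<^sub>m k" and ?B = "?R ^\<^sub>m k * M ^\<^sub>m k"
  have Nk: "N ^\<^sub>m k \<in> carrier_mat d d" "transpose_mat N ^\<^sub>m k \<in> carrier_mat d d"
      "M ^\<^sub>m k \<in> carrier_mat d d" "?R ^\<^sub>m k \<in> carrier_mat d d"
    using N R M_carrier by auto
  note d1 = similar_mat_witD2[OF Nk(1) w1] and d2' = similar_mat_witD2[OF Nk(2) w2]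
  have "?A = (?D * ?R ^\<^sub>m k * ?D') * (?D * M ^\<^sub>m k * ?D')"
    using d1(3) d2'(3) by simp
  also have "\<dots> = ?D * ?B * ?D'"
    by (rule conjugated_mat_mult[of _ d]) (use Nk d1(2) in auto)
  finally have "similar_mat ?A ?B"
    using Nk d1(1,2) by (intro similar_matI[of _ _ ?D ?D' d]) auto
  then have "real_eigenvalues ?B = real_eigenvalues ?A"
    by (simp add: real_eigenvalues_def char_poly_similar)
  moreover have "dim_row ?B = d" using R by simp
  ultimately have gap: "1 - power_gap \<pi> M k = real_eigenvalues ?A ! 1"
    using d2 by (simp add: power_gap_def spectral_gap_def)
  have A: "?A \<in> carrier_mat d d" using Nk by simp
  have symA: "symmetric_on d (\<lambda>i j. ?A $$ (i, j))" by (rule symmetric_on_gram_pow[OF N])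
  obtain E l where E: "eigensystem d (\<lambda>i j. ?A $$ (i, j)) E l" and l: "l 1 = real_eigenvalues ?A ! 1"
    "l 0 \<ge> l 1" "\<And>a. 1 \<le> a \<Longrightarrow> a < d \<Longrightarrow> l a \<le> l 1"
    using second_eigenvalue[OF A symA d2] by blast
  have KN: "(mv d (\<lambda>i j. N $$ (i, j)) ^^ k) v i = (K ^^ k) v i" if "i < d" for v k i
    using that
  proof (induction k arbitrary: i)
    case (Suc k)
    have "mv d (\<lambda>i j. N $$ (i, j)) ((mv d (\<lambda>i j. N $$ (i, j)) ^^ k) v) i = mv d (\<lambda>i j. N $$ (i, j)) ((K ^^ k) v) i"
      using mv_cong[of d "(mv d (\<lambda>i j. N $$ (i, j)) ^^ k) v" "(K ^^ k) v"] Suc.IH by simp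
    also have "\<dots> = K ((K ^^ k) v) i"
      using Suc.prems by (simp add: mv_def[of d _ "(K ^^ k) v"] N_def normalized_kernel_def)
    finally show ?case by simp
  qed simp
  have "ip d ((K ^^ k) v) ((K ^^ k) v) = (\<Sum>a<d. l a * (ip d (E a) v)\<^sup>2)" for v
    using eigensystem_quadratic_form[OF symA E, of v] unfolding ip_gram_pow[OF N]
    using ip_cong[of d "(mv d (\<lambda>i j. N $$ (i, j)) ^^ k) v" "(K ^^ k) v"] KN by auto
  then show ?thesis
    using E l gap by (intro that[of E l]) (auto simp: eigensystem_def)
qed

end

text \<open>A plane meets every hyperplane in a nonzero vector; for the second eigenvalue this
  replaces the general min-max principle.\<close>

lemma nontrivial_combination_orthogonal:
  obtains x y :: real where "x\<^sup>2 + y\<^sup>2 > 0" "x * a + y * b = 0"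
proof (cases "a = 0 \<and> b = 0")
  case True
  then show ?thesis by (intro that[of 1 0]) auto
next
  case False
  then show ?thesis by (intro that[of b "- a"]) (auto simp: sum_power2_gt_zero_iff)
qed

lemma orthonormal_pair:
  assumes "orthonormal_basis d E" "d \<ge> 2"
  shows "a < d \<Longrightarrow> ip d (E a) (\<lambda>i. x * E 0 i + y * E (Suc 0) i) = (if a = 0 then x else if a = 1 then y else 0)"
    and "ip d (\<lambda>i. x * E 0 i + y * E (Suc 0) i) (\<lambda>i. x * E 0 i + y * E (Suc 0) i) = x\<^sup>2 + y\<^sup>2"
  using assms unfolding ip_add_left ip_add_right ip_scale_left ip_scale_right
  by (auto simp: orthonormal_basis_def power2_eq_square)

context ergodic_chain
begin

lemma power_gap_bounds: "0 \<le> power_gap \<pi> M k" "power_gap \<pi> M k \<le> 1"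
proof -
  obtain E l where E: "orthonormal_basis d E" "l 1 = 1 - power_gap \<pi> M k" "l 0 \<ge> l (1::nat)"
    "\<forall>a. 1 \<le> a \<longrightarrow> a < d \<longrightarrow> l a \<le> l 1"
    "\<forall>v. ip d ((K ^^ k) v) ((K ^^ k) v) = (\<Sum>a<d. l a * (ip d (E a) v)\<^sup>2)"
    by (rule power_gap_second_eigenvalue[of k])
  have "ip d ((K ^^ k) (E 1)) ((K ^^ k) (E 1)) = (\<Sum>a<d. l a * of_bool (a = 1))"
    unfolding E(5)[rule_format] using E(1) d2
    by (intro sum.cong refl) (simp add: orthonormal_basis_def)
  also have "\<dots> = l 1"
    using d2 by (simp add: of_bool_def if_distrib[of "\<lambda>x. _ * x"] sum.delta cong: if_cong)
  finally have "ip d ((K ^^ k) (E 1)) ((K ^^ k) (E 1)) = 1 - power_gap \<pi> M k" using E(2) by simp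
  moreover have "ip d (E 1) (E 1) = 1" using E(1) d2 by (simp add: orthonormal_basis_def)
  ultimately show "0 \<le> power_gap \<pi> M k" "power_gap \<pi> M k \<le> 1"
    using ip_K_pow_le[of k "E 1"] ip_nonneg[of d "(K ^^ k) (E 1)"] by auto
qed

text \<open>Lower half of the Courant-Fischer characterisation, on the span of the top two
  eigenvectors; \<open>power_gap_hyperplane\<close> is the upper half.\<close>

lemma power_gap_plane:
  obtains E0 E1 where
    "\<forall>x y. ip d (\<lambda>i. x * E0 i + y * E1 i) (\<lambda>i. x * E0 i + y * E1 i) = x\<^sup>2 + y\<^sup>2"
    "\<forall>x y. (1 - power_gap \<pi> M k) * (x\<^sup>2 + y\<^sup>2) \<le>
       ip d ((K ^^ k) (\<lambda>i. x * E0 i + y * E1 i)) ((K ^^ k) (\<lambda>i. x * E0 i + y * E1 i))"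
proof -
  obtain E l where E: "orthonormal_basis d E" "l 1 = 1 - power_gap \<pi> M k" "l 0 \<ge> l (1::nat)"
    "\<forall>a. 1 \<le> a \<longrightarrow> a < d \<longrightarrow> l a \<le> l 1"
    "\<forall>v. ip d ((K ^^ k) v) ((K ^^ k) v) = (\<Sum>a<d. l a * (ip d (E a) v)\<^sup>2)"
    by (rule power_gap_second_eigenvalue[of k])
  show ?thesis
  proof (rule that[of "E 0" "E (Suc 0)"]; intro allI)
    fix x y
    let ?v = "\<lambda>i. x * E 0 i + y * E (Suc 0) i"
    show "ip d ?v ?v = x\<^sup>2 + y\<^sup>2" by (rule orthonormal_pair(2)[OF E(1) d2])
    have "ip d ((K ^^ k) ?v) ((K ^^ k) ?v) = (\<Sum>a<d. l a * (if a = 0 then x else if a = 1 then y else 0)\<^sup>2)"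
      unfolding E(5)[rule_format] using orthonormal_pair(1)[OF E(1) d2] by (intro sum.cong refl) simp
    also have "\<dots> = (\<Sum>a\<in>{0, 1}. l a * (if a = 0 then x else if a = 1 then y else 0)\<^sup>2)"
      using d2 by (intro sum.mono_neutral_right) auto
    also have "\<dots> = l 0 * x\<^sup>2 + l 1 * y\<^sup>2" by simp
    also have "\<dots> \<ge> l 1 * x\<^sup>2 + l 1 * y\<^sup>2"
      using E(3) by (intro add_mono mult_right_mono) auto
    finally show "(1 - power_gap \<pi> M k) * (x\<^sup>2 + y\<^sup>2) \<le> ip d ((K ^^ k) ?v) ((K ^^ k) ?v)"
      by (simp only: E(2)[symmetric] distrib_left)
  qed
qed

lemma power_gap_hyperplane:
  obtains w where "\<forall>v. ip d w v = 0 \<longrightarrow> ip d ((K ^^ k) v) ((K ^^ k) v) \<le> (1 - power_gap \<pi> M k) * ip d v v"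
proof -
  obtain E l where E: "orthonormal_basis d E" "l 1 = 1 - power_gap \<pi> M k" "l 0 \<ge> l (1::nat)"
    "\<forall>a. 1 \<le> a \<longrightarrow> a < d \<longrightarrow> l a \<le> l 1"
    "\<forall>v. ip d ((K ^^ k) v) ((K ^^ k) v) = (\<Sum>a<d. l a * (ip d (E a) v)\<^sup>2)"
    by (rule power_gap_second_eigenvalue[of k])
  show ?thesis
  proof (rule that[of "E 0"]; intro allI impI)
    fix v assume v: "ip d (E 0) v = 0"
    have "ip d ((K ^^ k) v) ((K ^^ k) v) \<le> (\<Sum>a<d. l 1 * (ip d (E a) v)\<^sup>2)"
      unfolding E(5)[rule_format]
    proof (rule sum_mono)
      fix a assume "a \<in> {..<d}"
      then show "l a * (ip d (E a) v)\<^sup>2 \<le> l 1 * (ip d (E a) v)\<^sup>2"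
        using E(4) v by (cases "a = 0") (auto intro!: mult_right_mono)
    qed
    also have "\<dots> = l 1 * ip d v v"
      using orthonormal_basis_parseval[OF E(1), of v v]
      by (simp add: sum_distrib_left[symmetric] power2_eq_square)
    finally show "ip d ((K ^^ k) v) ((K ^^ k) v) \<le> (1 - power_gap \<pi> M k) * ip d v v"
      using E(2) by simp
  qed
qed

section \<open>Contraction on the orthogonal complement of the stationary direction\<close>

lemma K_pow_linear:
  "(K ^^ k) (\<lambda>i. a * u i + b * v i) = (\<lambda>i. a * (K ^^ k) u i + b * (K ^^ k) v i)"
proof (induction k)
  case (Suc k)
  then show ?case by (simp add: mv_add mv_scale)
qed simp

lemma mean_mv_P: "(\<Sum>i<d. \<pi> $ i * mv d (P k) f i) = (\<Sum>i<d. \<pi> $ i * f i)"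
proof -
  have "(\<Sum>i<d. \<pi> $ i * mv d (P k) f i) = (\<Sum>i<d. \<Sum>j<d. \<pi> $ i * P k i j * f j)"
    by (simp add: mv_def sum_distrib_left mult.assoc)
  also have "\<dots> = (\<Sum>j<d. \<Sum>i<d. \<pi> $ i * P k i j * f j)" by (rule sum.swap)
  also have "\<dots> = (\<Sum>i<d. \<pi> $ i * f i)"
    using pi_P by (intro sum.cong refl) (simp add: sum_distrib_right[symmetric])
  finally show ?thesis .
qed

lemma ip_sqrt_pi: "ip d (\<lambda>i. sqrt (\<pi> $ i)) v = (\<Sum>i<d. \<pi> $ i * (v i / sqrt (\<pi> $ i)))"
  unfolding ip_def
proof (intro sum.cong refl)
  fix i assume "i \<in> {..<d}"
  then have i: "sqrt (\<pi> $ i) * sqrt (\<pi> $ i) = \<pi> $ i" "sqrt (\<pi> $ i) \<noteq> 0"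
    using sqrt_pi_sq[of i] sqrt_pi_pos[of i] by auto
  have "s * x = (s * s) * (x / s)" if "s \<noteq> 0" for s x :: real using that by simp
  from this[OF i(2), of "v i"]
  show "sqrt (\<pi> $ i) * v i = \<pi> $ i * (v i / sqrt (\<pi> $ i))" by (simp only: i(1))
qed

lemma ip_sqrt_pi_K_pow: "ip d (\<lambda>i. sqrt (\<pi> $ i)) ((K ^^ k) v) = ip d (\<lambda>i. sqrt (\<pi> $ i)) v"
proof -
  have "ip d (\<lambda>i. sqrt (\<pi> $ i)) ((K ^^ k) v) =
      (\<Sum>i<d. \<pi> $ i * mv d (P k) (\<lambda>j. v j / sqrt (\<pi> $ j)) i)"
    unfolding ip_sqrt_pi
  proof (intro sum.cong refl)
    fix i assume "i \<in> {..<d}"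
    then show "\<pi> $ i * ((K ^^ k) v i / sqrt (\<pi> $ i)) = \<pi> $ i * mv d (P k) (\<lambda>j. v j / sqrt (\<pi> $ j)) i"
      using sqrt_pi_pos[of i] K_pow[of i k v] by simp
  qed
  then show ?thesis by (simp add: mean_mv_P ip_sqrt_pi)
qed

lemma K_pow_sqrt_pi: "i < d \<Longrightarrow> (K ^^ k) (\<lambda>i. sqrt (\<pi> $ i)) i = sqrt (\<pi> $ i)"
proof -
  assume i: "i < d"
  have "mv d (P k) (\<lambda>j. sqrt (\<pi> $ j) / sqrt (\<pi> $ j)) i = (\<Sum>j<d. P k i j)"
    unfolding mv_def using sqrt_pi_pos by (intro sum.cong refl) force
  then show ?thesis using K_pow[OF i] P_row[OF i] by simp
qed

lemma ip_sqrt_pi_self: "ip d (\<lambda>i. sqrt (\<pi> $ i)) (\<lambda>i. sqrt (\<pi> $ i)) = 1"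
  using ip_pi[of "\<lambda>_. 1" "\<lambda>_. 1"] pi_sum by simp

text \<open>The hyperplane supplied above is orthogonal to some top eigenvector, which need not be
  \<open>sqrt \<pi>\<close> when the eigenvalue 1 is multiple. A combination of
  \<open>sqrt \<pi>\<close> and \<open>v\<close> inside the hyperplane transfers the bound, since
  \<open>K ^^ k\<close> fixes \<open>sqrt \<pi>\<close> and preserves orthogonality to it.\<close>

lemma ip_K_pow_orthogonal_le:
  assumes v: "ip d (\<lambda>i. sqrt (\<pi> $ i)) v = 0"
  shows "ip d ((K ^^ k) v) ((K ^^ k) v) \<le> (1 - power_gap \<pi> M k) * ip d v v"
proof -
  define r where "r = (\<lambda>i. sqrt (\<pi> $ i))"
  obtain w where w: "\<forall>v. ip d w v = 0 \<longrightarrow>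
      ip d ((K ^^ k) v) ((K ^^ k) v) \<le> (1 - power_gap \<pi> M k) * ip d v v"
    by (rule power_gap_hyperplane[of k])
  obtain a b :: real where ab: "a\<^sup>2 + b\<^sup>2 > 0" "a * ip d w r + b * ip d w v = 0"
    by (rule nontrivial_combination_orthogonal)
  let ?u = "\<lambda>i. a * r i + b * v i"
  let ?q = "ip d ((K ^^ k) v) ((K ^^ k) v)" and ?g = "1 - power_gap \<pi> M k"
  have rr: "ip d r r = 1" unfolding r_def by (rule ip_sqrt_pi_self)
  have rv: "ip d r v = 0" "ip d v r = 0" using v by (auto simp: r_def ip_commute)
  have rK: "ip d r ((K ^^ k) v) = 0" "ip d ((K ^^ k) v) r = 0"
    using ip_sqrt_pi_K_pow[of k v] rv by (auto simp: r_def ip_commute)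
  have "ip d ((K ^^ k) ?u) ((K ^^ k) ?u) = ip d (\<lambda>i. a * r i + b * (K ^^ k) v i) (\<lambda>i. a * r i + b * (K ^^ k) v i)"
    unfolding K_pow_linear using K_pow_sqrt_pi by (intro ip_cong) (auto simp: r_def)
  also have "\<dots> = a\<^sup>2 + b\<^sup>2 * ?q"
    unfolding ip_add_left ip_add_right ip_scale_left ip_scale_right rr rK by (simp add: power2_eq_square)
  finally have "a\<^sup>2 + b\<^sup>2 * ?q \<le> ?g * ip d ?u ?u"
    using w[rule_format, of ?u] ab(2) by (simp add: ip_add_right ip_scale_right)
  also have "ip d ?u ?u = a\<^sup>2 + b\<^sup>2 * ip d v v"
    unfolding ip_add_left ip_add_right ip_scale_left ip_scale_right rr rv by (simp add: power2_eq_square)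
  finally have main: "a\<^sup>2 + b\<^sup>2 * ?q \<le> ?g * a\<^sup>2 + b\<^sup>2 * (?g * ip d v v)" by (simp add: algebra_simps)
  show ?thesis
  proof (cases "b = 0")
    \<comment> \<open>The hyperplane then contains \<open>sqrt \<pi>\<close>, whose length is
      preserved; so the gap is 0 and plain contraction suffices.\<close>
    case True
    then have "power_gap \<pi> M k \<le> 0" using main ab(1) by (simp add: algebra_simps mult_le_0_iff)
    then have "power_gap \<pi> M k = 0" using power_gap_bounds(1)[of k] by simp
    then show ?thesis using ip_K_pow_le[of k v] by simp
  next
    case False
    have "?g * a\<^sup>2 \<le> 1 * a\<^sup>2" using power_gap_bounds(1)[of k] by (intro mult_right_mono) auto
    then have "b\<^sup>2 * ?q \<le> b\<^sup>2 * (?g * ip d v v)" using main by simp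
    then show ?thesis using False by (simp add: mult_le_cancel_left)
  qed
qed

lemma mean_zero_contraction:
  assumes "(\<Sum>i<d. \<pi> $ i * f i) = 0"
  shows "(\<Sum>i<d. \<pi> $ i * (mv d (P k) f i)\<^sup>2) \<le> (1 - power_gap \<pi> M k) * (\<Sum>i<d. \<pi> $ i * (f i)\<^sup>2)"
proof -
  let ?v = "\<lambda>i. sqrt (\<pi> $ i) * f i"
  have v: "?v i / sqrt (\<pi> $ i) = f i" if "i < d" for i using sqrt_pi_pos[OF that] by simp
  have "ip d (\<lambda>i. sqrt (\<pi> $ i)) ?v = 0"
    unfolding ip_sqrt_pi using assms v by simp
  from ip_K_pow_orthogonal_le[OF this, of k]
  show ?thesis
    unfolding ip_K_pow ip_div_sqrt_pi[of ?v] using v mv_cong[of d "\<lambda>j. ?v j / sqrt (\<pi> $ j)" f] by simp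
qed

text \<open>A zero gap leaves a plane on which \<open>K ^^ k\<close> loses nothing. Its vector
  orthogonal to \<open>sqrt \<pi>\<close> corresponds to a mean-zero \<open>f\<close> without
  conditional variance; positive transition probabilities from state 0 make \<open>f\<close>
  constant, hence zero.\<close>

lemma power_gap_pos:
  assumes pos: "\<And>i j. i < d \<Longrightarrow> j < d \<Longrightarrow> P k i j > 0"
  shows "power_gap \<pi> M k > 0"
proof (rule ccontr)
  assume "\<not> ?thesis"
  then have gap0: "power_gap \<pi> M k = 0" using power_gap_bounds(1)[of k] by simp
  obtain E0 E1 where E: "\<forall>x y. ip d (\<lambda>i. x * E0 i + y * E1 i) (\<lambda>i. x * E0 i + y * E1 i) = x\<^sup>2 + y\<^sup>2"
    "\<forall>x y. (1 - power_gap \<pi> M k) * (x\<^sup>2 + y\<^sup>2) \<le>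
       ip d ((K ^^ k) (\<lambda>i. x * E0 i + y * E1 i)) ((K ^^ k) (\<lambda>i. x * E0 i + y * E1 i))"
    by (rule power_gap_plane[of k])
  let ?r = "\<lambda>i. sqrt (\<pi> $ i)"
  obtain x y where xy: "x\<^sup>2 + y\<^sup>2 > 0" "x * ip d ?r E0 + y * ip d ?r E1 = 0"
    by (rule nontrivial_combination_orthogonal)
  define v where "v = (\<lambda>i. x * E0 i + y * E1 i)"
  define f where "f = (\<lambda>j. v j / sqrt (\<pi> $ j))"
  have "ip d ?r v = 0" using xy(2) by (simp add: v_def ip_add_right ip_scale_right)
  then have mean: "(\<Sum>i<d. \<pi> $ i * f i) = 0" by (simp add: ip_sqrt_pi f_def)
  have "ip d v v \<le> ip d ((K ^^ k) v) ((K ^^ k) v)"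
    using E[rule_format, of x y] gap0 by (simp add: v_def)
  then have le0: "(\<Sum>i<d. \<pi> $ i * (\<Sum>j<d. P k i j * (f j - mv d (P k) f i)\<^sup>2)) \<le> 0"
    using dirichlet_identity[of f k] unfolding ip_K_pow ip_div_sqrt_pi[of v] f_def by linarith
  have nn: "\<pi> $ i * (\<Sum>j<d. P k i j * (f j - mv d (P k) f i)\<^sup>2) \<ge> 0" if "i < d" for i
    using that by (intro mult_nonneg_nonneg sum_nonneg pi_nonneg P_nonneg) auto
  have "(\<Sum>i<d. \<pi> $ i * (\<Sum>j<d. P k i j * (f j - mv d (P k) f i)\<^sup>2)) = 0"
    by (rule antisym[OF le0 sum_nonneg]) (use nn in simp)
  then have "\<forall>i\<in>{..<d}. \<pi> $ i * (\<Sum>j<d. P k i j * (f j - mv d (P k) f i)\<^sup>2) = 0"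
    by (subst (asm) sum_nonneg_eq_0_iff) (simp_all add: nn)
  then have "\<pi> $ 0 * (\<Sum>j<d. P k 0 j * (f j - mv d (P k) f 0)\<^sup>2) = 0"
    using d2 by (auto dest: bspec[of _ _ 0])
  then have "(\<Sum>j<d. P k 0 j * (f j - mv d (P k) f 0)\<^sup>2) = 0"
    using pi_pos[of 0] d2 by simp
  then have eq0: "\<forall>j\<in>{..<d}. P k 0 j * (f j - mv d (P k) f 0)\<^sup>2 = 0"
    using d2 by (subst (asm) sum_nonneg_eq_0_iff) (auto simp: P_nonneg)
  then have const: "f j = mv d (P k) f 0" if "j < d" for j
  proof -
    have "P k 0 j * (f j - mv d (P k) f 0)\<^sup>2 = 0"
      using eq0 that by blast
    moreover have "P k 0 j \<noteq> 0" using pos[of 0 j] that d2 by simp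
    ultimately show ?thesis by (simp only: mult_eq_0_iff power2_eq_square) simp
  qed
  have "(\<Sum>i<d. \<pi> $ i * f i) = (\<Sum>i<d. \<pi> $ i) * mv d (P k) f 0"
    unfolding sum_distrib_right using const by (intro sum.cong refl) simp
  then have "mv d (P k) f 0 = 0" using mean pi_sum by simp
  then have "f j = 0" if "j < d" for j using const that by simp
  then have "v j = 0" if "j < d" for j
    using sqrt_pi_pos[OF that] that unfolding f_def by (metis divide_eq_0_iff less_irrefl)
  then have "ip d v v = 0" by (simp add: ip_def)
  then show False using E(1)[rule_format, of x y] xy(1) by (simp add: v_def)
qed

lemma pseudo_gap_eq: "pseudo_spectral_gap \<pi> M = (SUP k\<in>{1..}. power_gap \<pi> M k / real k)"
  by (simp add: pseudo_spectral_gap_def power_gap_def)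

lemma power_gap_div_le_1: "power_gap \<pi> M k / real k \<le> 1" if "k \<ge> 1"
  using power_gap_bounds[of k] that by (simp add: field_simps)

lemma bdd_above_power_gaps: "bdd_above ((\<lambda>k. power_gap \<pi> M k / real k) ` {1..})"
  using power_gap_div_le_1 by (intro bdd_aboveI[of _ 1]) auto

lemma power_gap_le_pseudo_gap: "k \<ge> 1 \<Longrightarrow> power_gap \<pi> M k / real k \<le> pseudo_spectral_gap \<pi> M"
  unfolding pseudo_gap_eq using bdd_above_power_gaps by (intro cSUP_upper) auto

lemma pseudo_gap_pos: "pseudo_spectral_gap \<pi> M > 0"
proof -
  obtain k where k: "k \<ge> 1" "\<And>i j. i < d \<Longrightarrow> j < d \<Longrightarrow> P k i j > 0"
    using eventually_positive by blast
  then have "power_gap \<pi> M k / real k > 0" using power_gap_pos by simp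
  with power_gap_le_pseudo_gap[OF k(1)] show ?thesis by simp
qed

lemma pseudo_gap_le_1: "pseudo_spectral_gap \<pi> M \<le> 1"
  unfolding pseudo_gap_eq using power_gap_div_le_1 by (intro cSUP_least) auto

text \<open>The factor 2 lost here only enters the constants of the tail bounds.\<close>

lemma pseudo_gap_half_attained:
  obtains k where "k \<ge> 1" "power_gap \<pi> M k \<ge> real k * pseudo_spectral_gap \<pi> M / 2"
proof -
  have "pseudo_spectral_gap \<pi> M / 2 < (SUP k\<in>{1..}. power_gap \<pi> M k / real k)"
    unfolding pseudo_gap_eq[symmetric] using pseudo_gap_pos by linarith
  then obtain k where "k \<in> {1..}" "pseudo_spectral_gap \<pi> M / 2 < power_gap \<pi> M k / real k"
    using bdd_above_power_gaps by (subst (asm) less_cSUP_iff) auto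
  then show ?thesis by (intro that[of k]) (auto simp: field_simps)
qed

section \<open>Lipschitz dependence of the gaps on the normalised kernel\<close>

lemma K_pow_perturbation:
  assumes C: "ergodic_chain d M' \<pi>'"
    and D: "\<And>v. nrm d (\<lambda>i. mv d L v i - mv d (normalized_kernel \<pi>' M') v i) \<le> \<Delta> * nrm d v"
  shows "nrm d (\<lambda>i. (K ^^ k) v i - (mv d (normalized_kernel \<pi>' M') ^^ k) v i) \<le> real k * \<Delta> * nrm d v"
proof (induction k)
  case 0
  then show ?case by (simp add: nrm_def ip_def)
next
  case (Suc k)
  interpret C: ergodic_chain d M' \<pi>' by (rule C)
  have D0: "\<Delta> * nrm d v \<ge> 0" for v by (rule order_trans[OF nrm_nonneg D])
  let ?u = "(K ^^ k) v" and ?u' = "(C.K ^^ k) v"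
  have "nrm d (\<lambda>i. (K ^^ Suc k) v i - (C.K ^^ Suc k) v i) =
      nrm d (\<lambda>i. (K ^^ 1) (\<lambda>i. ?u i - ?u' i) i + (K ?u' i - C.K ?u' i))"
    by (intro nrm_cong) (simp add: mv_diff)
  also have "\<dots> \<le> nrm d ((K ^^ 1) (\<lambda>i. ?u i - ?u' i)) + nrm d (\<lambda>i. K ?u' i - C.K ?u' i)"
    by (rule nrm_add_le)
  also have "\<dots> \<le> nrm d (\<lambda>i. ?u i - ?u' i) + \<Delta> * nrm d ?u'"
    by (intro add_mono nrm_K_pow_le D)
  also have "\<Delta> * nrm d ?u' \<le> \<Delta> * nrm d v"
  proof (cases "\<Delta> \<ge> 0")
    case True then show ?thesis by (intro mult_left_mono C.nrm_K_pow_le)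
  next
    \<comment> \<open>A negative \<Delta> is compatible with \<open>D\<close> only if the norms
      vanish.\<close>
    case False
    then have "nrm d v = 0" using D0[of v] nrm_nonneg[of d v] by (simp add: zero_le_mult_iff)
    moreover have "nrm d ?u' = 0" using C.nrm_K_pow_le[of k v] nrm_nonneg[of d ?u'] calculation by simp
    ultimately show ?thesis by simp
  qed
  finally show ?case using Suc by (simp add: algebra_simps)
qed

text \<open>A vector common to the top plane of one chain and the hyperplane of the other compares
  the two second eigenvalues. The difference of squares factors into a difference bounded by
  \<open>k \<Delta>\<close> and a sum bounded by 2, both relative to the norm of the vector.\<close>

lemma power_gap_perturbation:
  assumes C: "ergodic_chain d M' \<pi>'"
    and D: "\<And>v. nrm d (\<lambda>i. mv d L v i - mv d (normalized_kernel \<pi>' M') v i) \<le> \<Delta> * nrm d v"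
  shows "power_gap \<pi>' M' k \<le> power_gap \<pi> M k + 2 * real k * \<Delta>"
proof -
  interpret C: ergodic_chain d M' \<pi>' by (rule C)
  obtain E0 E1 where E: "\<forall>x y. ip d (\<lambda>i. x * E0 i + y * E1 i) (\<lambda>i. x * E0 i + y * E1 i) = x\<^sup>2 + y\<^sup>2"
    "\<forall>x y. (1 - power_gap \<pi> M k) * (x\<^sup>2 + y\<^sup>2) \<le>
       ip d ((K ^^ k) (\<lambda>i. x * E0 i + y * E1 i)) ((K ^^ k) (\<lambda>i. x * E0 i + y * E1 i))"
    by (rule power_gap_plane[of k])
  obtain w where w: "\<forall>v. ip d w v = 0 \<longrightarrow>
      ip d ((C.K ^^ k) v) ((C.K ^^ k) v) \<le> (1 - power_gap \<pi>' M' k) * ip d v v"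
    by (rule C.power_gap_hyperplane[of k])
  obtain x y where xy: "x\<^sup>2 + y\<^sup>2 > 0" "x * ip d w E0 + y * ip d w E1 = 0"
    by (rule nontrivial_combination_orthogonal)
  define v where "v = (\<lambda>i. x * E0 i + y * E1 i)"
  let ?a = "nrm d ((K ^^ k) v)" and ?b = "nrm d ((C.K ^^ k) v)"
  have vv: "ip d v v > 0" using E(1)[rule_format, of x y] xy(1) by (simp add: v_def)
  have 1: "(1 - power_gap \<pi> M k) * ip d v v \<le> ?a\<^sup>2"
    using E[rule_format, of x y] by (simp add: v_def nrm_power2)
  have 2: "?b\<^sup>2 \<le> (1 - power_gap \<pi>' M' k) * ip d v v"
    using w[rule_format, of v] xy(2) by (simp add: v_def nrm_power2 ip_add_right ip_scale_right)
  have "?a \<le> ?b + nrm d (\<lambda>i. (K ^^ k) v i - (C.K ^^ k) v i)"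
    using nrm_add_le[of d "(C.K ^^ k) v" "\<lambda>i. (K ^^ k) v i - (C.K ^^ k) v i"] by simp
  then have ab: "?a - ?b \<le> real k * \<Delta> * nrm d v"
    using K_pow_perturbation[OF C D, of k v] by simp
  have "?a\<^sup>2 - ?b\<^sup>2 = (?a - ?b) * (?a + ?b)" by (simp add: power2_eq_square algebra_simps)
  also have "\<dots> \<le> (real k * \<Delta> * nrm d v) * (?a + ?b)"
    by (intro mult_right_mono ab add_nonneg_nonneg nrm_nonneg)
  also have "\<dots> \<le> (real k * \<Delta> * nrm d v) * (nrm d v + nrm d v)"
  proof (intro mult_left_mono add_mono nrm_K_pow_le C.nrm_K_pow_le)
    show "0 \<le> real k * \<Delta> * nrm d v"
      by (rule order_trans[OF nrm_nonneg K_pow_perturbation[OF C D]])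
  qed
  also have "\<dots> = 2 * real k * \<Delta> * (nrm d v)\<^sup>2" by (simp add: power2_eq_square)
  finally have "?a\<^sup>2 - ?b\<^sup>2 \<le> 2 * real k * \<Delta> * ip d v v" by (simp add: nrm_power2)
  with 1 2 have "(1 - power_gap \<pi> M k) * ip d v v \<le> (1 - power_gap \<pi>' M' k + 2 * real k * \<Delta>) * ip d v v"
    by (simp add: algebra_simps)
  then have "1 - power_gap \<pi> M k \<le> 1 - power_gap \<pi>' M' k + 2 * real k * \<Delta>"
    using vv by (simp only: mult_le_cancel_right_pos)
  then show ?thesis by simp
qed

lemma pseudo_gap_perturbation:
  assumes C: "ergodic_chain d M' \<pi>'"
    and D: "\<And>v. nrm d (\<lambda>i. mv d L v i - mv d (normalized_kernel \<pi>' M') v i) \<le> \<Delta> * nrm d v"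
  shows "pseudo_spectral_gap \<pi>' M' \<le> pseudo_spectral_gap \<pi> M + 2 * \<Delta>"
proof -
  interpret C: ergodic_chain d M' \<pi>' by (rule C)
  show ?thesis
    unfolding C.pseudo_gap_eq
  proof (rule cSUP_least)
    fix k :: nat assume "k \<in> {1..}"
    then have k: "k \<ge> 1" by simp
    have "power_gap \<pi>' M' k / real k \<le> (power_gap \<pi> M k + 2 * real k * \<Delta>) / real k"
      by (intro divide_right_mono power_gap_perturbation[OF C D]) auto
    also have "\<dots> = power_gap \<pi> M k / real k + 2 * \<Delta>" using k by (simp add: field_simps)
    finally show "power_gap \<pi>' M' k / real k \<le> pseudo_spectral_gap \<pi> M + 2 * \<Delta>"
      using power_gap_le_pseudo_gap[OF k] by simp
  qed simp
qed

end

section \<open>Exponential moments of additive functionals\<close>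

fun path_prob :: "real mat \<Rightarrow> nat list \<Rightarrow> real" where
  "path_prob M (x # y # ys) = M $$ (x, y) * path_prob M (y # ys)"
| "path_prob M xs = 1"

text \<open>Conditional expectation over \<open>n\<close> transitions given the initial state
  \<open>x\<close>, which belongs to the path passed to \<open>F\<close>; the initial law is
  averaged in only at the end.\<close>

definition path_exp :: "nat \<Rightarrow> real mat \<Rightarrow> nat \<Rightarrow> nat \<Rightarrow> (nat list \<Rightarrow> real) \<Rightarrow> real" where
  "path_exp d M n x F = (\<Sum>ys\<in>trajectories d n. path_prob M (x # ys) * F (x # ys))"

lemma trajectories_0: "trajectories d 0 = {[]}"
  by (auto simp: trajectories_def)

lemma sum_trajectories_Suc:
  "(\<Sum>xs\<in>trajectories d (Suc n). g xs) = (\<Sum>x<d. \<Sum>ys\<in>trajectories d n. g (x # ys))"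
proof -
  have "trajectories d (Suc n) = (\<lambda>(x, ys). x # ys) ` ({..<d} \<times> trajectories d n)"
    by (auto simp: trajectories_def length_Suc_conv image_def)
  moreover have "inj_on (\<lambda>(x, ys). x # ys) ({..<d} \<times> trajectories d n)"
    by (auto simp: inj_on_def)
  ultimately have "(\<Sum>xs\<in>trajectories d (Suc n). g xs) = (\<Sum>(x, ys)\<in>{..<d} \<times> trajectories d n. g (x # ys))"
    by (simp add: sum.reindex case_prod_unfold o_def)
  then show ?thesis by (simp add: sum.cartesian_product)
qed

lemma path_exp_0: "path_exp d M 0 x F = F [x]"
  by (simp add: path_exp_def trajectories_0)

lemma path_exp_Suc: "path_exp d M (Suc n) x F = (\<Sum>y<d. M $$ (x, y) * path_exp d M n y (\<lambda>zs. F (x # zs)))"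
  by (simp add: path_exp_def sum_trajectories_Suc sum_distrib_left mult.assoc)

lemma trajectory_prob_Cons: "trajectory_prob M \<mu> (x # ys) = \<mu> $ x * path_prob M (x # ys)"
proof -
  have "(\<Prod>t<length ys. M $$ ((x # ys) ! t, ys ! t)) = path_prob M (x # ys)"
    by (induction ys arbitrary: x) (simp_all del: prod.lessThan_Suc add: prod.lessThan_Suc_shift)
  then show ?thesis by (simp add: trajectory_prob_def)
qed

lemma sum_trajectory_prob_path_exp:
  "(\<Sum>xs\<in>trajectories d (Suc n). trajectory_prob M \<mu> xs * F xs) = (\<Sum>x<d. \<mu> $ x * path_exp d M n x F)"
  by (simp add: sum_trajectories_Suc trajectory_prob_Cons path_exp_def sum_distrib_left mult.assoc)

lemma path_exp_scale: "path_exp d M n x (\<lambda>zs. c * F zs) = c * path_exp d M n x F"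
  by (simp add: path_exp_def sum_distrib_left mult.left_commute)

lemma path_exp_sum: "path_exp d M n x (\<lambda>zs. \<Sum>r\<in>S. F r zs) = (\<Sum>r\<in>S. path_exp d M n x (F r))"
  unfolding path_exp_def sum_distrib_left by (rule sum.swap)

lemma path_exp_cong:
  assumes "\<And>zs. zs \<in> trajectories d n \<Longrightarrow> F (x # zs) = G (x # zs)"
  shows "path_exp d M n x F = path_exp d M n x G"
  using assms by (simp add: path_exp_def)

fun transition_sum :: "(nat \<Rightarrow> nat \<Rightarrow> real) \<Rightarrow> nat list \<Rightarrow> real" where
  "transition_sum f (x # y # ys) = f x y + transition_sum f (y # ys)"
| "transition_sum f xs = 0"

text \<open>
  Transitions are indexed by the number of states that remain, so that the residue classes modulo
  \<open>k\<close> split an additive functional into functionals of the \<open>k\<close>-skipped chain.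
\<close>

fun skipped_sum :: "nat \<Rightarrow> nat \<Rightarrow> (nat \<Rightarrow> real) \<Rightarrow> nat list \<Rightarrow> real" where
  "skipped_sum k r f (x # y # ys) =
     (if Suc (length ys) mod k = r then f x else 0) + skipped_sum k r f (y # ys)"
| "skipped_sum k r f xs = 0"

lemma sum_skipped_sum:
  assumes "k \<ge> 1"
  shows "(\<Sum>r<k. skipped_sum k r f xs) = transition_sum (\<lambda>x y. f x) xs"
proof (induction xs)
  case (Cons x xs)
  show ?case
  proof (cases xs)
    case (Cons y ys)
    have "(\<Sum>r<k. if Suc (length ys) mod k = r then f x else 0) = f x"
      using assms by (simp add: sum.delta')
    then show ?thesis using \<open>(\<Sum>r<k. skipped_sum k r f xs) = _\<close> Cons by (simp add: sum.distrib)
  qed simp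
qed simp

context ergodic_chain
begin

lemma path_prob_nonneg: "x < d \<Longrightarrow> ys \<in> trajectories d n \<Longrightarrow> path_prob M (x # ys) \<ge> 0"
proof (induction ys arbitrary: x n)
  case (Cons y ys)
  then have "y < d" "ys \<in> trajectories d (length ys)" by (auto simp: trajectories_def)
  then show ?case using Cons M_nonneg by simp
qed simp

lemma path_exp_mono:
  assumes "x < d" "\<And>zs. zs \<in> trajectories d n \<Longrightarrow> F (x # zs) \<le> G (x # zs)"
  shows "path_exp d M n x F \<le> path_exp d M n x G"
  unfolding path_exp_def using assms path_prob_nonneg by (intro sum_mono mult_left_mono) auto

abbreviation "mean f \<equiv> (\<Sum>i<d. \<pi> $ i * f i)"

lemma mean_nonneg: "(\<And>i. i < d \<Longrightarrow> f i \<ge> 0) \<Longrightarrow> mean f \<ge> 0"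
  by (intro sum_nonneg mult_nonneg_nonneg pi_nonneg) auto

lemma mean_mono: "(\<And>i. i < d \<Longrightarrow> f i \<le> g i) \<Longrightarrow> mean f \<le> mean g"
  by (intro sum_mono mult_left_mono pi_nonneg) auto

lemma mean_Cauchy_Schwarz: "(mean (\<lambda>i. f i * g i))\<^sup>2 \<le> mean (\<lambda>i. (f i)\<^sup>2) * mean (\<lambda>i. (g i)\<^sup>2)"
  using ip_Cauchy_Schwarz[of d "\<lambda>i. sqrt (\<pi> $ i) * f i" "\<lambda>i. sqrt (\<pi> $ i) * g i"]
  by (simp only: ip_pi power2_eq_square)

lemma mean_add: "mean (\<lambda>i. f i + g i) = mean f + mean g"
  by (simp add: sum.distrib distrib_left)

lemma mean_scale: "mean (\<lambda>i. c * f i) = c * mean f"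
  by (simp add: sum_distrib_left mult.left_commute)

lemma mean_const: "mean (\<lambda>i. c) = c"
  using pi_sum by (simp add: sum_distrib_right[symmetric])

lemma mean_variance:
  "mean (\<lambda>i. (f i - mean f)\<^sup>2) = mean (\<lambda>i. (f i)\<^sup>2) - (mean f)\<^sup>2"
  using weighted_variance_identity[OF pi_sum, of f] by simp

text \<open>
  The bilinear form of \<open>M\<^sup>k\<close> is dominated by that of the self-adjoint operator \<open>(1 - w) I + w \<Pi>\<close>,
  where \<open>\<Pi>\<close> projects onto the constants, so no reversibility is needed in the exponential moment bound.
\<close>

lemma bilinear_contraction:
  assumes g: "power_gap \<pi> M k = g" and w: "w = g / 2"
  defines "q \<equiv> \<lambda>u. w * (mean u)\<^sup>2 + (1 - w) * mean (\<lambda>i. (u i)\<^sup>2)"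
  shows "(mean (\<lambda>i. u i * mv d (P k) v i))\<^sup>2 \<le> q u * q v"
proof -
  let ?a = "mean u" and ?b = "mean v"
  define u' where "u' i = u i - ?a" for i
  define v' where "v' i = v i - ?b" for i
  let ?U = "mean (\<lambda>i. (u' i)\<^sup>2)" and ?V = "mean (\<lambda>i. (v' i)\<^sup>2)"
  have gb: "0 \<le> g" "g \<le> 1" using power_gap_bounds[of k] g by auto
  have U: "mean (\<lambda>i. (u i)\<^sup>2) = ?U + ?a\<^sup>2" and V: "mean (\<lambda>i. (v i)\<^sup>2) = ?V + ?b\<^sup>2"
    using mean_variance[of u] mean_variance[of v] by (simp_all add: u'_def v'_def)
  have UV0: "?U \<ge> 0" "?V \<ge> 0" by (intro mean_nonneg; simp)+
  have v'0: "mean v' = 0"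
    using mean_add[of v "\<lambda>_. - ?b"] by (simp add: v'_def mean_const sum_negf)
  have u'0: "mean u' = 0"
    using mean_add[of u "\<lambda>_. - ?a"] by (simp add: u'_def mean_const sum_negf)
  have Pv: "mv d (P k) v i = ?b + mv d (P k) v' i" if "i < d" for i
  proof -
    have "mv d (P k) v i = mv d (P k) (\<lambda>i. ?b + v' i) i" by (simp add: v'_def)
    also have "\<dots> = ?b * (\<Sum>j<d. P k i j) + mv d (P k) v' i"
      by (simp add: mv_def distrib_left sum.distrib sum_distrib_left mult.commute)
    finally show ?thesis using P_row[OF that] by simp
  qed
  let ?c = "mean (\<lambda>i. u' i * mv d (P k) v' i)"
  have "mean (\<lambda>i. u i * mv d (P k) v i) = mean (\<lambda>i. ?a * ?b + (?b * u' i + (?a * mv d (P k) v' i + u' i * mv d (P k) v' i)))"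
    using Pv by (intro sum.cong refl) (simp add: u'_def algebra_simps)
  also have "\<dots> = ?a * ?b + (?b * mean u' + (?a * mean (mv d (P k) v') + ?c))"
    by (simp only: mean_add mean_scale mean_const)
  finally have main: "mean (\<lambda>i. u i * mv d (P k) v i) = ?a * ?b + ?c"
    using u'0 v'0 by (simp add: mean_mv_P)
  have "?c\<^sup>2 \<le> ?U * mean (\<lambda>i. (mv d (P k) v' i)\<^sup>2)" by (rule mean_Cauchy_Schwarz)
  also have "\<dots> \<le> ?U * ((1 - g) * ?V)"
    using mean_zero_contraction[OF v'0, of k] g UV0 by (intro mult_left_mono) auto
  \<comment> \<open>\<open>1 - g <= (1 - w)^2\<close> because \<open>w = g / 2\<close>.\<close>
  also have "\<dots> \<le> ?U * ((1 - w)\<^sup>2 * ?V)"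
    using UV0 w by (intro mult_left_mono mult_right_mono) (auto simp: power2_eq_square algebra_simps)
  finally have c: "?c\<^sup>2 \<le> ((1 - w) * sqrt ?U * sqrt ?V)\<^sup>2"
    using UV0 by (simp add: power_mult_distrib mult_ac)
  have w1: "0 \<le> 1 - w" using gb w by simp
  have "\<bar>?c\<bar> \<le> (1 - w) * sqrt ?U * sqrt ?V"
    using c w1 UV0 by (simp add: abs_le_square_iff[symmetric] abs_mult)
  then have "\<bar>?a * ?b + ?c\<bar> \<le> \<bar>?a\<bar> * \<bar>?b\<bar> + (1 - w) * sqrt ?U * sqrt ?V"
    by (simp add: abs_mult[symmetric])
  then have "(?a * ?b + ?c)\<^sup>2 \<le> (\<bar>?a\<bar> * \<bar>?b\<bar> + (1 - w) * sqrt ?U * sqrt ?V)\<^sup>2"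
    using abs_le_square_iff[of "?a * ?b + ?c" "\<bar>?a\<bar> * \<bar>?b\<bar> + (1 - w) * sqrt ?U * sqrt ?V"] by linarith
  also have "\<dots> \<le> (\<bar>?a\<bar>\<^sup>2 + (1 - w) * (sqrt ?U)\<^sup>2) * (\<bar>?b\<bar>\<^sup>2 + (1 - w) * (sqrt ?V)\<^sup>2)"
  proof -
    \<comment> \<open>Lagrange's identity with weights 1 and \<open>1 - w\<close>, that is,
      Cauchy-Schwarz with its defect.\<close>
    have "(A\<^sup>2 + (1 - w) * S\<^sup>2) * (B\<^sup>2 + (1 - w) * R\<^sup>2) - (A * B + (1 - w) * S * R)\<^sup>2 =
        (1 - w) * (A * R - B * S)\<^sup>2" for A B S R
      by (simp add: power2_eq_square algebra_simps)
    from this[of "\<bar>?a\<bar>" "sqrt ?U" "\<bar>?b\<bar>" "sqrt ?V"] show ?thesis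
      using mult_nonneg_nonneg[OF w1 zero_le_power2[of "\<bar>?a\<bar> * sqrt ?V - \<bar>?b\<bar> * sqrt ?U"]] by linarith
  qed
  also have "\<dots> = q u * q v"
    using UV0 unfolding q_def U V by (simp add: algebra_simps)
  finally show ?thesis unfolding main .
qed

end

section \<open>Scalar inequalities for the exponential moment bound\<close>

lemma exp_le_quadratic:
  fixes x :: real
  assumes "\<bar>x\<bar> \<le> 1"
  shows "exp x \<le> 1 + x + x\<^sup>2"
proof (cases "x \<ge> 0")
  case True
  then show ?thesis using exp_bound[of x] assms by simp
next
  case False
  define t where "t = - x"
  have t: "0 < t" using False by (simp add: t_def)
  have "1 \<le> (1 + t) * (1 - t + t\<^sup>2)"
  proof -
    have "(1 + t) * (1 - t + t\<^sup>2) = 1 + t ^ 3" by (simp add: power2_eq_square power3_eq_cube algebra_simps)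
    then show ?thesis using t by simp
  qed
  also have "\<dots> \<le> exp t * (1 - t + t\<^sup>2)"
  proof (rule mult_right_mono)
    have "1 - t + t\<^sup>2 = (1 - t / 2)\<^sup>2 + 3 / 4 * t\<^sup>2" by (simp add: power2_eq_square algebra_simps)
    then show "0 \<le> 1 - t + t\<^sup>2" by simp
  qed (rule exp_ge_add_one_self)
  finally have "exp (- t) * 1 \<le> exp (- t) * (exp t * (1 - t + t\<^sup>2))"
    by (intro mult_left_mono) auto
  also have "\<dots> = 1 - t + t\<^sup>2" by (simp add: mult.assoc[symmetric] exp_add[symmetric])
  finally show ?thesis by (simp add: t_def)
qed

text \<open>Here \<open>c\<close> is the size of the mean of a function, \<open>y\<close> its
  standard deviation and \<open>s = t \<sigma>\<close>. The mixed term \<open>3 c s y\<close> is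
  only of first order in \<open>s\<close>; the slack \<open>w y^2\<close> of the form absorbs it at
  the price of \<open>1 / w\<close>. This is how the spectral gap enters the moment bound.\<close>

lemma tilted_form_arithmetic:
  fixes w t s c y A B :: real
  assumes c: "0 \<le> c" and y: "0 \<le> y" and s: "0 \<le> s" "s \<le> t" and t: "6 * t \<le> w" and w: "0 < w" "w \<le> 1"
    and A: "A \<le> c\<^sup>2 + y\<^sup>2 + 2 * c * s * y + t * y\<^sup>2 + 2 * c\<^sup>2 * s\<^sup>2 + 2 * t\<^sup>2 * y\<^sup>2"
    and B: "0 \<le> B" "B \<le> c * (1 + s\<^sup>2 / 4) + s * y"
  shows "w * B\<^sup>2 + (1 - w) * A \<le> (1 + 7 * s\<^sup>2 / w) * (c\<^sup>2 + y\<^sup>2)"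
proof -
  let ?Z = "c\<^sup>2 + 3 * (c * s * y) + 2 * (c\<^sup>2 * s\<^sup>2) + 2 * (t * y\<^sup>2)"
  have t0: "0 \<le> t" "t \<le> 1 / 6" and s1: "s \<le> 1" using s t w by auto
  have ss: "s\<^sup>2 \<le> t"
  proof -
    have "s\<^sup>2 \<le> s * 1" unfolding power2_eq_square using s s1 by (intro mult_left_mono) auto
    then show ?thesis using s by simp
  qed
  have csy: "0 \<le> c * s * y" using c s y by simp
  have tt: "2 * t\<^sup>2 * y\<^sup>2 \<le> t * y\<^sup>2"
  proof -
    have "2 * t\<^sup>2 \<le> t * 1" unfolding power2_eq_square using mult_left_mono[of "2 * t" 1 t] t0 by (simp add: mult_ac)
    then show ?thesis by (intro mult_right_mono) auto
  qed
  have A': "A \<le> ?Z + y\<^sup>2" using A tt csy by (simp add: mult_ac)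
  have "B\<^sup>2 \<le> (c * (1 + s\<^sup>2 / 4) + s * y)\<^sup>2" using B by (intro power_mono) auto
  also have "\<dots> = c\<^sup>2 * (1 + s\<^sup>2 / 2 + s\<^sup>2 * s\<^sup>2 / 16) + (2 + s\<^sup>2 / 2) * (c * s * y) + s\<^sup>2 * y\<^sup>2"
    by (simp add: power2_eq_square algebra_simps)
  also have "\<dots> \<le> c\<^sup>2 * (1 + 2 * s\<^sup>2) + 3 * (c * s * y) + 2 * t * y\<^sup>2"
  proof -
    have "s\<^sup>2 * s\<^sup>2 \<le> s\<^sup>2 * 1" using ss t0 by (intro mult_left_mono) auto
    then have "1 + s\<^sup>2 / 2 + s\<^sup>2 * s\<^sup>2 / 16 \<le> 1 + 2 * s\<^sup>2" using zero_le_power2[of s] by linarith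
    then have "c\<^sup>2 * (1 + s\<^sup>2 / 2 + s\<^sup>2 * s\<^sup>2 / 16) \<le> c\<^sup>2 * (1 + 2 * s\<^sup>2)"
      by (rule mult_left_mono) simp
    moreover have "(2 + s\<^sup>2 / 2) * (c * s * y) \<le> 3 * (c * s * y)"
      using ss t0 csy by (intro mult_right_mono) auto
    moreover have "s\<^sup>2 * y\<^sup>2 \<le> 2 * t * y\<^sup>2"
      using ss t0 by (intro mult_right_mono) auto
    ultimately show ?thesis by linarith
  qed
  finally have B': "B\<^sup>2 \<le> ?Z" by (simp add: algebra_simps)
  have "w * B\<^sup>2 + (1 - w) * A \<le> w * ?Z + (1 - w) * (?Z + y\<^sup>2)"
    using A' B' w by (intro add_mono mult_left_mono) auto
  also have "\<dots> = ?Z + (1 - w) * y\<^sup>2" by (simp add: algebra_simps)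
  also have "\<dots> \<le> c\<^sup>2 + y\<^sup>2 + 7 * s\<^sup>2 / w * c\<^sup>2"
  proof -
    \<comment> \<open>Completing the square spends half of \<open>w y^2\<close> and yields the
      constant 9/2; the term \<open>2 t y^2\<close> spends a further third. The sum 9/2 + 2 is
      rounded up to 7.\<close>
    have "0 \<le> (w * y - 3 * (c * s))\<^sup>2" by simp
    then have "6 * w * (c * s * y) \<le> w\<^sup>2 * y\<^sup>2 + 9 * (c\<^sup>2 * s\<^sup>2)"
      by (simp add: power2_eq_square algebra_simps)
    then have 1: "3 * (c * s * y) \<le> w * y\<^sup>2 / 2 + 9 / 2 * (c\<^sup>2 * s\<^sup>2) / w"
      using w by (simp add: field_simps power2_eq_square)
    have "2 * (c\<^sup>2 * s\<^sup>2) * w \<le> 2 * (c\<^sup>2 * s\<^sup>2) * 1" using w by (intro mult_left_mono) auto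
    then have 2: "2 * (c\<^sup>2 * s\<^sup>2) \<le> 2 * (c\<^sup>2 * s\<^sup>2) / w"
      using w by (simp add: field_simps)
    have "6 * t * y\<^sup>2 \<le> w * y\<^sup>2" using t by (intro mult_right_mono) auto
    then have 3: "2 * (t * y\<^sup>2) \<le> w * y\<^sup>2 / 3" by simp
    have 4: "9 / 2 * (c\<^sup>2 * s\<^sup>2) / w + 2 * (c\<^sup>2 * s\<^sup>2) / w \<le> 7 * s\<^sup>2 / w * c\<^sup>2"
      using w by (simp add: field_simps)
    have "0 \<le> w * y\<^sup>2" using w by simp
    with 1 2 3 4 show ?thesis by (simp add: algebra_simps)
  qed
  also have "\<dots> \<le> (1 + 7 * s\<^sup>2 / w) * (c\<^sup>2 + y\<^sup>2)"
  proof -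
    have "0 \<le> 7 * s\<^sup>2 / w * y\<^sup>2" using w by simp
    then show ?thesis by (simp add: algebra_simps add_divide_distrib)
  qed
  finally show ?thesis .
qed

text \<open>A class has at most \<open>T / k + 1\<close> members, and \<open>k <= T\<close> absorbs
  the extra one.\<close>

lemma card_residue_class_le:
  fixes k T :: nat
  assumes "1 \<le> k" "k \<le> T"
  shows "real k * real (card {j\<in>{1..T}. j mod k = r}) \<le> 2 * real T"
proof -
  have "{j\<in>{1..T}. j mod k = r} \<subseteq> (\<lambda>a. a * k + r) ` {0..T div k}"
  proof
    fix j assume j: "j \<in> {j\<in>{1..T}. j mod k = r}"
    then have "j = (j div k) * k + r" using div_mult_mod_eq[of j k] by simp
    moreover have "j div k \<in> {0..T div k}" using j by (simp add: div_le_mono)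
    ultimately show "j \<in> (\<lambda>a. a * k + r) ` {0..T div k}" by blast
  qed
  then have "card {j\<in>{1..T}. j mod k = r} \<le> card ((\<lambda>a. a * k + r) ` {0..T div k})"
    by (intro card_mono) auto
  also have "\<dots> \<le> T div k + 1" using card_image_le[of "{0..T div k}" "\<lambda>a. a * k + r"] by simp
  finally have "k * card {j\<in>{1..T}. j mod k = r} \<le> k * (T div k + 1)" by (rule mult_le_mono2)
  also have "\<dots> \<le> T + k" by (simp add: algebra_simps)
  also have "\<dots> \<le> 2 * T" using assms by simp
  finally show ?thesis by (metis of_nat_le_iff of_nat_mult of_nat_numeral)
qed

text \<open>Convexity of \<open>exp\<close> separates the dependent residue classes, at the price of
  multiplying each exponent by \<open>k\<close>.\<close>

lemma exp_average_le:
  assumes "k \<ge> 1"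
  shows "exp (\<Sum>r<k. a r) \<le> (1 / real k) * (\<Sum>r<k. exp (real k * a r))"
proof -
  let ?m = "\<Sum>r<k. a r"
  have "real k * exp ?m = (\<Sum>r<k. exp ?m + exp ?m * (real k * a r - ?m))"
    by (simp add: sum.distrib sum_distrib_left[symmetric] sum_subtractf)
  also have "\<dots> \<le> (\<Sum>r<k. exp (real k * a r))" by (intro sum_mono exp_tangent)
  finally show ?thesis using assms by (simp add: field_simps)
qed

context ergodic_chain
begin

lemma mean_mult_le:
  assumes "mean (\<lambda>i. (f i)\<^sup>2) \<le> a\<^sup>2" "mean (\<lambda>i. (g i)\<^sup>2) \<le> b\<^sup>2" "0 \<le> a" "0 \<le> b"
  shows "\<bar>mean (\<lambda>i. f i * g i)\<bar> \<le> a * b"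
proof -
  have "(mean (\<lambda>i. f i * g i))\<^sup>2 \<le> mean (\<lambda>i. (f i)\<^sup>2) * mean (\<lambda>i. (g i)\<^sup>2)" by (rule mean_Cauchy_Schwarz)
  also have "\<dots> \<le> a\<^sup>2 * b\<^sup>2" using assms by (intro mult_mono mean_nonneg) auto
  finally have "(mean (\<lambda>i. f i * g i))\<^sup>2 \<le> (a * b)\<^sup>2" by (simp add: power_mult_distrib)
  then show ?thesis using assms by (metis abs_le_square_iff abs_of_nonneg mult_nonneg_nonneg)
qed

text \<open>Split \<open>u\<close> into mean and fluctuation. The first-order effect of the tilt on
  the mean part cancels because \<open>f\<close> is centred; the mixed terms that remain are of the
  kind that \<open>tilted_form_arithmetic\<close> absorbs.\<close>

lemma tilted_form_le:
  assumes f: "\<And>i. i < d \<Longrightarrow> \<bar>f i\<bar> \<le> 1" and f0: "mean f = 0" and fv: "mean (\<lambda>i. (f i)\<^sup>2) \<le> \<sigma>\<^sup>2"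
    and \<sigma>: "0 \<le> \<sigma>" "\<sigma> \<le> 1" and t: "0 \<le> t" "6 * t \<le> w" and w: "0 < w" "w \<le> 1"
  shows "w * (mean (\<lambda>i. exp (t * f i / 2) * u i))\<^sup>2 + (1 - w) * mean (\<lambda>i. (exp (t * f i / 2) * u i)\<^sup>2)
    \<le> (1 + 7 * (t * \<sigma>)\<^sup>2 / w) * mean (\<lambda>i. (u i)\<^sup>2)"
proof -
  define m where "m = mean u"
  define u0 where "u0 i = u i - m" for i
  define y where "y = sqrt (mean (\<lambda>i. (u0 i)\<^sup>2))"
  have u: "u = (\<lambda>i. m + u0 i)" by (simp add: u0_def)
  have y0: "0 \<le> y" by (simp add: y_def mean_nonneg)
  have y2: "mean (\<lambda>i. (u0 i)\<^sup>2) = y\<^sup>2" by (simp add: y_def mean_nonneg)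
  have var: "mean (\<lambda>i. (u i)\<^sup>2) = \<bar>m\<bar>\<^sup>2 + y\<^sup>2"
    using mean_variance[of u] y2 by (simp add: u0_def m_def)
  have fu: "\<bar>mean (\<lambda>i. f i * u0 i)\<bar> \<le> \<sigma> * y"
    by (rule mean_mult_le) (use fv y2 \<sigma> y0 in auto)
  have fu': "\<bar>mean (\<lambda>i. \<bar>f i\<bar> * \<bar>u0 i\<bar>)\<bar> \<le> \<sigma> * y"
    by (rule mean_mult_le) (use fv y2 \<sigma> y0 in auto)
  have f2: "(f i)\<^sup>2 \<le> 1" if "i < d" for i using f[OF that] by (simp add: abs_square_le_1)
  have tf: "\<bar>t * f i\<bar> \<le> 1 / 6" if "i < d" for i
  proof -
    have "\<bar>t * f i\<bar> \<le> t * 1" unfolding abs_mult using t f[OF that] by (intro mult_mono) auto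
    then show ?thesis using t w by simp
  qed
  have A: "mean (\<lambda>i. (exp (t * f i / 2) * u i)\<^sup>2) \<le>
      \<bar>m\<bar>\<^sup>2 + y\<^sup>2 + 2 * \<bar>m\<bar> * (t * \<sigma>) * y + t * y\<^sup>2 + 2 * \<bar>m\<bar>\<^sup>2 * (t * \<sigma>)\<^sup>2 + 2 * t\<^sup>2 * y\<^sup>2"
  proof -
    have "mean (\<lambda>i. (exp (t * f i / 2) * u i)\<^sup>2) \<le>
        mean (\<lambda>i. (u i)\<^sup>2 + (t * (m\<^sup>2 * f i + ((2 * m) * (f i * u0 i) + (u0 i)\<^sup>2)) +
          t\<^sup>2 * ((2 * m\<^sup>2) * (f i)\<^sup>2 + 2 * (u0 i)\<^sup>2)))"
    proof (rule mean_mono)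
      fix i assume i: "i < d"
      have "(exp (t * f i / 2) * u i)\<^sup>2 = exp (t * f i) * (u i)\<^sup>2"
        by (simp add: power_mult_distrib exp_double[symmetric])
      also have "\<dots> \<le> (1 + t * f i + (t * f i)\<^sup>2) * (u i)\<^sup>2"
        using tf[OF i] by (intro mult_right_mono exp_le_quadratic) auto
      also have "\<dots> = (u i)\<^sup>2 + t * (f i * (u i)\<^sup>2) + t\<^sup>2 * ((f i)\<^sup>2 * (u i)\<^sup>2)"
        by (simp add: power_mult_distrib algebra_simps)
      also have "\<dots> \<le> (u i)\<^sup>2 + t * (m\<^sup>2 * f i + ((2 * m) * (f i * u0 i) + (u0 i)\<^sup>2)) +
          t\<^sup>2 * ((2 * m\<^sup>2) * (f i)\<^sup>2 + 2 * (u0 i)\<^sup>2)"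
      proof (intro add_mono mult_left_mono order_refl)
        have "f i * (u0 i)\<^sup>2 \<le> 1 * (u0 i)\<^sup>2" using f[OF i] by (intro mult_right_mono) auto
        then show "f i * (u i)\<^sup>2 \<le> m\<^sup>2 * f i + ((2 * m) * (f i * u0 i) + (u0 i)\<^sup>2)"
          by (simp add: u power2_eq_square algebra_simps)
        have "(u i)\<^sup>2 \<le> 2 * m\<^sup>2 + 2 * (u0 i)\<^sup>2"
          using zero_le_power2[of "m - u0 i"] by (simp add: u power2_eq_square algebra_simps)
        then have "(f i)\<^sup>2 * (u i)\<^sup>2 \<le> (f i)\<^sup>2 * (2 * m\<^sup>2 + 2 * (u0 i)\<^sup>2)" by (intro mult_left_mono) auto
        also have "\<dots> \<le> (2 * m\<^sup>2) * (f i)\<^sup>2 + 2 * (u0 i)\<^sup>2"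
          using mult_right_mono[OF f2[OF i], of "2 * (u0 i)\<^sup>2"] by (simp add: algebra_simps)
        finally show "(f i)\<^sup>2 * (u i)\<^sup>2 \<le> (2 * m\<^sup>2) * (f i)\<^sup>2 + 2 * (u0 i)\<^sup>2" .
      qed (use t in auto)
      finally show "(exp (t * f i / 2) * u i)\<^sup>2 \<le> (u i)\<^sup>2 + (t * (m\<^sup>2 * f i + ((2 * m) * (f i * u0 i) + (u0 i)\<^sup>2)) +
          t\<^sup>2 * ((2 * m\<^sup>2) * (f i)\<^sup>2 + 2 * (u0 i)\<^sup>2))" by simp
    qed
    also have "\<dots> = (\<bar>m\<bar>\<^sup>2 + y\<^sup>2) + (t * (m\<^sup>2 * 0 + ((2 * m) * mean (\<lambda>i. f i * u0 i) + y\<^sup>2)) +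
          t\<^sup>2 * ((2 * m\<^sup>2) * mean (\<lambda>i. (f i)\<^sup>2) + 2 * y\<^sup>2))"
      by (simp only: mean_add mean_scale f0 y2 var)
    also have "\<dots> \<le> (\<bar>m\<bar>\<^sup>2 + y\<^sup>2) + (t * (m\<^sup>2 * 0 + (2 * \<bar>m\<bar> * (\<sigma> * y) + y\<^sup>2)) +
          t\<^sup>2 * ((2 * m\<^sup>2) * \<sigma>\<^sup>2 + 2 * y\<^sup>2))"
    proof (intro add_mono mult_left_mono order_refl fv)
      have "2 * m * mean (\<lambda>i. f i * u0 i) \<le> \<bar>2 * m\<bar> * \<bar>mean (\<lambda>i. f i * u0 i)\<bar>"
        by (metis abs_ge_self abs_mult)
      also have "\<dots> \<le> 2 * \<bar>m\<bar> * (\<sigma> * y)" using fu by (simp add: abs_mult mult_left_mono)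
      finally show "2 * m * mean (\<lambda>i. f i * u0 i) \<le> 2 * \<bar>m\<bar> * (\<sigma> * y)" .
    qed (use t in auto)
    also have "\<dots> = \<bar>m\<bar>\<^sup>2 + y\<^sup>2 + 2 * \<bar>m\<bar> * (t * \<sigma>) * y + t * y\<^sup>2 + 2 * \<bar>m\<bar>\<^sup>2 * (t * \<sigma>)\<^sup>2 + 2 * t\<^sup>2 * y\<^sup>2"
      by (simp add: power_mult_distrib algebra_simps)
    finally show ?thesis .
  qed
  have B: "\<bar>mean (\<lambda>i. exp (t * f i / 2) * u i)\<bar> \<le> \<bar>m\<bar> * (1 + (t * \<sigma>)\<^sup>2 / 4) + (t * \<sigma>) * y"
  proof -
    \<comment> \<open>The Taylor remainder is at most \<open>t^2 f^2 / 4\<close>, so its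
      contribution is governed by \<sigma> rather than by the sup norm of \<open>f\<close>.\<close>
    define r where "r i = exp (t * f i / 2) - 1 - t * f i / 2" for i
    have r: "\<bar>r i\<bar> \<le> t\<^sup>2 / 4 * (f i)\<^sup>2" if "i < d" for i
    proof -
      have "exp (t * f i / 2) \<le> 1 + t * f i / 2 + (t * f i / 2)\<^sup>2"
        using tf[OF that] by (intro exp_le_quadratic) auto
      moreover have "1 + t * f i / 2 \<le> exp (t * f i / 2)" by (rule exp_ge_add_one_self)
      moreover have "(t * f i / 2)\<^sup>2 = t\<^sup>2 / 4 * (f i)\<^sup>2" by (simp add: power_mult_distrib power_divide)
      ultimately show ?thesis unfolding r_def by linarith
    qed
    have "mean (\<lambda>i. exp (t * f i / 2) * u i) =
        mean (\<lambda>i. m + (u0 i + ((t / 2 * m) * f i + (t / 2 * (f i * u0 i) + r i * u i))))"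
      by (intro sum.cong refl) (simp add: u r_def algebra_simps)
    also have "\<dots> = m + (mean u0 + ((t / 2 * m) * mean f + (t / 2 * mean (\<lambda>i. f i * u0 i) + mean (\<lambda>i. r i * u i))))"
      by (simp only: mean_add mean_scale mean_const)
    also have "mean u0 = 0"
      using mean_add[of u "\<lambda>_. - m"] by (simp add: u0_def[abs_def] mean_const sum_negf m_def)
    finally have eq: "mean (\<lambda>i. exp (t * f i / 2) * u i) = m + (t / 2 * mean (\<lambda>i. f i * u0 i) + mean (\<lambda>i. r i * u i))"
      using f0 by simp
    have "\<bar>mean (\<lambda>i. r i * u i)\<bar> \<le> mean (\<lambda>i. \<bar>r i * u i\<bar>)"
      using sum_abs[of "\<lambda>i. \<pi> $ i * (r i * u i)" "{..<d}"] pi_nonneg by (simp add: abs_mult)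
    also have "\<dots> \<le> mean (\<lambda>i. t\<^sup>2 / 4 * (\<bar>m\<bar> * (f i)\<^sup>2 + \<bar>f i\<bar> * \<bar>u0 i\<bar>))"
    proof (rule mean_mono)
      fix i assume i: "i < d"
      have "\<bar>r i * u i\<bar> \<le> (t\<^sup>2 / 4 * (f i)\<^sup>2) * (\<bar>m\<bar> + \<bar>u0 i\<bar>)"
        unfolding abs_mult using r[OF i] by (intro mult_mono) (auto simp: u)
      also have "\<dots> = t\<^sup>2 / 4 * (\<bar>m\<bar> * (f i)\<^sup>2 + (\<bar>f i\<bar> * \<bar>f i\<bar>) * \<bar>u0 i\<bar>)"
        by (simp add: power2_eq_square algebra_simps)
      also have "\<dots> \<le> t\<^sup>2 / 4 * (\<bar>m\<bar> * (f i)\<^sup>2 + (1 * \<bar>f i\<bar>) * \<bar>u0 i\<bar>)"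
        using f[OF i] by (intro mult_left_mono add_mono order_refl mult_right_mono) auto
      finally show "\<bar>r i * u i\<bar> \<le> t\<^sup>2 / 4 * (\<bar>m\<bar> * (f i)\<^sup>2 + \<bar>f i\<bar> * \<bar>u0 i\<bar>)" by simp
    qed
    also have "\<dots> = t\<^sup>2 / 4 * (\<bar>m\<bar> * mean (\<lambda>i. (f i)\<^sup>2) + mean (\<lambda>i. \<bar>f i\<bar> * \<bar>u0 i\<bar>))"
      by (simp only: mean_add mean_scale)
    also have "\<dots> \<le> t\<^sup>2 / 4 * (\<bar>m\<bar> * \<sigma>\<^sup>2 + \<sigma> * y)"
      using fu' fv by (intro mult_left_mono add_mono) auto
    finally have R: "\<bar>mean (\<lambda>i. r i * u i)\<bar> \<le> t\<^sup>2 / 4 * (\<bar>m\<bar> * \<sigma>\<^sup>2 + \<sigma> * y)" .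
    have F: "\<bar>t / 2 * mean (\<lambda>i. f i * u0 i)\<bar> \<le> t / 2 * (\<sigma> * y)"
      unfolding abs_mult using t fu by (intro mult_mono) auto
    have "\<bar>mean (\<lambda>i. exp (t * f i / 2) * u i)\<bar> \<le> \<bar>m\<bar> + (t / 2 * (\<sigma> * y) + t\<^sup>2 / 4 * (\<bar>m\<bar> * \<sigma>\<^sup>2 + \<sigma> * y))"
      unfolding eq using F R by linarith
    also have "\<dots> = \<bar>m\<bar> * (1 + (t * \<sigma>)\<^sup>2 / 4) + (t * \<sigma>) * y * (1 / 2 + t / 4)"
      by (simp add: power2_eq_square algebra_simps)
    also have "\<dots> \<le> \<bar>m\<bar> * (1 + (t * \<sigma>)\<^sup>2 / 4) + (t * \<sigma>) * y * 1"
      using t w y0 \<sigma> by (intro add_mono order_refl mult_left_mono) auto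
    finally show ?thesis by simp
  qed
  have "t * \<sigma> \<le> t" using mult_left_mono[OF \<sigma>(2) t(1)] by simp
  then have "w * \<bar>mean (\<lambda>i. exp (t * f i / 2) * u i)\<bar>\<^sup>2 + (1 - w) * mean (\<lambda>i. (exp (t * f i / 2) * u i)\<^sup>2)
    \<le> (1 + 7 * (t * \<sigma>)\<^sup>2 / w) * (\<bar>m\<bar>\<^sup>2 + y\<^sup>2)"
    by (intro tilted_form_arithmetic[OF abs_ge_zero y0 _ _ t(2) w A abs_ge_zero B]) (use t \<sigma> in auto)
  then show ?thesis by (simp only: var power2_abs)
qed

lemma M_P_Suc:
  assumes "x < d"
  shows "(\<Sum>y<d. M $$ (x, y) * mv d (P q) v y) = mv d (P (Suc q)) v x"
proof -
  have "(\<Sum>y<d. M $$ (x, y) * mv d (P q) v y) = mv d (\<lambda>i j. M $$ (i, j)) ((mv d (\<lambda>i j. M $$ (i, j)) ^^ q) v) x"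
    unfolding mv_def[of d _ "(_ ^^ q) v"] using mv_mat_pow[OF M_carrier] by (intro sum.cong) auto
  also have "\<dots> = mv d (P (Suc q)) v x"
    using mv_mat_pow[OF M_carrier assms, of "Suc q" v] by simp
  finally show ?thesis .
qed

context
  fixes k :: nat and f :: "nat \<Rightarrow> real" and t \<sigma> w \<rho> :: real
  assumes k: "k \<ge> 1" and w: "w = power_gap \<pi> M k / 2" and w0: "0 < w"
    and f: "\<And>i. i < d \<Longrightarrow> \<bar>f i\<bar> \<le> 1" and f0: "mean f = 0" and fv: "mean (\<lambda>i. (f i)\<^sup>2) \<le> \<sigma>\<^sup>2"
    and \<sigma>: "0 \<le> \<sigma>" "\<sigma> \<le> 1" and t: "0 \<le> t" "6 * t \<le> w" and \<rho>: "\<rho> = 1 + 7 * (t * \<sigma>)\<^sup>2 / w"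
begin

lemma w_le_half: "w \<le> 1 / 2"
  using w power_gap_bounds(2)[of k] by simp

lemma rho_ge_1: "1 \<le> \<rho>"
  using w0 by (simp add: \<rho>)

text \<open>The squared norm \<open>N\<close> of the new function is a bilinear form in its own tilt
  and the tilt of \<open>\<kappa>\<close>; \<open>bilinear_contraction\<close> and the tilt bound
  give \<open>N^2 <= (\<rho> N) (\<rho> Q)\<close>, and one factor \<open>N\<close> cancels.\<close>

lemma tilted_step:
  assumes "mean (\<lambda>i. (\<kappa> i)\<^sup>2) \<le> (\<rho> ^ c)\<^sup>2"
  shows "mean (\<lambda>i. (exp (t * f i / 2) * mv d (P k) (\<lambda>j. exp (t * f j / 2) * \<kappa> j) i)\<^sup>2) \<le> (\<rho> ^ Suc c)\<^sup>2"
proof -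
  define v where "v i = exp (t * f i / 2) * mv d (P k) (\<lambda>j. exp (t * f j / 2) * \<kappa> j) i" for i
  let ?N = "mean (\<lambda>i. (v i)\<^sup>2)" and ?Q = "mean (\<lambda>i. (\<kappa> i)\<^sup>2)"
  have N0: "0 \<le> ?N" "0 \<le> ?Q" by (intro mean_nonneg; simp)+
  have w1: "w \<le> 1" using w_le_half by simp
  note tilt = tilted_form_le[OF f f0 fv \<sigma> t w0 w1, folded \<rho>]
  have eq: "?N = mean (\<lambda>i. (exp (t * f i / 2) * v i) * mv d (P k) (\<lambda>j. exp (t * f j / 2) * \<kappa> j) i)"
    by (intro sum.cong refl) (simp add: v_def power2_eq_square mult_ac)
  have "?N\<^sup>2 \<le> (w * (mean (\<lambda>i. exp (t * f i / 2) * v i))\<^sup>2 + (1 - w) * mean (\<lambda>i. (exp (t * f i / 2) * v i)\<^sup>2)) *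
      (w * (mean (\<lambda>i. exp (t * f i / 2) * \<kappa> i))\<^sup>2 + (1 - w) * mean (\<lambda>i. (exp (t * f i / 2) * \<kappa> i)\<^sup>2))"
    using bilinear_contraction[OF refl w, of "\<lambda>i. exp (t * f i / 2) * v i" "\<lambda>i. exp (t * f i / 2) * \<kappa> i"]
    unfolding eq .
  also have "\<dots> \<le> (\<rho> * ?N) * (\<rho> * ?Q)"
  proof (rule mult_mono[OF tilt[of v] tilt[of \<kappa>]])
    show "0 \<le> w * (mean (\<lambda>i. exp (t * f i / 2) * \<kappa> i))\<^sup>2 + (1 - w) * mean (\<lambda>i. (exp (t * f i / 2) * \<kappa> i)\<^sup>2)"
      using w0 w1 by (intro add_nonneg_nonneg mult_nonneg_nonneg mean_nonneg) auto
  qed (use N0 rho_ge_1 in auto)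
  finally have "?N * ?N \<le> ?N * (\<rho>\<^sup>2 * ?Q)" by (simp add: power2_eq_square mult_ac)
  then have "?N \<le> \<rho>\<^sup>2 * ?Q"
    using N0 by (cases "?N = 0") (auto simp: mult_le_cancel_left)
  also have "\<dots> \<le> \<rho>\<^sup>2 * (\<rho> ^ c)\<^sup>2" using assms by (intro mult_left_mono) auto
  finally show ?thesis by (simp add: v_def power_mult_distrib)
qed

lemma tilted_start: "mean (\<lambda>i. (exp (t * f i / 2))\<^sup>2) \<le> \<rho>\<^sup>2"
proof -
  have "mean (\<lambda>i. (exp (t * f i / 2))\<^sup>2) \<le> mean (\<lambda>i. 1 + (t * f i + t\<^sup>2 * (f i)\<^sup>2))"
  proof (rule mean_mono)
    fix i assume i: "i < d"
    have "\<bar>t * f i\<bar> \<le> t * 1" unfolding abs_mult using t f[OF i] by (intro mult_mono) auto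
    then have "exp (t * f i) \<le> 1 + t * f i + (t * f i)\<^sup>2"
      using t w_le_half by (intro exp_le_quadratic) auto
    then show "(exp (t * f i / 2))\<^sup>2 \<le> 1 + (t * f i + t\<^sup>2 * (f i)\<^sup>2)"
      by (simp add: exp_double[symmetric] power_mult_distrib)
  qed
  also have "\<dots> = 1 + (t * mean f + t\<^sup>2 * mean (\<lambda>i. (f i)\<^sup>2))"
    by (simp only: mean_add mean_scale mean_const)
  also have "\<dots> \<le> 1 + t\<^sup>2 * \<sigma>\<^sup>2"
    using f0 mult_left_mono[OF fv, of "t\<^sup>2"] by simp
  also have "\<dots> \<le> \<rho>"
  proof -
    have "(t * \<sigma>)\<^sup>2 * w \<le> (t * \<sigma>)\<^sup>2 * 7" using w_le_half by (intro mult_left_mono) auto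
    then show ?thesis using w0 by (simp add: \<rho> power_mult_distrib field_simps)
  qed
  also have "\<dots> \<le> \<rho>\<^sup>2" using rho_ge_1 by (simp add: power2_eq_square)
  finally show ?thesis .
qed

text \<open>
  Here \<open>q\<close> counts the steps since the last weighted transition. Half of each weight \<open>exp (t f)\<close> is
  kept outside \<open>\<kappa>\<close>, so that a full period applies the symmetrised operator of \<open>tilted_step\<close> to \<open>\<kappa>\<close>.
\<close>

lemma skipped_mgf_invariant:
  assumes r: "r < k"
  defines "c \<equiv> \<lambda>n. card {j\<in>{1..n}. j mod k = r}"
    and "G \<equiv> \<lambda>n x. path_exp d M n x (\<lambda>zs. exp (t * skipped_sum k r f zs))"
  shows "(\<forall>x<d. G n x = 1) \<or> (\<exists>\<kappa> q. q < k \<and> n mod k = (r + q) mod k \<and>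
    (\<forall>x<d. G n x = mv d (P q) (\<lambda>j. exp (t * f j / 2) * \<kappa> j) x) \<and> mean (\<lambda>i. (\<kappa> i)\<^sup>2) \<le> (\<rho> ^ c n)\<^sup>2)"
proof (induction n)
  case 0
  then show ?case by (simp add: G_def path_exp_0)
next
  case (Suc n)
  have G_Suc: "G (Suc n) x = (if Suc n mod k = r then exp (t * f x) else 1) * (\<Sum>y<d. M $$ (x, y) * G n y)" for x
  proof -
    have "path_exp d M n y (\<lambda>zs. exp (t * skipped_sum k r f (x # zs))) =
        (if Suc n mod k = r then exp (t * f x) else 1) * G n y" for y
    proof -
      have "path_exp d M n y (\<lambda>zs. exp (t * skipped_sum k r f (x # zs))) =
          path_exp d M n y (\<lambda>zs. (if Suc n mod k = r then exp (t * f x) else 1) * exp (t * skipped_sum k r f zs))"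
        by (rule path_exp_cong) (auto simp: trajectories_def distrib_left exp_add)
      then show ?thesis by (simp only: path_exp_scale G_def)
    qed
    then show ?thesis unfolding G_def path_exp_Suc by (simp add: sum_distrib_left mult.left_commute)
  qed
  have c_Suc: "c (Suc n) = c n + (if Suc n mod k = r then 1 else 0)"
  proof -
    have "{j\<in>{1..Suc n}. j mod k = r} =
        (if Suc n mod k = r then insert (Suc n) {j\<in>{1..n}. j mod k = r} else {j\<in>{1..n}. j mod k = r})"
      by (auto simp: le_Suc_eq)
    then show ?thesis by (simp add: c_def)
  qed
  have D2: "exp (t * f x) = exp (t * f x / 2) * exp (t * f x / 2)" for x
    by (simp add: exp_add[symmetric])
  show ?case
  proof (cases "\<forall>x<d. G n x = 1")
    case True
    then have one: "(\<Sum>y<d. M $$ (x, y) * G n y) = 1" if "x < d" for x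
      using M_row[OF that] by simp
    show ?thesis
    proof (cases "Suc n mod k = r")
      case False
      then show ?thesis using one G_Suc by simp
    next
      case hit: True
      \<comment> \<open>The first hit of the residue class: its weight is split evenly, one half
        becoming \<open>\<kappa>\<close> and the other staying outside.\<close>
      let ?\<kappa> = "\<lambda>i. exp (t * f i / 2)"
      have "mean (\<lambda>i. (?\<kappa> i)\<^sup>2) \<le> (\<rho> ^ c (Suc n))\<^sup>2"
      proof -
        have "\<rho> ^ 1 \<le> \<rho> ^ c (Suc n)" using rho_ge_1 c_Suc hit by (intro power_increasing) auto
        then have "\<rho>\<^sup>2 \<le> (\<rho> ^ c (Suc n))\<^sup>2" using rho_ge_1 by (intro power_mono) auto
        then show ?thesis using tilted_start by linarith
      qed
      moreover have "G (Suc n) x = mv d (P 0) (\<lambda>j. exp (t * f j / 2) * ?\<kappa> j) x" if "x < d" for x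
        using G_Suc[of x] one[OF that] hit D2[of x] mv_mat_pow[OF M_carrier that, of 0] by simp
      moreover have "Suc n mod k = (r + 0) mod k" using hit r by simp
      ultimately show ?thesis using k by (intro disjI2 exI[of _ ?\<kappa>] exI[of _ 0]) auto
    qed
  next
    case False
    then obtain \<kappa> q where q: "q < k" "n mod k = (r + q) mod k"
      and G: "\<forall>x<d. G n x = mv d (P q) (\<lambda>j. exp (t * f j / 2) * \<kappa> j) x"
      and \<kappa>: "mean (\<lambda>i. (\<kappa> i)\<^sup>2) \<le> (\<rho> ^ c n)\<^sup>2"
      using Suc.IH False by blast
    let ?v = "\<lambda>j. exp (t * f j / 2) * \<kappa> j"
    have MG: "(\<Sum>y<d. M $$ (x, y) * G n y) = mv d (P (Suc q)) ?v x" if "x < d" for x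
      using M_P_Suc[OF that, of q ?v] G by simp
    have Sn: "Suc n mod k = (r + Suc q) mod k" using mod_Suc_eq[of n k] mod_Suc_eq[of "r + q" k] q(2) by simp
    show ?thesis
    proof (cases "Suc q = k")
      case True
      then have hit: "Suc n mod k = r" using Sn r by simp
      \<comment> \<open>After a full period, the old \<open>\<kappa>\<close> with its outer
        half-weight, then \<open>P k\<close>, then half of the new weight combine into the next
        \<open>\<kappa>\<close>.\<close>
      let ?\<kappa> = "\<lambda>i. exp (t * f i / 2) * mv d (P k) ?v i"
      have "mean (\<lambda>i. (?\<kappa> i)\<^sup>2) \<le> (\<rho> ^ c (Suc n))\<^sup>2"
        using tilted_step[OF \<kappa>] c_Suc hit by simp
      moreover have "G (Suc n) x = mv d (P 0) (\<lambda>j. exp (t * f j / 2) * ?\<kappa> j) x" if "x < d" for x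
        using G_Suc[of x] MG[OF that] hit D2[of x] mv_mat_pow[OF M_carrier that, of 0] True by simp
      moreover have "Suc n mod k = (r + 0) mod k" using hit r by simp
      ultimately show ?thesis using k by (intro disjI2 exI[of _ ?\<kappa>] exI[of _ 0]) auto
    next
      case miss: False
      then have q': "Suc q < k" using q(1) by simp
      \<comment> \<open>Hits are exactly \<open>k\<close> steps apart: \<open>r + Suc q\<close> is
        congruent to \<open>r\<close> only if \<open>k\<close> divides \<open>Suc q\<close>.\<close>
      have "Suc n mod k \<noteq> r"
      proof
        assume "Suc n mod k = r"
        then have eq: "(r + Suc q) mod k = r" using Sn by simp
        show False
        proof (cases "r + Suc q < k")
          case True
          then show False using eq by simp
        next
          case False
          then have "(r + Suc q) mod k = r + Suc q - k" using r q' by (simp add: le_mod_geq)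
          then show False using eq False q' by simp
        qed
      qed
      then have "\<forall>x<d. G (Suc n) x = mv d (P (Suc q)) ?v x" "c (Suc n) = c n"
        using G_Suc MG c_Suc by auto
      then show ?thesis using q' Sn \<kappa> by (intro disjI2 exI[of _ \<kappa>] exI[of _ "Suc q"]) auto
    qed
  qed
qed

text \<open>An \<open>L2(\<pi>)\<close> bound becomes pointwise through the smallest stationary
  mass, at cost \<open>1 / sqrt p0\<close>; the factor 2 covers the outer half-weight, as
  \<open>exp (1 / 2) <= 2\<close>. This permits an arbitrary initial state.\<close>

lemma skipped_mgf_le:
  assumes r: "r < k" and x: "x < d" and p0: "0 < p0" "\<And>i. i < d \<Longrightarrow> p0 \<le> \<pi> $ i"
  shows "path_exp d M n x (\<lambda>zs. exp (t * skipped_sum k r f zs)) \<le>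
    2 / sqrt p0 * \<rho> ^ card {j\<in>{1..n}. j mod k = r}"
proof -
  let ?c = "card {j\<in>{1..n}. j mod k = r}"
  have "\<pi> $ x \<le> (\<Sum>i<d. \<pi> $ i)"
    by (rule member_le_sum) (use x pi_nonneg in auto)
  then have "p0 \<le> 1" using p0(2)[OF x] pi_sum by linarith
  then have p1: "1 \<le> 1 / sqrt p0" using p0(1) by simp
  have \<rho>c: "1 \<le> \<rho> ^ ?c" using rho_ge_1 by simp
  show ?thesis
    using skipped_mgf_invariant[OF r, of n]
  proof (elim disjE exE conjE)
    assume "\<forall>x<d. path_exp d M n x (\<lambda>zs. exp (t * skipped_sum k r f zs)) = 1"
    then have "path_exp d M n x (\<lambda>zs. exp (t * skipped_sum k r f zs)) = 1" using x by simp
    also have "\<dots> \<le> (2 / sqrt p0) * \<rho> ^ ?c"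
    proof -
      have "1 \<le> 2 / sqrt p0" using p1 by simp
      from mult_mono[OF this \<rho>c] show ?thesis using p0(1) by simp
    qed
    finally show ?thesis .
  next
    fix \<kappa> q
    assume G: "\<forall>x<d. path_exp d M n x (\<lambda>zs. exp (t * skipped_sum k r f zs)) =
        mv d (P q) (\<lambda>j. exp (t * f j / 2) * \<kappa> j) x"
      and \<kappa>: "mean (\<lambda>i. (\<kappa> i)\<^sup>2) \<le> (\<rho> ^ ?c)\<^sup>2"
    have bound: "exp (t * f j / 2) * \<kappa> j \<le> 2 / sqrt p0 * \<rho> ^ ?c" if j: "j < d" for j
    proof -
      have "p0 * (\<kappa> j)\<^sup>2 \<le> \<pi> $ j * (\<kappa> j)\<^sup>2" using p0(2)[OF j] by (intro mult_right_mono) auto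
      also have "\<dots> \<le> mean (\<lambda>i. (\<kappa> i)\<^sup>2)"
      proof (rule member_le_sum[of j "{..<d}" "\<lambda>i. \<pi> $ i * (\<kappa> i)\<^sup>2"])
        fix i assume "i \<in> {..<d} - {j}"
        then show "0 \<le> \<pi> $ i * (\<kappa> i)\<^sup>2" by (intro mult_nonneg_nonneg pi_nonneg) auto
      qed (use j in auto)
      finally have "p0 * (\<kappa> j)\<^sup>2 \<le> (\<rho> ^ ?c)\<^sup>2" using \<kappa> by linarith
      then have "(sqrt p0 * \<bar>\<kappa> j\<bar>)\<^sup>2 \<le> (\<rho> ^ ?c)\<^sup>2" using p0(1) by (simp add: power_mult_distrib)
      then have "sqrt p0 * \<bar>\<kappa> j\<bar> \<le> \<rho> ^ ?c"
        by (rule power2_le_imp_le) (use \<rho>c in linarith)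
      then have \<kappa>j: "\<bar>\<kappa> j\<bar> \<le> \<rho> ^ ?c / sqrt p0"
        using p0(1) by (simp only: pos_le_divide_eq real_sqrt_gt_0_iff mult.commute)
      have "t * f j / 2 \<le> \<bar>t\<bar> * \<bar>f j\<bar> / 2"
        using abs_ge_self[of "t * f j"] by (simp add: abs_mult)
      also have "\<dots> \<le> \<bar>t\<bar> * 1 / 2" using f[OF j] by (intro divide_right_mono mult_left_mono) auto
      also have "\<dots> \<le> 1 / 2" using t w_le_half by simp
      finally have "exp (t * f j / 2) \<le> exp (1 / 2)" by (simp only: exp_le_cancel_iff)
      also have "exp (1 / 2) \<le> (2 :: real)" using exp_bound_half[of "1/2 :: real"] by simp
      finally have "exp (t * f j / 2) * \<bar>\<kappa> j\<bar> \<le> 2 * \<bar>\<kappa> j\<bar>"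
        by (rule mult_right_mono) simp
      moreover have "exp (t * f j / 2) * \<kappa> j \<le> exp (t * f j / 2) * \<bar>\<kappa> j\<bar>"
        by (intro mult_left_mono) auto
      ultimately have "exp (t * f j / 2) * \<kappa> j \<le> 2 * \<bar>\<kappa> j\<bar>" by linarith
      also have "\<dots> \<le> 2 * (\<rho> ^ ?c / sqrt p0)" using \<kappa>j by simp
      finally show ?thesis by simp
    qed
    have "path_exp d M n x (\<lambda>zs. exp (t * skipped_sum k r f zs)) =
        (\<Sum>j<d. P q x j * (exp (t * f j / 2) * \<kappa> j))"
      using G[rule_format, OF x] by (simp only: mv_def)
    also have "\<dots> \<le> (\<Sum>j<d. P q x j * (2 / sqrt p0 * \<rho> ^ ?c))"
      using bound P_nonneg[OF x] by (intro sum_mono mult_left_mono) auto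
    also have "\<dots> = (\<Sum>j<d. P q x j) * (2 / sqrt p0 * \<rho> ^ ?c)"
      by (rule sum_distrib_right[symmetric])
    also have "\<dots> = 2 / sqrt p0 * \<rho> ^ ?c"
      by (simp only: P_row[OF x] mult_1_left)
    finally show ?thesis .
  qed
qed

end

end

section \<open>Linearity of transition sums, and visit counts\<close>

lemma transition_sum_affine:
  "transition_sum (\<lambda>x y. a * f x y + b) zs = a * transition_sum f zs + b * real (length zs - 1)"
proof (induction zs)
  case (Cons x zs)
  then show ?case by (cases zs) (auto simp: algebra_simps)
qed simp

lemma transition_sum_add:
  "transition_sum (\<lambda>x y. f x y + g x y) zs = transition_sum f zs + transition_sum g zs"
proof (induction zs)
  case (Cons x zs)
  then show ?case by (cases zs) auto
qed simp

lemma transition_sum_scale: "transition_sum (\<lambda>x y. a * f x y) zs = a * transition_sum f zs"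
  using transition_sum_affine[of a f 0 zs] by simp

lemma transition_sum_diff:
  "transition_sum (\<lambda>x y. f x y - g x y) zs = transition_sum f zs - transition_sum g zs"
  using transition_sum_add[of f "\<lambda>x y. -1 * g x y" zs] transition_sum_scale[of "-1" g zs] by simp

lemma transition_sum_sum:
  assumes "finite S"
  shows "transition_sum (\<lambda>x y. \<Sum>i\<in>S. f i x y) zs = (\<Sum>i\<in>S. transition_sum (f i) zs)"
  using assms
proof (induction S)
  case empty
  then show ?case using transition_sum_scale[of 0 "\<lambda>_ _. 0" zs] by simp
next
  case (insert i S)
  then show ?case by (simp add: transition_sum_add)
qed

lemma transition_sum_cong:
  assumes "set zs \<subseteq> {..<d}" "\<And>x y. x < d \<Longrightarrow> y < d \<Longrightarrow> f x y = g x y"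
  shows "transition_sum f zs = transition_sum g zs"
  using assms(1)
proof (induction zs)
  case (Cons x zs)
  then show ?case using assms(2) by (cases zs) auto
qed simp

text \<open>Departures are counted, so the final state of the path is left out; the row sums of the
  transition counts are then exactly the visits.\<close>

definition visits :: "nat \<Rightarrow> nat list \<Rightarrow> real" where
  "visits i = transition_sum (\<lambda>x y. of_bool (x = i))"

lemma visits_nonneg: "visits i zs \<ge> 0"
  unfolding visits_def
proof (induction zs)
  case (Cons x zs)
  then show ?case by (cases zs) auto
qed simp

context ergodic_chain
begin

text \<open>For a \<open>k\<close> that half attains the pseudo-spectral gap, convexity splits the
  functional into residue classes. Each is an additive functional of the \<open>k\<close>-step
  chain, whose gap \<open>skipped_mgf_le\<close> exploits.\<close>

lemma additive_mgf_le:
  assumes f: "\<And>i. i < d \<Longrightarrow> \<bar>f i\<bar> \<le> 1" and f0: "mean f = 0" and fv: "mean (\<lambda>i. (f i)\<^sup>2) \<le> \<sigma>\<^sup>2"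
    and \<sigma>: "0 \<le> \<sigma>" "\<sigma> \<le> 1" and t: "0 \<le> t" "24 * t \<le> pseudo_spectral_gap \<pi> M"
    and T: "real T * pseudo_spectral_gap \<pi> M \<ge> 2"
    and x: "x < d" and p0: "0 < p0" "\<And>i. i < d \<Longrightarrow> p0 \<le> \<pi> $ i"
  shows "path_exp d M T x (\<lambda>zs. exp (t * transition_sum (\<lambda>x y. f x) zs)) \<le>
    2 / sqrt p0 * exp (56 * t\<^sup>2 * \<sigma>\<^sup>2 * real T / pseudo_spectral_gap \<pi> M)"
proof -
  let ?g = "pseudo_spectral_gap \<pi> M"
  have g0: "?g > 0" by (rule pseudo_gap_pos)
  obtain k where k: "k \<ge> 1" "power_gap \<pi> M k \<ge> real k * ?g / 2"
    by (rule pseudo_gap_half_attained)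
  define gk where "gk = power_gap \<pi> M k"
  have gk: "real k * ?g \<le> 2 * gk" "gk \<le> 1" using k(2) power_gap_bounds(2)[of k] by (auto simp: gk_def)
  have "0 < real k * ?g" using k(1) g0 by simp
  then have gk0: "0 < gk" using gk(1) by linarith
  \<comment> \<open>As \<open>gk <= 1\<close>, hypothesis \<open>T\<close> forces
    \<open>k <= T\<close>, so \<open>card_residue_class_le\<close> applies.\<close>
  have "real k * ?g \<le> real T * ?g" using gk T by linarith
  then have kT: "k \<le> T" using g0 by simp
  let ?t = "real k * t" and ?w = "gk / 2"
  define \<rho> where "\<rho> = 1 + 7 * (?t * \<sigma>)\<^sup>2 / ?w"
  have t': "0 \<le> ?t" "6 * ?t \<le> ?w"
  proof -
    have "real k * (24 * t) \<le> real k * ?g" using t by (intro mult_left_mono) auto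
    then show "6 * ?t \<le> ?w" using gk by linarith
  qed (use t in simp)
  have w0: "0 < ?w" using gk0 by simp
  have each: "path_exp d M T x (\<lambda>zs. exp (?t * skipped_sum k r f zs)) \<le>
      2 / sqrt p0 * exp (56 * t\<^sup>2 * \<sigma>\<^sup>2 * real T / ?g)" if r: "r < k" for r
  proof -
    let ?c = "card {j\<in>{1..T}. j mod k = r}"
    have \<rho>c: "\<rho> ^ ?c \<le> exp (56 * t\<^sup>2 * \<sigma>\<^sup>2 * real T / ?g)"
    proof -
      have "\<rho> ^ ?c \<le> exp (7 * (?t * \<sigma>)\<^sup>2 / ?w) ^ ?c"
        unfolding \<rho>_def using w0 by (intro power_mono exp_ge_add_one_self) auto
      also have "\<dots> = exp (real ?c * (7 * (?t * \<sigma>)\<^sup>2 / ?w))" by (rule exp_of_nat_mult[symmetric])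
      \<comment> \<open>The constant 56 is 14 times two factors 2, one from the half-attained gap
        and one from the class size; 14 comes from dividing 7 by \<open>?w = gk / 2\<close>.\<close>
      also have "real ?c * (7 * (?t * \<sigma>)\<^sup>2 / ?w) = 14 * t\<^sup>2 * \<sigma>\<^sup>2 * (real k / gk) * (real k * real ?c)"
        using gk0 by (simp add: field_simps power2_eq_square)
      also have "exp \<dots> \<le> exp (14 * t\<^sup>2 * \<sigma>\<^sup>2 * (2 / ?g) * (2 * real T))"
      proof -
        have A: "real k / gk \<le> 2 / ?g" using gk(1) gk0 g0 by (simp add: field_simps)
        have B: "real k * real ?c \<le> 2 * real T" by (rule card_residue_class_le[OF k(1) kT])
        have C: "14 * t\<^sup>2 * \<sigma>\<^sup>2 * (real k / gk) \<le> 14 * t\<^sup>2 * \<sigma>\<^sup>2 * (2 / ?g)"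
          by (rule mult_left_mono[OF A]) simp
        have "14 * t\<^sup>2 * \<sigma>\<^sup>2 * (real k / gk) * (real k * real ?c) \<le> 14 * t\<^sup>2 * \<sigma>\<^sup>2 * (2 / ?g) * (2 * real T)"
          by (rule mult_mono[OF C B]) (use g0 in auto)
        then show ?thesis by (simp only: exp_le_cancel_iff)
      qed
      also have "14 * t\<^sup>2 * \<sigma>\<^sup>2 * (2 / ?g) * (2 * real T) = 56 * t\<^sup>2 * \<sigma>\<^sup>2 * real T / ?g"
        by simp
      finally show ?thesis .
    qed
    have "path_exp d M T x (\<lambda>zs. exp (?t * skipped_sum k r f zs)) \<le> 2 / sqrt p0 * \<rho> ^ ?c"
      by (rule skipped_mgf_le[OF k(1) _ w0 f f0 fv \<sigma> t' \<rho>_def r x p0]) (simp_all add: gk_def)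
    also have "\<dots> \<le> 2 / sqrt p0 * exp (56 * t\<^sup>2 * \<sigma>\<^sup>2 * real T / ?g)"
      using p0(1) by (intro mult_left_mono \<rho>c) auto
    finally show ?thesis .
  qed
  have "path_exp d M T x (\<lambda>zs. exp (t * transition_sum (\<lambda>x y. f x) zs)) \<le>
      path_exp d M T x (\<lambda>zs. (1 / real k) * (\<Sum>r<k. exp (?t * skipped_sum k r f zs)))"
  proof (rule path_exp_mono[OF x])
    fix zs
    have "exp (\<Sum>r<k. t * skipped_sum k r f (x # zs)) \<le>
        (1 / real k) * (\<Sum>r<k. exp (real k * (t * skipped_sum k r f (x # zs))))"
      by (rule exp_average_le[OF k(1)])
    then show "exp (t * transition_sum (\<lambda>x y. f x) (x # zs)) \<le>
        (1 / real k) * (\<Sum>r<k. exp (?t * skipped_sum k r f (x # zs)))"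
      by (simp only: sum_distrib_left[symmetric] sum_skipped_sum[OF k(1)] mult.assoc)
  qed
  also have "\<dots> = (1 / real k) * (\<Sum>r<k. path_exp d M T x (\<lambda>zs. exp (?t * skipped_sum k r f zs)))"
    by (simp only: path_exp_scale path_exp_sum)
  also have "\<dots> \<le> (1 / real k) * (\<Sum>r<k. 2 / sqrt p0 * exp (56 * t\<^sup>2 * \<sigma>\<^sup>2 * real T / ?g))"
    by (intro mult_left_mono sum_mono each) auto
  also have "\<dots> = 2 / sqrt p0 * exp (56 * t\<^sup>2 * \<sigma>\<^sup>2 * real T / ?g)"
    using k(1) by simp
  finally show ?thesis .
qed

lemma visits_one_sided_tail:
  assumes s: "s = 1 \<or> s = -1" and i: "i < d" and \<eta>: "0 < \<eta>" "\<eta> \<le> 1"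
    and T: "real T * pseudo_spectral_gap \<pi> M \<ge> 2"
    and x: "x < d" and p0: "0 < p0" "\<And>i. i < d \<Longrightarrow> p0 \<le> \<pi> $ i"
  shows "path_exp d M T x (\<lambda>zs. of_bool (\<eta> * real T * \<pi> $ i \<le> s * (visits i zs - real T * \<pi> $ i))) \<le>
    2 / sqrt p0 * exp (- (\<eta>\<^sup>2 * pseudo_spectral_gap \<pi> M * p0 * real T / 224))"
proof -
  let ?g = "pseudo_spectral_gap \<pi> M" and ?p = "\<pi> $ i"
  have g: "0 < ?g" "?g \<le> 1" by (rule pseudo_gap_pos, rule pseudo_gap_le_1)
  define f where "f j = s * (of_bool (j = i) - ?p)" for j :: nat
  \<comment> \<open>Minimiser of \<open>- t \<eta> T p + 56 t^2 p T / ?g\<close>, with minimum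
    \<open>- \<eta>^2 ?g p T / 224\<close>.\<close>
  define t where "t = \<eta> * ?g / 112"
  have "?p \<le> (\<Sum>j<d. \<pi> $ j)"
    by (rule member_le_sum) (use i pi_nonneg in auto)
  then have p: "0 \<le> ?p" "?p \<le> 1" using pi_nonneg[OF i] pi_sum by auto
  have s2: "s * s = 1" "\<bar>s\<bar> = 1" using s by auto
  have mi: "mean (\<lambda>j. of_bool (j = i)) = ?p"
    using i by (simp add: of_bool_def if_distrib[of "\<lambda>x. _ * x"] sum.delta cong: if_cong)
  have "mean f = s * (mean (\<lambda>j. of_bool (j = i)) + mean (\<lambda>j. - ?p))"
    unfolding f_def mean_scale diff_conv_add_uminus mean_add ..
  then have f0: "mean f = 0" unfolding mi mean_const by simp
  \<comment> \<open>The Bernoulli variance is at most \<open>?p\<close>, so that relative accuracy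
    costs only one factor \<open>1 / ?p\<close> in the sample size.\<close>
  have "mean (\<lambda>j. (f j)\<^sup>2) = mean (\<lambda>j. (1 - 2 * ?p) * of_bool (j = i) + ?p * ?p)"
  proof (intro sum.cong refl arg_cong2[where f = "(*)"])
    fix j
    have "(f j)\<^sup>2 = (s * s) * (of_bool (j = i) - ?p)\<^sup>2" by (simp add: f_def power2_eq_square)
    then show "(f j)\<^sup>2 = (1 - 2 * ?p) * of_bool (j = i) + ?p * ?p"
      by (simp add: s2 power2_eq_square algebra_simps)
  qed
  also have "\<dots> = (1 - 2 * ?p) * ?p + ?p * ?p" by (simp only: mean_add mean_scale mean_const mi)
  also have "\<dots> \<le> (sqrt ?p)\<^sup>2" using p by (simp add: algebra_simps)
  finally have fv: "mean (\<lambda>j. (f j)\<^sup>2) \<le> (sqrt ?p)\<^sup>2" .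
  have f1: "\<bar>f j\<bar> \<le> 1" for j unfolding f_def abs_mult using p s2 by auto
  have t: "0 \<le> t" "24 * t \<le> ?g"
  proof -
    have "\<eta> * ?g \<le> 1 * ?g" using \<eta> g by (intro mult_right_mono) auto
    then show "24 * t \<le> ?g" using g by (simp add: t_def)
  qed (use \<eta> g in \<open>simp add: t_def\<close>)
  have S: "transition_sum (\<lambda>x y. f x) (x # zs) = s * (visits i (x # zs) - real T * ?p)"
    if "zs \<in> trajectories d T" for zs x
  proof -
    have "transition_sum (\<lambda>x y. f x) (x # zs) = transition_sum (\<lambda>x y. s * of_bool (x = i) + - (s * ?p)) (x # zs)"
      by (simp add: f_def algebra_simps)
    also have "\<dots> = s * visits i (x # zs) + - (s * ?p) * real T"
      using that by (simp only: transition_sum_affine visits_def trajectories_def) simp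
    finally show ?thesis by (simp add: algebra_simps)
  qed
  let ?a = "\<eta> * real T * ?p"
  have "path_exp d M T x (\<lambda>zs. of_bool (?a \<le> s * (visits i zs - real T * ?p))) \<le>
      path_exp d M T x (\<lambda>zs. exp (- (t * ?a)) * exp (t * transition_sum (\<lambda>x y. f x) zs))"
  proof (rule path_exp_mono[OF x])
    fix zs assume zs: "zs \<in> trajectories d T"
    show "of_bool (?a \<le> s * (visits i (x # zs) - real T * ?p)) \<le>
        exp (- (t * ?a)) * exp (t * transition_sum (\<lambda>x y. f x) (x # zs))"
    proof (cases "?a \<le> s * (visits i (x # zs) - real T * ?p)")
      case True
      then have "t * ?a \<le> t * transition_sum (\<lambda>x y. f x) (x # zs)"
        unfolding S[OF zs] using t by (intro mult_left_mono) auto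
      then show ?thesis using True by (simp add: exp_add[symmetric])
    qed simp
  qed
  also have "\<dots> = exp (- (t * ?a)) * path_exp d M T x (\<lambda>zs. exp (t * transition_sum (\<lambda>x y. f x) zs))"
    by (rule path_exp_scale)
  also have "\<dots> \<le> exp (- (t * ?a)) * (2 / sqrt p0 * exp (56 * t\<^sup>2 * (sqrt ?p)\<^sup>2 * real T / ?g))"
    by (intro mult_left_mono additive_mgf_le f1 f0 fv t T x p0) (use p in auto)
  also have "\<dots> = 2 / sqrt p0 * exp (- (t * ?a) + 56 * t\<^sup>2 * (sqrt ?p)\<^sup>2 * real T / ?g)"
    by (simp only: exp_add mult.left_commute mult.assoc)
  also have "- (t * ?a) + 56 * t\<^sup>2 * (sqrt ?p)\<^sup>2 * real T / ?g = - (\<eta>\<^sup>2 * ?g * ?p * real T / 224)"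
    using g p by (simp add: t_def field_simps power2_eq_square)
  also have "2 / sqrt p0 * exp (- (\<eta>\<^sup>2 * ?g * ?p * real T / 224)) \<le> 2 / sqrt p0 * exp (- (\<eta>\<^sup>2 * ?g * p0 * real T / 224))"
    using p0(1) p0(2)[OF i] g by (intro mult_left_mono) (auto intro!: mult_right_mono mult_left_mono)
  finally show ?thesis .
qed

text \<open>Induction over the first transition: its compensated increment is absorbed into
  \<open>H\<close>, which is why \<open>H\<close> is general, and
  \<open>trace_exp_supermartingale_step\<close> removes it by averaging over the next state.\<close>

lemma path_freedman:
  fixes X :: "nat \<Rightarrow> nat \<Rightarrow> nat \<Rightarrow> nat \<Rightarrow> real" and V :: "nat \<Rightarrow> nat \<Rightarrow> nat \<Rightarrow> real"
  assumes symX: "\<And>x y. x < d \<Longrightarrow> y < d \<Longrightarrow> symmetric_on n (X x y)"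
    and symV: "\<And>x. x < d \<Longrightarrow> symmetric_on n (V x)"
    and small: "\<And>x y u. x < d \<Longrightarrow> y < d \<Longrightarrow> ip n (mv n (X x y) u) (mv n (X x y) u) \<le> ip n u u / 4"
    and centred: "\<And>x i j. x < d \<Longrightarrow> i < n \<Longrightarrow> j < n \<Longrightarrow> (\<Sum>y<d. M $$ (x, y) * X x y i j) = 0"
    and var: "\<And>x u. x < d \<Longrightarrow>
      (\<Sum>y<d. M $$ (x, y) * ip n (mv n (X x y) u) (mv n (X x y) u)) \<le> ip n u (mv n (V x) u)"
    and symH: "symmetric_on n H" and x: "x < d"
  shows "path_exp d M T x (\<lambda>zs. trace_exp n (\<lambda>i j. H i j + transition_sum (\<lambda>x y. X x y i j - 4 * V x i j) zs))
    \<le> trace_exp n H"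
  using symH x
proof (induction T arbitrary: H x)
  case 0
  then show ?case by (simp add: path_exp_0)
next
  case (Suc T)
  let ?H = "\<lambda>y i j. H i j - 4 * V x i j + X x y i j"
  have "path_exp d M (Suc T) x (\<lambda>zs. trace_exp n (\<lambda>i j. H i j + transition_sum (\<lambda>x y. X x y i j - 4 * V x i j) zs))
      = (\<Sum>y<d. M $$ (x, y) * path_exp d M T y (\<lambda>zs. trace_exp n
          (\<lambda>i j. H i j + transition_sum (\<lambda>x y. X x y i j - 4 * V x i j) (x # zs))))"
    by (rule path_exp_Suc)
  also have "\<dots> = (\<Sum>y<d. M $$ (x, y) * path_exp d M T y (\<lambda>zs. trace_exp n
          (\<lambda>i j. ?H y i j + transition_sum (\<lambda>x y. X x y i j - 4 * V x i j) zs)))"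
  proof (intro sum.cong refl arg_cong2[where f = "(*)"] path_exp_cong arg_cong[where f = "trace_exp n"] ext)
    fix y zs i j
    show "H i j + transition_sum (\<lambda>x y. X x y i j - 4 * V x i j) (x # y # zs) =
        ?H y i j + transition_sum (\<lambda>x y. X x y i j - 4 * V x i j) (y # zs)"
      by simp
  qed
  also have "\<dots> \<le> (\<Sum>y<d. M $$ (x, y) * trace_exp n (?H y))"
  proof (intro sum_mono mult_left_mono)
    fix y assume "y \<in> {..<d}"
    then have y: "y < d" by simp
    have "symmetric_on n (?H y)"
      by (intro symmetric_on_add symmetric_on_diff symmetric_on_scale Suc.prems symX symV y)
    then show "path_exp d M T y (\<lambda>zs. trace_exp n (\<lambda>i j. ?H y i j +
        transition_sum (\<lambda>x y. X x y i j - 4 * V x i j) zs)) \<le> trace_exp n (?H y)"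
      using Suc.IH y by blast
    show "0 \<le> M $$ (x, y)" by (rule M_nonneg[OF Suc.prems(2) y])
  qed
  also have "\<dots> \<le> trace_exp n H"
    by (rule trace_exp_supermartingale_step[where Y = "{..<d}" and p = "\<lambda>y. M $$ (x, y)" and X = "X x" and V = "V x"])
      (use Suc.prems M_nonneg M_row symV symX small centred var in auto)
  finally show ?case .
qed

end

section \<open>Concentration of the transition noise\<close>

lemma sum_lessThan_plus: "(\<Sum>i<m + n. f i) = (\<Sum>i<m. f i) + (\<Sum>j<n. f (m + j))"
  for f :: "nat \<Rightarrow> real"
  by (induction n) (simp_all add: add.assoc)

text \<open>The Hermitian dilation: \<open>A\<close> and its transpose as the off-diagonal blocks of
  a symmetric matrix of twice the size.\<close>

definition dilation :: "nat \<Rightarrow> (nat \<Rightarrow> nat \<Rightarrow> real) \<Rightarrow> nat \<Rightarrow> nat \<Rightarrow> real" where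
  "dilation d A a b =
     (if a < d \<and> d \<le> b then A a (b - d) else if d \<le> a \<and> b < d then A b (a - d) else 0)"

definition diagonal :: "(nat \<Rightarrow> real) \<Rightarrow> nat \<Rightarrow> nat \<Rightarrow> real" where
  "diagonal h a b = (if a = b then h a else 0)"

lemma ip_double: "ip (d + d) u v = ip d u v + ip d (\<lambda>j. u (d + j)) (\<lambda>j. v (d + j))"
  by (simp add: ip_def sum_lessThan_plus)

lemma mv_dilation_lower: "a < d \<Longrightarrow> mv (d + d) (dilation d A) u a = mv d A (\<lambda>j. u (d + j)) a"
  by (simp add: mv_def sum_lessThan_plus dilation_def)

lemma mv_dilation_upper: "mv (d + d) (dilation d A) u (d + j) = (\<Sum>i<d. A i j * u i)"
  by (simp add: mv_def sum_lessThan_plus dilation_def)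

lemma symmetric_on_dilation: "symmetric_on n (dilation d A)"
  by (simp add: symmetric_on_def dilation_def)

lemma symmetric_on_diagonal: "symmetric_on n (diagonal h)"
  by (simp add: symmetric_on_def diagonal_def)

lemma ip_diagonal: "ip n u (mv n (diagonal h) u) = (\<Sum>a<n. h a * (u a)\<^sup>2)"
proof -
  have "mv n (diagonal h) u a = h a * u a" if "a < n" for a
    using that by (simp add: mv_def diagonal_def if_distrib[of "\<lambda>x. x * _"] sum.delta cong: if_cong)
  then show ?thesis by (simp add: ip_def power2_eq_square mult_ac)
qed

lemma ip_dilation: "ip (d + d) u (mv (d + d) (dilation d A) u) = 2 * ip d u (mv d A (\<lambda>j. u (d + j)))"
proof -
  have "ip d (\<lambda>j. u (d + j)) (\<lambda>j. \<Sum>i<d. A i j * u i) = (\<Sum>j<d. \<Sum>i<d. u i * (A i j * u (d + j)))"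
    by (simp add: ip_def sum_distrib_left mult_ac)
  also have "\<dots> = (\<Sum>i<d. \<Sum>j<d. u i * (A i j * u (d + j)))" by (rule sum.swap)
  also have "\<dots> = ip d u (mv d A (\<lambda>j. u (d + j)))" by (simp add: ip_def mv_def sum_distrib_left)
  finally have 1: "ip d (\<lambda>j. u (d + j)) (\<lambda>j. mv (d + d) (dilation d A) u (d + j)) = ip d u (mv d A (\<lambda>j. u (d + j)))"
    by (simp only: mv_dilation_upper)
  have 2: "ip d u (mv (d + d) (dilation d A) u) = ip d u (mv d A (\<lambda>j. u (d + j)))"
    by (intro ip_cong refl mv_dilation_lower)
  show ?thesis unfolding ip_double[of d u] 1 2 by simp
qed

text \<open>A single transition changes only row \<open>x\<close> of the noise, so the dilated step
  has rank at most two and the length of its image is explicit.\<close>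

lemma nrm_dilation_rank_one:
  assumes "x < d"
  shows "ip (d + d) (mv (d + d) (dilation d (\<lambda>i j. of_bool (i = x) * b * r j)) u)
      (mv (d + d) (dilation d (\<lambda>i j. of_bool (i = x) * b * r j)) u) =
    b\<^sup>2 * ((ip d r (\<lambda>j. u (d + j)))\<^sup>2 + (u x)\<^sup>2 * ip d r r)"
proof -
  let ?A = "\<lambda>i j. of_bool (i = x) * b * r j :: real"
  let ?w = "mv (d + d) (dilation d ?A) u" and ?s = "ip d r (\<lambda>j. u (d + j))"
  have w: "?w i = of_bool (i = x) * (b * ?s)" if "i < d" for i
    by (simp only: mv_dilation_lower[OF that]) (simp add: mv_def ip_def sum_distrib_left mult_ac)
  have "ip d ?w ?w = ip d (\<lambda>i. of_bool (i = x) * (b * ?s)) (\<lambda>i. of_bool (i = x) * (b * ?s))"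
    by (rule ip_cong[OF w w])
  also have "\<dots> = (\<Sum>i<d. if i = x then (b * ?s)\<^sup>2 else 0)"
    unfolding ip_def[of d "\<lambda>i. of_bool (i = x) * (b * ?s)"] by (intro sum.cong) (auto simp: power2_eq_square)
  also have "\<dots> = (b * ?s)\<^sup>2" using assms by simp
  finally have 1: "ip d ?w ?w = (b * ?s)\<^sup>2" .
  have "(\<Sum>i<d. ?A i j * u i) = (b * u x) * r j" for j
  proof -
    have "(\<Sum>i<d. ?A i j * u i) = (\<Sum>i<d. if i = x then b * r j * u i else 0)"
      by (intro sum.cong) auto
    then show ?thesis using assms by simp
  qed
  then have 2: "ip d (\<lambda>j. ?w (d + j)) (\<lambda>j. ?w (d + j)) = (b * u x)\<^sup>2 * ip d r r"
    by (simp only: mv_dilation_upper ip_scale_left ip_scale_right power2_eq_square mult.assoc)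
  show ?thesis
    unfolding ip_double[of d ?w] 1 2 by (simp add: power_mult_distrib algebra_simps)
qed

context ergodic_chain
begin

definition residual :: "nat \<Rightarrow> nat \<Rightarrow> nat \<Rightarrow> real" where
  "residual x y j = (of_bool (j = y) - M $$ (x, j)) / sqrt (\<pi> $ j)"

definition noise_step :: "nat \<Rightarrow> nat \<Rightarrow> nat \<Rightarrow> nat \<Rightarrow> nat \<Rightarrow> real" where
  "noise_step T x y i j = of_bool (i = x) * (1 / (real T * sqrt (\<pi> $ x))) * residual x y j"

text \<open>
  In terms of transition counts this is \<open>(N(i, j) - N(i) M(i, j)) / (T sqrt (\<pi> i) sqrt (\<pi> j))\<close>.
\<close>

definition noise :: "nat list \<Rightarrow> nat \<Rightarrow> nat \<Rightarrow> real" where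
  "noise zs i j = transition_sum (\<lambda>x y. noise_step (length zs - 1) x y i j) zs"

text \<open>
  A diagonal bound for the conditional second moment of the dilated step: indices below \<open>d\<close> belong
  to the rows of the noise, the others to its columns.
\<close>

definition variance_proxy :: "nat \<Rightarrow> nat \<Rightarrow> nat \<Rightarrow> real" where
  "variance_proxy T x a =
     (if a < d then of_bool (x = a) * ((\<Sum>j<d. M $$ (a, j) / \<pi> $ j) / ((real T)\<^sup>2 * \<pi> $ a))
      else M $$ (x, a - d) / ((real T)\<^sup>2 * \<pi> $ x * \<pi> $ (a - d)))"

lemma M_le_1: "i < d \<Longrightarrow> j < d \<Longrightarrow> M $$ (i, j) \<le> 1"
  using P_le_1[of i j 1] M_carrier by simp

lemma residual_mean: "x < d \<Longrightarrow> j < d \<Longrightarrow> (\<Sum>y<d. M $$ (x, y) * residual x y j) = 0"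
proof -
  assume x: "x < d" and j: "j < d"
  have "(\<Sum>y<d. M $$ (x, y) * residual x y j) =
      (\<Sum>y<d. M $$ (x, y) * of_bool (j = y) - M $$ (x, y) * M $$ (x, j)) / sqrt (\<pi> $ j)"
    by (simp add: residual_def sum_divide_distrib right_diff_distrib)
  also have "(\<Sum>y<d. M $$ (x, y) * of_bool (j = y) - M $$ (x, y) * M $$ (x, j)) =
      (\<Sum>y<d. if j = y then M $$ (x, y) else 0) - (\<Sum>y<d. M $$ (x, y)) * M $$ (x, j)"
    by (simp add: sum_subtractf sum_distrib_right of_bool_def if_distrib[of "\<lambda>z. _ * z"] cong: if_cong)
  also have "\<dots> = 0" using j M_row[OF x] by simp
  finally show ?thesis by simp
qed

lemma residual_sq: "j < d \<Longrightarrow> (residual x y j)\<^sup>2 = (of_bool (j = y) - M $$ (x, j))\<^sup>2 / \<pi> $ j"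
  using pi_nonneg[of j] by (simp add: residual_def power_divide)

lemma residual_norm_le:
  assumes x: "x < d" and y: "y < d" and p0: "0 < p0" "\<And>i. i < d \<Longrightarrow> p0 \<le> \<pi> $ i"
  shows "ip d (residual x y) (residual x y) \<le> 2 / p0"
proof -
  have "ip d (residual x y) (residual x y) = (\<Sum>j<d. (residual x y j)\<^sup>2)"
    by (simp add: ip_def power2_eq_square)
  also have "\<dots> \<le> (\<Sum>j<d. ((if j = y then 1 else 0) + M $$ (x, j)) / p0)"
  proof (rule sum_mono)
    fix j assume "j \<in> {..<d}"
    then have j: "j < d" by simp
    have m: "0 \<le> M $$ (x, j)" "M $$ (x, j) \<le> 1" using M_nonneg[OF x j] M_le_1[OF x j] by auto
    then have "M $$ (x, j) * M $$ (x, j) \<le> M $$ (x, j)" by (simp add: mult_left_le)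
    then have "M $$ (x, j) * M $$ (x, j) \<le> 3 * M $$ (x, j)" "M $$ (x, j) * M $$ (x, j) \<le> M $$ (x, j)"
      using m by linarith+
    then have "(of_bool (j = y) - M $$ (x, j))\<^sup>2 \<le> (if j = y then 1 else 0) + M $$ (x, j)"
      by (cases "j = y") (simp_all add: power2_eq_square algebra_simps)
    then show "(residual x y j)\<^sup>2 \<le> ((if j = y then 1 else 0) + M $$ (x, j)) / p0"
      unfolding residual_sq[OF j] using m p0(1) p0(2)[OF j] by (intro frac_le) auto
  qed
  also have "\<dots> = ((\<Sum>j<d. if j = y then 1 else 0) + (\<Sum>j<d. M $$ (x, j))) / p0"
    by (simp only: sum_divide_distrib[symmetric] sum.distrib)
  also have "\<dots> = 2 / p0" using y M_row[OF x] by simp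
  finally show ?thesis .
qed

text \<open>The inner product is a centred function of the next state, so the left side is a
  conditional variance; dropping the squared mean leaves a diagonal form.\<close>

lemma residual_inner_variance:
  assumes x: "x < d"
  shows "(\<Sum>y<d. M $$ (x, y) * (ip d (residual x y) u)\<^sup>2) \<le> (\<Sum>j<d. M $$ (x, j) / \<pi> $ j * (u j)\<^sup>2)"
proof -
  let ?f = "\<lambda>j. u j / sqrt (\<pi> $ j)"
  have ip: "ip d (residual x y) u = ?f y - (\<Sum>j<d. M $$ (x, j) * ?f j)" if "y < d" for y
  proof -
    have "ip d (residual x y) u = (\<Sum>j<d. (if j = y then ?f j else 0) - M $$ (x, j) * ?f j)"
      unfolding ip_def by (intro sum.cong) (auto simp: residual_def diff_divide_distrib algebra_simps)
    then show ?thesis using that by (simp add: sum_subtractf)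
  qed
  have "(\<Sum>y<d. M $$ (x, y) * (ip d (residual x y) u)\<^sup>2) =
      (\<Sum>y<d. M $$ (x, y) * (?f y - (\<Sum>j<d. M $$ (x, j) * ?f j))\<^sup>2)"
    using ip by (intro sum.cong) auto
  also have "\<dots> = (\<Sum>j<d. M $$ (x, j) * (?f j)\<^sup>2) - (\<Sum>j<d. M $$ (x, j) * ?f j)\<^sup>2"
    by (rule weighted_variance_identity[OF M_row[OF x]])
  also have "\<dots> \<le> (\<Sum>j<d. M $$ (x, j) * (?f j)\<^sup>2)" by simp
  also have "\<dots> = (\<Sum>j<d. M $$ (x, j) / \<pi> $ j * (u j)\<^sup>2)"
    using pi_nonneg by (intro sum.cong) (auto simp: power_divide)
  finally show ?thesis .
qed

lemma residual_norm_variance: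
  assumes x: "x < d"
  shows "(\<Sum>y<d. M $$ (x, y) * ip d (residual x y) (residual x y)) \<le> (\<Sum>j<d. M $$ (x, j) / \<pi> $ j)"
proof -
  have "(\<Sum>y<d. M $$ (x, y) * ip d (residual x y) (residual x y)) =
      (\<Sum>y<d. \<Sum>j<d. M $$ (x, y) * (residual x y j)\<^sup>2)"
    by (simp add: ip_def power2_eq_square sum_distrib_left)
  also have "\<dots> = (\<Sum>j<d. \<Sum>y<d. M $$ (x, y) * (residual x y j)\<^sup>2)" by (rule sum.swap)
  also have "\<dots> \<le> (\<Sum>j<d. M $$ (x, j) / \<pi> $ j)"
  proof (rule sum_mono)
    fix j assume "j \<in> {..<d}"
    then have j: "j < d" by simp
    let ?f = "\<lambda>y. of_bool (j = y) :: real"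
    have m: "(\<Sum>y<d. M $$ (x, y) * ?f y) = M $$ (x, j)" "(\<Sum>y<d. M $$ (x, y) * (?f y)\<^sup>2) = M $$ (x, j)"
      using j by (simp_all add: of_bool_def if_distrib[of "\<lambda>z. _ * z"] if_distrib[of "\<lambda>z. z ^ 2"] cong: if_cong)
    have "(\<Sum>y<d. M $$ (x, y) * (residual x y j)\<^sup>2) = (\<Sum>y<d. M $$ (x, y) * (?f y - M $$ (x, j))\<^sup>2) / \<pi> $ j"
      by (simp add: residual_sq[OF j] sum_divide_distrib)
    also have "(\<Sum>y<d. M $$ (x, y) * (?f y - M $$ (x, j))\<^sup>2) = M $$ (x, j) - (M $$ (x, j))\<^sup>2"
      using weighted_variance_identity[OF M_row[OF x], of ?f] unfolding m .
    also have "(M $$ (x, j) - (M $$ (x, j))\<^sup>2) / \<pi> $ j \<le> M $$ (x, j) / \<pi> $ j"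
      using pi_nonneg[OF j] by (intro divide_right_mono) auto
    finally show "(\<Sum>y<d. M $$ (x, y) * (residual x y j)\<^sup>2) \<le> M $$ (x, j) / \<pi> $ j" .
  qed
  finally show ?thesis .
qed

lemma ip_noise_step:
  assumes "x < d"
  shows "ip (d + d) (mv (d + d) (\<lambda>a b. \<tau> * dilation d (noise_step T x y) a b) u)
      (mv (d + d) (\<lambda>a b. \<tau> * dilation d (noise_step T x y) a b) u) =
    \<tau>\<^sup>2 / ((real T)\<^sup>2 * \<pi> $ x) *
      ((ip d (residual x y) (\<lambda>j. u (d + j)))\<^sup>2 + (u x)\<^sup>2 * ip d (residual x y) (residual x y))"
proof -
  have ns: "noise_step T x y = (\<lambda>i j. of_bool (i = x) * (1 / (real T * sqrt (\<pi> $ x))) * residual x y j)"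
    by (simp add: noise_step_def fun_eq_iff)
  have b: "(1 / (real T * sqrt (\<pi> $ x)))\<^sup>2 = 1 / ((real T)\<^sup>2 * \<pi> $ x)"
    using pi_nonneg[OF assms] by (simp add: power_divide power_mult_distrib)
  show ?thesis
    unfolding mv_mat_scale ip_scale_left ip_scale_right ns nrm_dilation_rank_one[OF assms] b
    by (simp add: power2_eq_square)
qed

text \<open>Each scaled step has squared norm at most \<open>2 \<tau>^2 / (T p0)^2\<close>, which
  \<open>3 \<tau> <= T p0\<close> keeps below 1/4. The bound \<open>2 d\<close> is the trace of the
  exponential of zero in the dimension of the dilation.\<close>

lemma noise_freedman:
  assumes T: "T \<ge> 1" and p0: "0 < p0" "\<And>i. i < d \<Longrightarrow> p0 \<le> \<pi> $ i"
    and \<tau>: "0 \<le> \<tau>" "3 * \<tau> \<le> real T * p0" and x: "x < d"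
  shows "path_exp d M T x (\<lambda>zs. trace_exp (d + d) (\<lambda>a b. transition_sum (\<lambda>x y.
      \<tau> * dilation d (noise_step T x y) a b - 4 * (\<tau>\<^sup>2 * diagonal (variance_proxy T x) a b)) zs)) \<le> 2 * real d"
proof -
  let ?X = "\<lambda>x y a b. \<tau> * dilation d (noise_step T x y) a b"
  let ?V = "\<lambda>x a b. \<tau>\<^sup>2 * diagonal (variance_proxy T x) a b"
  have "path_exp d M T x (\<lambda>zs. trace_exp (d + d) (\<lambda>a b. 0 + transition_sum (\<lambda>x y.
      ?X x y a b - 4 * ?V x a b) zs)) \<le> trace_exp (d + d) (\<lambda>a b. 0)"
  proof (rule path_freedman[where X = ?X and V = ?V and H = "\<lambda>a b. 0"])
    show "symmetric_on (d + d) (?X x y)" for x y by (intro symmetric_on_scale symmetric_on_dilation)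
    show "symmetric_on (d + d) (?V x)" for x by (intro symmetric_on_scale symmetric_on_diagonal)
    show "symmetric_on (d + d) (\<lambda>a b. 0)" by (simp add: symmetric_on_def)
    fix x assume x: "x < d"
    have px: "p0 \<le> \<pi> $ x" "0 < \<pi> $ x" using p0(2)[OF x] p0(1) by auto
    show "ip (d + d) (mv (d + d) (?X x y) u) (mv (d + d) (?X x y) u) \<le> ip (d + d) u u / 4" if y: "y < d" for y u
    proof -
      let ?u = "\<lambda>j. u (d + j)" and ?r = "ip d (residual x y) (residual x y)"
      have "(u x)\<^sup>2 \<le> (\<Sum>i<d. (u i)\<^sup>2)" by (rule member_le_sum[of x "{..<d}" "\<lambda>i. (u i)\<^sup>2"]) (use x in auto)
      then have ux: "(u x)\<^sup>2 \<le> ip d u u" by (simp add: ip_def power2_eq_square)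
      have r: "?r \<le> 2 / p0" by (rule residual_norm_le[OF x y p0])
      have "(ip d (residual x y) ?u)\<^sup>2 + (u x)\<^sup>2 * ?r \<le> ?r * ip d ?u ?u + ip d u u * ?r"
        by (intro add_mono ip_Cauchy_Schwarz mult_right_mono ux ip_nonneg)
      also have "\<dots> = ?r * ip (d + d) u u" by (simp add: ip_double[of d u] algebra_simps)
      also have "\<dots> \<le> 2 / p0 * ip (d + d) u u" by (intro mult_right_mono r ip_nonneg)
      finally have 1: "(ip d (residual x y) ?u)\<^sup>2 + (u x)\<^sup>2 * ?r \<le> 2 / p0 * ip (d + d) u u" .
      have "\<tau>\<^sup>2 / ((real T)\<^sup>2 * \<pi> $ x) * ((ip d (residual x y) ?u)\<^sup>2 + (u x)\<^sup>2 * ?r) \<le>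
          \<tau>\<^sup>2 / ((real T)\<^sup>2 * p0) * (2 / p0 * ip (d + d) u u)"
        using T p0(1) px by (intro mult_mono 1 frac_le mult_left_mono add_nonneg_nonneg mult_nonneg_nonneg) (auto simp: ip_nonneg)
      also have "\<dots> = (2 * \<tau>\<^sup>2 / (real T * p0)\<^sup>2) * ip (d + d) u u"
        by (simp add: power2_eq_square mult_ac)
      also have "\<dots> \<le> 1 / 4 * ip (d + d) u u"
      proof (intro mult_right_mono ip_nonneg)
        have "(3 * \<tau>)\<^sup>2 \<le> (real T * p0)\<^sup>2" using \<tau> by (intro power_mono) auto
        moreover have "(3 * \<tau>)\<^sup>2 = 9 * \<tau>\<^sup>2" by (simp add: power_mult_distrib)
        ultimately have "8 * \<tau>\<^sup>2 \<le> (real T * p0)\<^sup>2" using zero_le_power2[of \<tau>] by linarith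
        moreover have "0 < (real T * p0)\<^sup>2" using T p0(1) by simp
        ultimately show "2 * \<tau>\<^sup>2 / (real T * p0)\<^sup>2 \<le> 1 / 4" by (simp add: divide_le_eq)
      qed
      finally show ?thesis unfolding ip_noise_step[OF x] by simp
    qed
    show "(\<Sum>y<d. M $$ (x, y) * ?X x y a b) = 0" if ab: "a < d + d" "b < d + d" for a b
    proof -
      have z: "(\<Sum>y<d. M $$ (x, y) * noise_step T x y i j) = 0" if "j < d" for i j
      proof -
        have "(\<Sum>y<d. M $$ (x, y) * noise_step T x y i j) =
            of_bool (i = x) * (1 / (real T * sqrt (\<pi> $ x))) * (\<Sum>y<d. M $$ (x, y) * residual x y j)"
          by (simp only: noise_step_def sum_distrib_left mult_ac)
        then show ?thesis using residual_mean[OF x that] by simp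
      qed
      have "(\<Sum>y<d. M $$ (x, y) * ?X x y a b) = \<tau> * (\<Sum>y<d. M $$ (x, y) * dilation d (noise_step T x y) a b)"
        by (simp only: sum_distrib_left mult_ac)
      also have "(\<Sum>y<d. M $$ (x, y) * dilation d (noise_step T x y) a b) = 0"
      proof -
        consider "a < d \<and> d \<le> b" | "\<not> (a < d \<and> d \<le> b)" "d \<le> a \<and> b < d"
          | "\<not> (a < d \<and> d \<le> b)" "\<not> (d \<le> a \<and> b < d)" by blast
        then show ?thesis
        proof cases
          case 1
          then show ?thesis using ab z[of "b - d" a] by (simp add: dilation_def)
        next
          case 2
          then show ?thesis using ab z[of "a - d" b] by (simp add: dilation_def)
        next
          case 3
          then show ?thesis unfolding dilation_def by (simp only: if_False) simp
        qed
      qed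
      finally show ?thesis by simp
    qed
    show "(\<Sum>y<d. M $$ (x, y) * ip (d + d) (mv (d + d) (?X x y) u) (mv (d + d) (?X x y) u)) \<le>
        ip (d + d) u (mv (d + d) (?V x) u)" for u
    proof -
      let ?u = "\<lambda>j. u (d + j)" and ?b = "\<tau>\<^sup>2 / ((real T)\<^sup>2 * \<pi> $ x)"
      have "(\<Sum>y<d. M $$ (x, y) * ip (d + d) (mv (d + d) (?X x y) u) (mv (d + d) (?X x y) u)) =
          ?b * ((\<Sum>y<d. M $$ (x, y) * (ip d (residual x y) ?u)\<^sup>2) +
            (u x)\<^sup>2 * (\<Sum>y<d. M $$ (x, y) * ip d (residual x y) (residual x y)))"
        unfolding ip_noise_step[OF x]
        by (simp add: sum.distrib sum_distrib_left distrib_left mult_ac)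
      also have "\<dots> \<le> ?b * ((\<Sum>j<d. M $$ (x, j) / \<pi> $ j * (?u j)\<^sup>2) + (u x)\<^sup>2 * (\<Sum>j<d. M $$ (x, j) / \<pi> $ j))"
        using px by (intro mult_left_mono add_mono residual_inner_variance residual_norm_variance x) auto
      also have "\<dots> = ip (d + d) u (mv (d + d) (?V x) u)"
      proof -
        have lo: "(\<Sum>a<d. variance_proxy T x a * (u a)\<^sup>2) =
            (\<Sum>j<d. M $$ (x, j) / \<pi> $ j) / ((real T)\<^sup>2 * \<pi> $ x) * (u x)\<^sup>2"
        proof -
          have "(\<Sum>a<d. variance_proxy T x a * (u a)\<^sup>2) =
              (\<Sum>a<d. if a = x then (\<Sum>j<d. M $$ (a, j) / \<pi> $ j) / ((real T)\<^sup>2 * \<pi> $ a) * (u a)\<^sup>2 else 0)"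
            by (intro sum.cong) (auto simp: variance_proxy_def)
          then show ?thesis using x by simp
        qed
        have hi: "(\<Sum>j<d. variance_proxy T x (d + j) * (u (d + j))\<^sup>2) =
            1 / ((real T)\<^sup>2 * \<pi> $ x) * (\<Sum>j<d. M $$ (x, j) / \<pi> $ j * (u (d + j))\<^sup>2)"
          by (simp add: variance_proxy_def sum_distrib_left)
        show ?thesis
          unfolding mv_mat_scale ip_scale_right ip_diagonal sum_lessThan_plus lo hi
          by (simp add: algebra_simps)
      qed
      finally show ?thesis .
    qed
  qed (rule x)
  then show ?thesis by (simp add: trace_exp_0)
qed

text \<open>Row indices cost \<open>1 / p0\<close>, since the rows of \<open>M\<close> sum to 1. For
  column indices the visit bound cancels \<open>\<pi> i\<close> and leaves a column sum of
  \<open>M\<close>; this is where \<open>c\<close>, later \<open>max_col_sum_norm M\<close>, enters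
  the sample size.\<close>

lemma variance_proxy_sum_le:
  assumes T: "T \<ge> 1" and p0: "0 < p0" "\<And>i. i < d \<Longrightarrow> p0 \<le> \<pi> $ i"
    and c: "1 \<le> c" "\<And>j. j < d \<Longrightarrow> (\<Sum>i<d. M $$ (i, j)) \<le> c"
    and zs: "set zs \<subseteq> {..<d}" and v: "\<And>i. i < d \<Longrightarrow> visits i zs \<le> 2 * real T * \<pi> $ i" and a: "a < d + d"
  shows "transition_sum (\<lambda>x y. variance_proxy T x a) zs \<le> 2 * c / (real T * p0)"
proof (cases "a < d")
  case True
  let ?R = "\<Sum>j<d. M $$ (a, j) / \<pi> $ j"
  have pa: "0 < \<pi> $ a" by (rule pi_pos[OF True])
  have "transition_sum (\<lambda>x y. variance_proxy T x a) zs = transition_sum (\<lambda>x y. (?R / ((real T)\<^sup>2 * \<pi> $ a)) * of_bool (x = a)) zs"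
    using True by (simp only: variance_proxy_def if_True mult.commute)
  also have "\<dots> = ?R / ((real T)\<^sup>2 * \<pi> $ a) * visits a zs"
    by (simp only: transition_sum_scale visits_def)
  also have "\<dots> \<le> ?R / ((real T)\<^sup>2 * \<pi> $ a) * (2 * real T * \<pi> $ a)"
    using pa pi_nonneg M_nonneg True
    by (intro mult_left_mono v True divide_nonneg_nonneg sum_nonneg) auto
  also have "\<dots> = 2 * ?R / real T"
    using pa T by (simp add: field_simps power2_eq_square)
  also have "?R \<le> (\<Sum>j<d. M $$ (a, j) / p0)"
    using p0 M_nonneg True by (intro sum_mono frac_le) auto
  also have "\<dots> = 1 / p0" by (simp only: sum_divide_distrib[symmetric] M_row[OF True])
  finally have "transition_sum (\<lambda>x y. variance_proxy T x a) zs \<le> 2 * (1 / p0) / real T"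
    by (simp add: divide_right_mono)
  also have "\<dots> \<le> 2 * c / (real T * p0)"
    using c(1) p0(1) T by (simp add: field_simps)
  finally show ?thesis .
next
  case False
  define j where "j = a - d"
  have j: "j < d" using a False by (simp add: j_def)
  have pj: "0 < \<pi> $ j" by (rule pi_pos[OF j])
  have "transition_sum (\<lambda>x y. variance_proxy T x a) zs =
      transition_sum (\<lambda>x y. \<Sum>i<d. (M $$ (i, j) / ((real T)\<^sup>2 * \<pi> $ i * \<pi> $ j)) * of_bool (x = i)) zs"
  proof (rule transition_sum_cong[OF zs])
    fix x y assume "x < d"
    then show "variance_proxy T x a = (\<Sum>i<d. (M $$ (i, j) / ((real T)\<^sup>2 * \<pi> $ i * \<pi> $ j)) * of_bool (x = i))"
      using False by (simp add: variance_proxy_def j_def of_bool_def if_distrib[of "\<lambda>z. _ * z"] cong: if_cong)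
  qed
  also have "\<dots> = (\<Sum>i<d. (M $$ (i, j) / ((real T)\<^sup>2 * \<pi> $ i * \<pi> $ j)) * visits i zs)"
    by (simp only: transition_sum_sum finite_lessThan transition_sum_scale visits_def)
  also have "\<dots> \<le> (\<Sum>i<d. (2 / (real T * \<pi> $ j)) * M $$ (i, j))"
  proof (rule sum_mono)
    fix i assume "i \<in> {..<d}"
    then have i: "i < d" by simp
    have pi: "0 < \<pi> $ i" by (rule pi_pos[OF i])
    have "(M $$ (i, j) / ((real T)\<^sup>2 * \<pi> $ i * \<pi> $ j)) * visits i zs \<le>
        (M $$ (i, j) / ((real T)\<^sup>2 * \<pi> $ i * \<pi> $ j)) * (2 * real T * \<pi> $ i)"
      using pi pj M_nonneg[OF i j] by (intro mult_left_mono v i) auto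
    also have "\<dots> = (2 / (real T * \<pi> $ j)) * M $$ (i, j)"
      using pi pj T by (simp add: field_simps power2_eq_square)
    finally show "(M $$ (i, j) / ((real T)\<^sup>2 * \<pi> $ i * \<pi> $ j)) * visits i zs \<le>
        (2 / (real T * \<pi> $ j)) * M $$ (i, j)" .
  qed
  also have "\<dots> = (2 / (real T * \<pi> $ j)) * (\<Sum>i<d. M $$ (i, j))" by (rule sum_distrib_left[symmetric])
  also have "\<dots> \<le> (2 / (real T * p0)) * c"
  proof (rule mult_mono)
    show "2 / (real T * \<pi> $ j) \<le> 2 / (real T * p0)"
      using p0(1) p0(2)[OF j] T by (intro divide_left_mono mult_left_mono) auto
    show "0 \<le> (\<Sum>i<d. M $$ (i, j))" using M_nonneg j by (intro sum_nonneg) auto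
  qed (use c(2)[OF j] p0(1) in auto)
  finally show ?thesis by simp
qed

end

section \<open>Chains consistent with a trajectory\<close>

lemma nrm_mult_le:
  assumes "\<And>i. i < d \<Longrightarrow> \<bar>c i\<bar> \<le> K" "0 \<le> K"
  shows "nrm d (\<lambda>i. c i * v i) \<le> K * nrm d v"
proof -
  have "ip d (\<lambda>i. c i * v i) (\<lambda>i. c i * v i) \<le> K\<^sup>2 * ip d v v"
    unfolding ip_def sum_distrib_left
  proof (rule sum_mono)
    fix i assume "i \<in> {..<d}"
    then have "(c i)\<^sup>2 \<le> K\<^sup>2" using assms by (intro abs_le_square_iff[THEN iffD1]) auto
    then have "(c i)\<^sup>2 * (v i)\<^sup>2 \<le> K\<^sup>2 * (v i)\<^sup>2" by (rule mult_right_mono) simp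
    then show "c i * v i * (c i * v i) \<le> K\<^sup>2 * (v i * v i)" by (simp add: power2_eq_square mult_ac)
  qed
  then have "nrm d (\<lambda>i. c i * v i) \<le> sqrt (K\<^sup>2 * ip d v v)" unfolding nrm_def by (rule real_sqrt_le_mono)
  then show ?thesis using assms(2) by (simp add: nrm_def real_sqrt_mult)
qed

text \<open>The hypothesis is an eigenvalue bound for the dilation. Taking for \<open>u\<close> the
  image of \<open>w\<close>, rescaled to the length of \<open>w\<close>, balances the two squares
  and recovers the operator norm.\<close>

lemma nrm_mv_le_of_form:
  assumes "\<And>u z. ip d u (mv d A z) \<le> \<eta> / 2 * (ip d u u + ip d z z)"
  shows "nrm d (mv d A w) \<le> \<eta> * nrm d w"
proof -
  let ?y = "mv d A w"
  consider "nrm d w = 0" | "nrm d ?y = 0" "nrm d w > 0" | "nrm d w > 0" "nrm d ?y > 0"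
    using nrm_nonneg[of d w] nrm_nonneg[of d ?y] by linarith
  then show ?thesis
  proof cases
    case 1
    then have "\<forall>i<d. w i = 0" by (simp add: nrm_def ip_eq_0_iff)
    then show ?thesis by (simp add: nrm_def ip_def mv_def)
  next
    case 2
    have "0 \<le> \<eta>"
    proof (rule ccontr)
      assume "\<not> 0 \<le> \<eta>"
      then have "\<eta> / 2 * (ip d (\<lambda>i. 0) (\<lambda>i. 0) + ip d w w) < 0"
        using 2(2) by (intro mult_neg_pos) (auto simp: nrm_def ip_def)
      moreover have "ip d (\<lambda>i. 0) (mv d A w) = 0" by (simp add: ip_def)
      ultimately show False using assms[of "\<lambda>i. 0" w] by linarith
    qed
    with 2 show ?thesis by simp
  next
    case 3
    let ?c = "nrm d w / nrm d ?y"
    have "?c * (nrm d ?y)\<^sup>2 \<le> \<eta> / 2 * (?c * (?c * (nrm d ?y)\<^sup>2) + (nrm d w)\<^sup>2)"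
      using assms[of "\<lambda>i. ?c * ?y i" w] by (simp only: ip_scale_left ip_scale_right nrm_power2)
    also have "?c * (?c * (nrm d ?y)\<^sup>2) = (nrm d w)\<^sup>2" using 3 by (simp add: power2_eq_square)
    also have "\<eta> / 2 * ((nrm d w)\<^sup>2 + (nrm d w)\<^sup>2) = \<eta> * (nrm d w)\<^sup>2" by simp
    also have "?c * (nrm d ?y)\<^sup>2 = nrm d w * nrm d ?y" using 3 by (simp add: power2_eq_square)
    finally have "nrm d w * nrm d ?y \<le> nrm d w * (\<eta> * nrm d w)" by (simp add: power2_eq_square mult_ac)
    then show ?thesis using 3(1) by (simp only: mult_le_cancel_left_pos)
  qed
qed

text \<open>A function of the data alone; for a state without departures the division by zero makes
  its row and column vanish.\<close>

definition empirical_kernel :: "nat list \<Rightarrow> nat \<Rightarrow> nat \<Rightarrow> real" where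
  "empirical_kernel zs i j =
     transition_sum (\<lambda>x y. of_bool (x = i) * of_bool (y = j)) zs / (sqrt (visits i zs) * sqrt (visits j zs))"

context ergodic_chain
begin

text \<open>A large noise form makes the trace exponential large unless the compensator outweighs
  it. The visit bounds control the compensator, so both conditions are kept in one event and
  Markov's inequality applies.\<close>

lemma noise_tail:
  assumes T: "T \<ge> 1" and p0: "0 < p0" "\<And>i. i < d \<Longrightarrow> p0 \<le> \<pi> $ i"
    and c: "1 \<le> c" "\<And>j. j < d \<Longrightarrow> (\<Sum>i<d. M $$ (i, j)) \<le> c"
    and \<eta>: "0 < \<eta>" "\<eta> \<le> 1" and x: "x < d"
  shows "path_exp d M T x (\<lambda>zs. of_bool ((\<exists>u z. \<eta> / 2 * (ip d u u + ip d z z) < ip d u (mv d (noise zs) z)) \<and>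
      (\<forall>i<d. visits i zs \<le> 2 * real T * \<pi> $ i))) \<le> 2 * real d * exp (- (\<eta>\<^sup>2 * real T * p0 / (32 * c)))"
proof -
  \<comment> \<open>Minimiser \<open>\<eta> / (8 w)\<close> of the exponent
    \<open>- \<tau> \<eta> + 4 \<tau>^2 w\<close>.\<close>
  define \<tau> where "\<tau> = \<eta> * real T * p0 / (16 * c)"
  define w where "w = 2 * c / (real T * p0)"
  define H where "H zs a b = transition_sum (\<lambda>x y. \<tau> * dilation d (noise_step T x y) a b -
      4 * (\<tau>\<^sup>2 * diagonal (variance_proxy T x) a b)) zs" for zs a b
  have Tp: "0 < real T * p0" using T p0(1) by simp
  have \<tau>: "0 < \<tau>" "3 * \<tau> \<le> real T * p0"
  proof -
    have "0 < \<eta> * (real T * p0) / (16 * c)" using mult_pos_pos[OF \<eta>(1) Tp] c(1) by (intro divide_pos_pos) auto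
    then show "0 < \<tau>" by (simp only: \<tau>_def mult.assoc)
    have "3 * \<eta> * (real T * p0) \<le> (16 * c) * (real T * p0)"
      using \<eta> c(1) Tp by (intro mult_right_mono) auto
    then show "3 * \<tau> \<le> real T * p0" using c(1) by (simp add: \<tau>_def field_simps)
  qed
  let ?E = "\<lambda>zs. (\<exists>u z. \<eta> / 2 * (ip d u u + ip d z z) < ip d u (mv d (noise zs) z)) \<and>
      (\<forall>i<d. visits i zs \<le> 2 * real T * \<pi> $ i)"
  have "path_exp d M T x (\<lambda>zs. of_bool (?E zs)) \<le>
      path_exp d M T x (\<lambda>zs. exp (- \<tau> * \<eta> + 4 * \<tau>\<^sup>2 * w) * trace_exp (d + d) (H zs))"
  proof (rule path_exp_mono[OF x])
    fix ys assume ys: "ys \<in> trajectories d T"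
    let ?zs = "x # ys"
    have len: "length ?zs - 1 = T" and set: "set ?zs \<subseteq> {..<d}" using ys x by (auto simp: trajectories_def)
    define W where "W a = transition_sum (\<lambda>x y. variance_proxy T x a) ?zs" for a
    have H: "H ?zs = (\<lambda>a b. \<tau> * dilation d (noise ?zs) a b - 4 * \<tau>\<^sup>2 * diagonal W a b)"
    proof (intro ext)
      fix a b
      have 1: "transition_sum (\<lambda>x y. dilation d (noise_step T x y) a b) ?zs = dilation d (noise ?zs) a b"
        unfolding dilation_def noise_def len using transition_sum_scale[of 0 "\<lambda>_ _. 0" ?zs] by auto
      have 2: "transition_sum (\<lambda>x y. diagonal (variance_proxy T x) a b) ?zs = diagonal W a b"
        unfolding diagonal_def W_def using transition_sum_scale[of 0 "\<lambda>_ _. 0" ?zs] by auto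
      show "H ?zs a b = \<tau> * dilation d (noise ?zs) a b - 4 * \<tau>\<^sup>2 * diagonal W a b"
        unfolding H_def transition_sum_diff transition_sum_scale 1 2 by simp
    qed
    have symH: "symmetric_on (d + d) (H ?zs)"
      unfolding H by (intro symmetric_on_diff symmetric_on_scale symmetric_on_dilation symmetric_on_diagonal)
    have tr0: "0 \<le> trace_exp n A" for n A by (simp add: trace_exp_def sum_nonneg)
    show "of_bool (?E ?zs) \<le> exp (- \<tau> * \<eta> + 4 * \<tau>\<^sup>2 * w) * trace_exp (d + d) (H ?zs)"
    proof (cases "?E ?zs")
      case False
      show ?thesis
        unfolding of_bool_def if_not_P[OF False] by (intro mult_nonneg_nonneg tr0) simp
    next
      case True
      then obtain u z where uz: "\<eta> / 2 * (ip d u u + ip d z z) < ip d u (mv d (noise ?zs) z)"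
        and vis: "\<And>i. i < d \<Longrightarrow> visits i ?zs \<le> 2 * real T * \<pi> $ i" by blast
      let ?q = "ip d u u + ip d z z"
      have q0: "0 < ?q"
      proof (rule ccontr)
        assume "\<not> 0 < ?q"
        then have "ip d u u = 0" "ip d z z = 0" using ip_nonneg[of d u] ip_nonneg[of d z] by auto
        then have "ip d u (mv d (noise ?zs) z) = 0" by (simp add: ip_eq_0_iff) (simp add: ip_def)
        then show False using uz \<open>ip d u u = 0\<close> \<open>ip d z z = 0\<close> by simp
      qed
      \<comment> \<open>Stacking \<open>u\<close> and \<open>z\<close> and normalising gives a unit
        vector for the dilation, whose form is twice the bilinear one.\<close>
      define v where "v a = 1 / sqrt ?q * (if a < d then u a else z (a - d))" for a
      have vu: "ip d v w' = 1 / sqrt ?q * ip d u w'" for w'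
        unfolding ip_scale_left[symmetric] by (rule ip_cong) (simp_all add: v_def)
      have vz: "(\<lambda>j. v (d + j)) = (\<lambda>j. 1 / sqrt ?q * z j)" by (simp add: v_def)
      have "ip d v v = 1 / sqrt ?q * (1 / sqrt ?q * ip d u u)"
        unfolding vu ip_commute[of d u v] by simp
      then have unit: "ip (d + d) v v = 1"
        unfolding ip_double[of d v] vz ip_scale_left ip_scale_right using q0
        by (simp add: field_simps)
      have A: "ip (d + d) v (mv (d + d) (dilation d (noise ?zs)) v) \<ge> \<eta>"
      proof -
        have "ip (d + d) v (mv (d + d) (dilation d (noise ?zs)) v) =
            2 * (1 / sqrt ?q * (1 / sqrt ?q * ip d u (mv d (noise ?zs) z)))"
          unfolding ip_dilation vz vu mv_scale ip_scale_right ..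
        also have "\<dots> = 2 * ip d u (mv d (noise ?zs) z) / ?q" using q0 by simp
        also have "\<dots> \<ge> \<eta>" using uz q0 by (simp add: field_simps)
        finally show ?thesis .
      qed
      have B: "ip (d + d) v (mv (d + d) (diagonal W) v) \<le> w"
      proof -
        have "ip (d + d) v (mv (d + d) (diagonal W) v) = (\<Sum>a<d + d. W a * (v a)\<^sup>2)" by (rule ip_diagonal)
        also have "\<dots> \<le> (\<Sum>a<d + d. w * (v a)\<^sup>2)"
          unfolding W_def w_def
          by (intro sum_mono mult_right_mono variance_proxy_sum_le[OF T p0 c set vis]) auto
        also have "\<dots> = w * ip (d + d) v v" by (simp add: ip_def sum_distrib_left power2_eq_square)
        finally show ?thesis using unit by simp
      qed
      have "ip (d + d) v (mv (d + d) (H ?zs) v) = \<tau> * ip (d + d) v (mv (d + d) (dilation d (noise ?zs)) v) -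
          4 * \<tau>\<^sup>2 * ip (d + d) v (mv (d + d) (diagonal W) v)"
        unfolding H mv_mat_diff mv_mat_scale ip_diff_right ip_scale_right ..
      also have "\<dots> \<ge> \<tau> * \<eta> - 4 * \<tau>\<^sup>2 * w"
        using A B \<tau>(1) by (intro diff_mono mult_left_mono) auto
      finally have "exp (\<tau> * \<eta> - 4 * \<tau>\<^sup>2 * w) \<le> exp (ip (d + d) v (mv (d + d) (H ?zs) v))" by simp
      also have "\<dots> \<le> trace_exp (d + d) (H ?zs)"
        by (rule exp_quadratic_form_le_trace_exp[OF symH unit])
      finally have "exp (- \<tau> * \<eta> + 4 * \<tau>\<^sup>2 * w) * exp (\<tau> * \<eta> - 4 * \<tau>\<^sup>2 * w) \<le>
          exp (- \<tau> * \<eta> + 4 * \<tau>\<^sup>2 * w) * trace_exp (d + d) (H ?zs)" by (rule mult_left_mono) simp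
      then show ?thesis using True by (simp add: exp_add[symmetric])
    qed
  qed
  also have "\<dots> = exp (- \<tau> * \<eta> + 4 * \<tau>\<^sup>2 * w) * path_exp d M T x (\<lambda>zs. trace_exp (d + d) (H zs))"
    by (rule path_exp_scale)
  also have "\<dots> \<le> exp (- \<tau> * \<eta> + 4 * \<tau>\<^sup>2 * w) * (2 * real d)"
    unfolding H_def by (intro mult_left_mono noise_freedman[OF T p0 less_imp_le[OF \<tau>(1)] \<tau>(2) x]) auto
  also have "- \<tau> * \<eta> + 4 * \<tau>\<^sup>2 * w = - (\<eta>\<^sup>2 * real T * p0 / (32 * c))"
  proof -
    have "4 * \<tau>\<^sup>2 * w = \<tau> * (\<eta> / 2)"
      using c(1) T p0(1) by (simp add: w_def \<tau>_def power2_eq_square)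
    then have "- \<tau> * \<eta> + 4 * \<tau>\<^sup>2 * w = - (\<tau> * \<eta> / 2)" by simp
    also have "\<dots> = - (\<eta>\<^sup>2 * real T * p0 / (32 * c))" by (simp add: \<tau>_def power2_eq_square)
    finally show ?thesis .
  qed
  finally show ?thesis by (simp add: mult.commute)
qed

text \<open>Compares the data with any candidate chain, true or not. The last clause bounds the
  operator norm of the noise by \<eta> in the form that matches the dilation;
  \<open>\<eta> <= 1 / 2\<close> keeps the visit ratios away from zero.\<close>

definition consistent :: "real \<Rightarrow> nat list \<Rightarrow> bool" where
  "consistent \<eta> zs \<longleftrightarrow> 0 \<le> \<eta> \<and> \<eta> \<le> 1 / 2 \<and>
     (\<forall>i<d. \<bar>visits i zs - real (length zs - 1) * \<pi> $ i\<bar> \<le> \<eta> * real (length zs - 1) * \<pi> $ i) \<and>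
     (\<forall>u z. ip d u (mv d (noise zs) z) \<le> \<eta> / 2 * (ip d u u + ip d z z))"

text \<open>Union bound over \<open>2 d\<close> one-sided visit events and the noise event of
  \<open>noise_tail\<close>; the visit bounds inside the latter hold once no visit event
  occurs.\<close>

lemma inconsistent_tail:
  assumes T: "T \<ge> 1" "real T * pseudo_spectral_gap \<pi> M \<ge> 2" and p0: "0 < p0" "\<And>i. i < d \<Longrightarrow> p0 \<le> \<pi> $ i"
    and c: "1 \<le> c" "\<And>j. j < d \<Longrightarrow> (\<Sum>i<d. M $$ (i, j)) \<le> c"
    and \<eta>: "0 < \<eta>" "\<eta> \<le> 1 / 2" and x: "x < d"
  shows "path_exp d M T x (\<lambda>zs. of_bool (\<not> consistent \<eta> zs)) \<le>
    4 * real d / sqrt p0 * exp (- (\<eta>\<^sup>2 * pseudo_spectral_gap \<pi> M * p0 * real T / 224)) +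
    2 * real d * exp (- (\<eta>\<^sup>2 * real T * p0 / (32 * c)))"
proof -
  let ?A = "\<lambda>s i zs. of_bool (\<eta> * real T * \<pi> $ i \<le> s * (visits i zs - real T * \<pi> $ i)) :: real"
  let ?E = "\<lambda>zs. (\<exists>u z. \<eta> / 2 * (ip d u u + ip d z z) < ip d u (mv d (noise zs) z)) \<and>
      (\<forall>i<d. visits i zs \<le> 2 * real T * \<pi> $ i)"
  have \<eta>1: "\<eta> \<le> 1" using \<eta> by simp
  have "path_exp d M T x (\<lambda>zs. of_bool (\<not> consistent \<eta> zs)) \<le>
      path_exp d M T x (\<lambda>zs. \<Sum>b\<in>{False, True}. (if b then of_bool (?E zs) else (\<Sum>i<d. \<Sum>s\<in>{1, -1}. ?A s i zs)))"
  proof (rule path_exp_mono[OF x])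
    fix ys assume ys: "ys \<in> trajectories d T"
    let ?zs = "x # ys"
    have len: "length ?zs - 1 = T" using ys by (simp add: trajectories_def)
    have nonneg: "0 \<le> (\<Sum>i<d. \<Sum>s\<in>{1, -1}. ?A s i ?zs)" by (intro sum_nonneg) auto
    have "of_bool (\<not> consistent \<eta> ?zs) \<le> (\<Sum>i<d. \<Sum>s\<in>{1, -1}. ?A s i ?zs) + of_bool (?E ?zs)"
    proof (cases "\<forall>i<d. \<bar>visits i ?zs - real T * \<pi> $ i\<bar> \<le> \<eta> * real T * \<pi> $ i")
      case False
      then obtain i where i: "i < d" "\<eta> * real T * \<pi> $ i < \<bar>visits i ?zs - real T * \<pi> $ i\<bar>"
        by (auto simp: not_le)
      have pair: "(\<Sum>s\<in>{1, -1 :: real}. g s) = g 1 + g (-1)" for g :: "real \<Rightarrow> real" by simp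
      have "1 \<le> (\<Sum>s\<in>{1, -1}. ?A s i ?zs)"
        unfolding pair using i(2) by (cases "visits i ?zs - real T * \<pi> $ i \<ge> 0") auto
      also have "\<dots> \<le> (\<Sum>i<d. \<Sum>s\<in>{1, -1}. ?A s i ?zs)"
        by (rule member_le_sum[of i "{..<d}" "\<lambda>i. \<Sum>s\<in>{1, -1}. ?A s i ?zs"]) (use i in auto)
      finally have "1 \<le> (\<Sum>i<d. \<Sum>s\<in>{1, -1}. ?A s i ?zs)" .
      moreover have "of_bool (\<not> consistent \<eta> ?zs) \<le> (1 :: real)" "0 \<le> (of_bool (?E ?zs) :: real)" by auto
      ultimately show ?thesis by linarith
    next
      case True
      have vis: "visits i ?zs \<le> 2 * real T * \<pi> $ i" if i: "i < d" for i
      proof -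
        have "\<eta> * (real T * \<pi> $ i) \<le> 1 * (real T * \<pi> $ i)"
          using \<eta>1 pi_nonneg[OF i] by (intro mult_right_mono) auto
        then show ?thesis using True[rule_format, OF i] by (simp add: abs_le_iff)
      qed
      have "consistent \<eta> ?zs \<or> ?E ?zs"
      proof (rule disjCI)
        assume "\<not> ?E ?zs"
        then have "\<forall>u z. ip d u (mv d (noise ?zs) z) \<le> \<eta> / 2 * (ip d u u + ip d z z)"
          using vis by (meson not_le)
        then show "consistent \<eta> ?zs" unfolding consistent_def len using True \<eta> by simp
      qed
      then have "of_bool (\<not> consistent \<eta> ?zs) \<le> (of_bool (?E ?zs) :: real)" by auto
      then show ?thesis using nonneg by linarith
    qed
    then show "of_bool (\<not> consistent \<eta> ?zs) \<le>
        (\<Sum>b\<in>{False, True}. (if b then of_bool (?E ?zs) else (\<Sum>i<d. \<Sum>s\<in>{1, -1}. ?A s i ?zs)))"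
      by simp
  qed
  also have "\<dots> = (\<Sum>b\<in>{False, True}. path_exp d M T x (\<lambda>zs. if b then of_bool (?E zs) else (\<Sum>i<d. \<Sum>s\<in>{1, -1}. ?A s i zs)))"
    by (rule path_exp_sum)
  also have "\<dots> = path_exp d M T x (\<lambda>zs. \<Sum>i<d. \<Sum>s\<in>{1, -1}. ?A s i zs) + path_exp d M T x (\<lambda>zs. of_bool (?E zs))"
    by simp
  finally have main: "path_exp d M T x (\<lambda>zs. of_bool (\<not> consistent \<eta> zs)) \<le>
      path_exp d M T x (\<lambda>zs. \<Sum>i<d. \<Sum>s\<in>{1, -1}. ?A s i zs) + path_exp d M T x (\<lambda>zs. of_bool (?E zs))" .
  have "path_exp d M T x (\<lambda>zs. \<Sum>i<d. \<Sum>s\<in>{1, -1}. ?A s i zs) =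
      (\<Sum>i<d. \<Sum>s\<in>{1, -1}. path_exp d M T x (?A s i))"
    by (simp only: path_exp_sum)
  also have "\<dots> \<le> (\<Sum>i<d. \<Sum>s\<in>{1, -1 :: real}. 2 / sqrt p0 * exp (- (\<eta>\<^sup>2 * pseudo_spectral_gap \<pi> M * p0 * real T / 224)))"
    by (intro sum_mono visits_one_sided_tail \<eta>(1) \<eta>1 T x p0) auto
  also have "\<dots> = 4 * real d / sqrt p0 * exp (- (\<eta>\<^sup>2 * pseudo_spectral_gap \<pi> M * p0 * real T / 224))"
    by simp
  finally show ?thesis
    using main noise_tail[OF T(1) p0 c \<eta>(1) \<eta>1 x] by linarith
qed

text \<open>The square roots \<open>a i\<close> of the visit ratios lie near 1, and up to these
  factors the empirical matrix is \<open>L\<close> plus noise. Noise and row distortion cost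
  \<open>3 \<eta>\<close> on the rescaled vector, of norm at most \<open>2 |v|\<close>; column
  distortion costs \<open>2 \<eta>\<close> more, and 3 * 2 + 2 = 8.\<close>

lemma empirical_kernel_close:
  assumes len: "length zs \<ge> 2" and cons: "consistent \<eta> zs"
  shows "nrm d (\<lambda>i. mv d (empirical_kernel zs) v i - K v i) \<le> 8 * \<eta> * nrm d v"
proof -
  define T where "T = length zs - 1"
  have \<eta>: "0 \<le> \<eta>" "\<eta> \<le> 1 / 2"
    and vis: "\<And>i. i < d \<Longrightarrow> \<bar>visits i zs - real T * \<pi> $ i\<bar> \<le> \<eta> * real T * \<pi> $ i"
    and noise: "\<And>w. nrm d (mv d (noise zs) w) \<le> \<eta> * nrm d w"
    using cons[unfolded consistent_def, folded T_def] nrm_mv_le_of_form[of d "noise zs" \<eta>] by auto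
  have T: "0 < real T" using len by (simp add: T_def)
  define a where "a i = sqrt (visits i zs / (real T * \<pi> $ i))" for i
  have Tpi: "0 < real T * \<pi> $ i" if "i < d" for i using T pi_pos[OF that] by simp
  have a2: "\<bar>(a i)\<^sup>2 - 1\<bar> \<le> \<eta>" if "i < d" for i
  proof -
    have "(a i)\<^sup>2 = visits i zs / (real T * \<pi> $ i)"
      using divide_nonneg_pos[OF visits_nonneg[of i zs] Tpi[OF that]] by (simp add: a_def)
    then have "(a i)\<^sup>2 - 1 = (visits i zs - real T * \<pi> $ i) / (real T * \<pi> $ i)"
      using T pi_pos[OF that] unfolding diff_divide_distrib by simp
    then have "\<bar>(a i)\<^sup>2 - 1\<bar> = \<bar>visits i zs - real T * \<pi> $ i\<bar> / (real T * \<pi> $ i)"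
      by (simp only: abs_divide abs_of_pos[OF Tpi[OF that]])
    also have "\<dots> \<le> \<eta>" using vis[OF that] Tpi[OF that] by (simp add: divide_le_eq mult.assoc)
    finally show ?thesis .
  qed
  have a0: "0 \<le> a i" if "i < d" for i
    using divide_nonneg_pos[OF visits_nonneg[of i zs] Tpi[OF that]] by (simp add: a_def)
  have a1: "\<bar>a i - 1\<bar> \<le> \<eta>" if "i < d" for i
  proof -
    have "\<bar>a i - 1\<bar> * 1 \<le> \<bar>a i - 1\<bar> * (a i + 1)" using a0[OF that] by (intro mult_left_mono) auto
    also have "\<dots> = \<bar>(a i)\<^sup>2 - 1\<bar>"
      using a0[OF that] abs_mult[of "a i - 1" "a i + 1"] by (simp add: power2_eq_square algebra_simps)
    finally show ?thesis using a2[OF that] by simp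
  qed
  have ahalf: "1 / 2 \<le> a i" if "i < d" for i using a1[OF that] \<eta> by linarith
  have inv: "\<bar>1 / a i\<bar> \<le> 2" "\<bar>1 / a i - 1\<bar> \<le> 2 * \<eta>" if "i < d" for i
  proof -
    have p: "0 < a i" using ahalf[OF that] by simp
    show "\<bar>1 / a i\<bar> \<le> 2" using ahalf[OF that] p by (simp add: divide_le_eq)
    have "\<bar>1 / a i - 1\<bar> = \<bar>1 / a i\<bar> * \<bar>a i - 1\<bar>"
      unfolding abs_mult[symmetric] using p by (simp add: abs_minus_commute right_diff_distrib)
    also have "\<dots> \<le> 2 * \<eta>" using a1[OF that] \<open>\<bar>1 / a i\<bar> \<le> 2\<close> by (intro mult_mono) auto
    finally show "\<bar>1 / a i - 1\<bar> \<le> 2 * \<eta>" .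
  qed
  let ?w = "\<lambda>j. 1 / a j * v j"
  have entry: "empirical_kernel zs i j = 1 / a i * noise zs i j * (1 / a j) + a i * L i j * (1 / a j)"
    if "i < d" "j < d" for i j
  proof -
    let ?C = "transition_sum (\<lambda>x y. of_bool (x = i) * of_bool (y = j)) zs"
    let ?s = "sqrt (\<pi> $ i)" and ?s' = "sqrt (\<pi> $ j)"
    have s: "0 < ?s" "0 < ?s'" "?s * ?s = \<pi> $ i" using sqrt_pi_pos that sqrt_pi_sq by auto
    have "noise_step T x y i j = (1 / (real T * ?s * ?s')) * (of_bool (x = i) * of_bool (y = j) - M $$ (i, j) * of_bool (x = i))" for x y
      by (auto simp: noise_step_def residual_def)
    then have nz: "noise zs i j = (1 / (real T * ?s * ?s')) * (?C - M $$ (i, j) * visits i zs)"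
      unfolding noise_def visits_def T_def[symmetric]
      by (simp only: transition_sum_scale transition_sum_diff)
    have v: "visits l zs = (a l)\<^sup>2 * (real T * \<pi> $ l)" "sqrt (visits l zs) = a l * (sqrt (real T) * sqrt (\<pi> $ l))"
      if "l < d" for l
    proof -
      show "visits l zs = (a l)\<^sup>2 * (real T * \<pi> $ l)"
        using divide_nonneg_pos[OF visits_nonneg[of l zs] Tpi[OF that]] pi_pos[OF that] T by (simp add: a_def)
      then show "sqrt (visits l zs) = a l * (sqrt (real T) * sqrt (\<pi> $ l))"
        using a0[OF that] by (simp add: real_sqrt_mult)
    qed
    have ai: "0 < a i" "0 < a j" using ahalf[OF that(1)] ahalf[OF that(2)] by auto
    have C: "?C = real T * ?s * ?s' * noise zs i j + M $$ (i, j) * visits i zs"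
      using s T by (simp add: nz)
    have "sqrt (visits i zs) * sqrt (visits j zs) = a i * a j * (real T * ?s * ?s')"
      unfolding v(2)[OF that(1)] v(2)[OF that(2)] using T by (simp add: mult_ac)
    then have "empirical_kernel zs i j =
        (real T * ?s * ?s' * noise zs i j + M $$ (i, j) * ((a i)\<^sup>2 * (real T * (?s * ?s)))) / (a i * a j * (real T * ?s * ?s'))"
      unfolding empirical_kernel_def C v(1)[OF that(1)] s(3) by simp
    also have "\<dots> = 1 / a i * noise zs i j * (1 / a j) + a i * (?s * M $$ (i, j) / ?s') * (1 / a j)"
      using s(1,2) ai T by (simp add: divide_simps power2_eq_square) (simp add: algebra_simps)
    finally show ?thesis by (simp only: normalized_kernel_def)
  qed
  have split: "mv d (empirical_kernel zs) v i - K v i =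
      1 / a i * mv d (noise zs) ?w i + ((a i - 1) * K ?w i + K (\<lambda>j. (1 / a j - 1) * v j) i)" if "i < d" for i
  proof -
    have "mv d (empirical_kernel zs) v i = (\<Sum>j<d. (1 / a i * noise zs i j * (1 / a j) + a i * L i j * (1 / a j)) * v j)"
      unfolding mv_def using entry[OF that] by (intro sum.cong) auto
    also have "\<dots> = 1 / a i * mv d (noise zs) ?w i + a i * K ?w i"
      unfolding mv_def sum_distrib_left sum.distrib[symmetric]
      by (intro sum.cong refl) (simp add: algebra_simps)
    finally have 1: "mv d (empirical_kernel zs) v i = 1 / a i * mv d (noise zs) ?w i + a i * K ?w i" .
    have 2: "K (\<lambda>j. (1 / a j - 1) * v j) i = K ?w i - K v i"
      using fun_cong[OF mv_diff[of d L ?w v], of i] by (simp add: left_diff_distrib)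
    show ?thesis unfolding 1 2 by (simp add: algebra_simps)
  qed
  have Kle: "nrm d (K u) \<le> nrm d u" for u using nrm_K_pow_le[of 1 u] by simp
  have w: "nrm d ?w \<le> 2 * nrm d v" by (rule nrm_mult_le) (use inv in auto)
  let ?x = "\<lambda>i. 1 / a i * mv d (noise zs) ?w i" and ?y = "\<lambda>i. (a i - 1) * K ?w i"
    and ?z = "K (\<lambda>j. (1 / a j - 1) * v j)"
  have "nrm d ?x \<le> 2 * nrm d (mv d (noise zs) ?w)"
    by (rule nrm_mult_le) (use inv in auto)
  then have x: "nrm d ?x \<le> 2 * (\<eta> * nrm d ?w)" using noise[of ?w] by linarith
  have "nrm d ?y \<le> \<eta> * nrm d (K ?w)" by (rule nrm_mult_le) (use a1 \<eta> in auto)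
  also have "\<dots> \<le> \<eta> * nrm d ?w" using \<eta> by (intro mult_left_mono Kle) auto
  finally have y: "nrm d ?y \<le> \<eta> * nrm d ?w" .
  have "nrm d ?z \<le> nrm d (\<lambda>j. (1 / a j - 1) * v j)" by (rule Kle)
  also have "\<dots> \<le> 2 * \<eta> * nrm d v" by (rule nrm_mult_le) (use inv \<eta> in auto)
  finally have z: "nrm d ?z \<le> 2 * \<eta> * nrm d v" .
  have "nrm d (\<lambda>i. mv d (empirical_kernel zs) v i - K v i) = nrm d (\<lambda>i. ?x i + (?y i + ?z i))"
    using split by (rule nrm_cong)
  also have "\<dots> \<le> nrm d ?x + nrm d (\<lambda>i. ?y i + ?z i)" by (rule nrm_add_le)
  also have "\<dots> \<le> nrm d ?x + (nrm d ?y + nrm d ?z)" by (intro add_left_mono nrm_add_le)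
  also have "\<dots> \<le> 2 * (\<eta> * nrm d ?w) + (\<eta> * nrm d ?w + 2 * \<eta> * nrm d v)"
    by (intro add_mono x y z)
  also have "\<dots> = 3 * \<eta> * nrm d ?w + 2 * \<eta> * nrm d v" by simp
  also have "\<dots> \<le> 3 * \<eta> * (2 * nrm d v) + 2 * \<eta> * nrm d v"
    using \<eta> w by (intro add_mono mult_left_mono) auto
  finally show ?thesis by simp
qed

end

text \<open>Both kernels lie within 8 times their tolerance of the same empirical matrix, and the
  gap is 2-Lipschitz in the kernel.\<close>

lemma pseudo_gap_diff_le_of_consistent:
  assumes "ergodic_chain d M \<pi>" "ergodic_chain d M' \<pi>'" "length zs \<ge> 2"
    "ergodic_chain.consistent d M \<pi> \<eta> zs" "ergodic_chain.consistent d M' \<pi>' \<eta>' zs"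
  shows "pseudo_spectral_gap \<pi>' M' - 16 * \<eta>' \<le> pseudo_spectral_gap \<pi> M + 16 * \<eta>"
proof -
  interpret A: ergodic_chain d M \<pi> by fact
  interpret B: ergodic_chain d M' \<pi>' by fact
  have "nrm d (\<lambda>i. A.K v i - B.K v i) \<le> (8 * \<eta> + 8 * \<eta>') * nrm d v" for v
  proof -
    let ?e = "mv d (empirical_kernel zs) v"
    have "nrm d (\<lambda>i. A.K v i - B.K v i) = nrm d (\<lambda>i. -1 * (?e i - A.K v i) + (?e i - B.K v i))"
      by (intro nrm_cong) simp
    also have "\<dots> \<le> nrm d (\<lambda>i. -1 * (?e i - A.K v i)) + nrm d (\<lambda>i. ?e i - B.K v i)"
      by (rule nrm_add_le)
    also have "\<dots> \<le> 8 * \<eta> * nrm d v + 8 * \<eta>' * nrm d v"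
      unfolding nrm_scale using A.empirical_kernel_close[of zs \<eta> v] B.empirical_kernel_close[of zs \<eta>' v] assms(3-5)
      by simp
    finally show ?thesis by (simp add: algebra_simps)
  qed
  from A.pseudo_gap_perturbation[OF assms(2) this] show ?thesis by simp
qed

text \<open>
  Chains consistent with the data at levels \<open>\<eta>\<close> and \<open>\<eta>'\<close> have gaps differing by at most
  \<open>16 (\<eta> + \<eta>')\<close>, so all the intervals \<open>[\<gamma> - 16 \<eta>, \<gamma> + 16 \<eta>]\<close> share a point, namely the
  supremum of their left endpoints. This makes the estimator independent of \<open>\<epsilon>\<close> and \<open>\<delta>\<close>.
\<close>

definition gap_estimator :: "nat \<Rightarrow> nat list \<Rightarrow> real" where
  "gap_estimator d zs = Sup {pseudo_spectral_gap \<pi> M - 16 * \<eta> | M \<pi> \<eta>.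
     ergodic_chain d M \<pi> \<and> ergodic_chain.consistent d M \<pi> \<eta> zs}"

lemma gap_estimator_close:
  assumes C: "ergodic_chain d M \<pi>" and len: "length zs \<ge> 2" and cons: "ergodic_chain.consistent d M \<pi> \<eta> zs"
  shows "\<bar>gap_estimator d zs - pseudo_spectral_gap \<pi> M\<bar> \<le> 16 * \<eta>"
proof -
  let ?S = "{pseudo_spectral_gap \<pi> M - 16 * \<eta> | M \<pi> \<eta>.
     ergodic_chain d M \<pi> \<and> ergodic_chain.consistent d M \<pi> \<eta> zs}"
  have mem: "pseudo_spectral_gap \<pi> M - 16 * \<eta> \<in> ?S" using C cons by blast
  have ub: "s \<le> pseudo_spectral_gap \<pi> M + 16 * \<eta>" if "s \<in> ?S" for s
    using that pseudo_gap_diff_le_of_consistent[OF C _ len cons] by blast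
  then have "bdd_above ?S" by (rule bdd_aboveI)
  then have "pseudo_spectral_gap \<pi> M - 16 * \<eta> \<le> gap_estimator d zs"
    unfolding gap_estimator_def by (rule cSup_upper[OF mem])
  moreover have "gap_estimator d zs \<le> pseudo_spectral_gap \<pi> M + 16 * \<eta>"
    unfolding gap_estimator_def by (rule cSup_least) (use mem ub in blast)+
  ultimately show ?thesis by (simp add: abs_le_iff)
qed

section \<open>The estimator\<close>

lemma max_col_sum_norm_ge:
  "j < dim_col A \<Longrightarrow> (\<Sum>i<dim_row A. \<bar>A $$ (i, j)\<bar>) \<le> max_col_sum_norm A"
  unfolding max_col_sum_norm_def by (intro Max_ge) auto

lemma max_col_sum_norm_le:
  assumes "0 < dim_col A" "\<And>j. j < dim_col A \<Longrightarrow> (\<Sum>i<dim_row A. \<bar>A $$ (i, j)\<bar>) \<le> b"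
  shows "max_col_sum_norm A \<le> b"
  unfolding max_col_sum_norm_def using assms by (subst Max_le_iff) auto

lemma stationary_ratio_ge:
  assumes "i < dim_vec \<pi>" "j < dim_vec \<pi>"
  shows "\<pi> $ i / \<pi> $ j \<le> stationary_ratio \<pi>"
  unfolding stationary_ratio_def using assms
  by (intro Max_ge finite_imageI finite_cartesian_product image_eqI[of _ _ "(i, j)"]) auto

context stationary_chain
begin

lemma dim_P: "dim_row (M ^\<^sub>m k) = d" "dim_col (M ^\<^sub>m k) = d"
  using pow_carrier_mat[OF M_carrier, of k] by auto

lemma col_sum_P: "j < d \<Longrightarrow> (\<Sum>i<d. \<bar>P k i j\<bar>) = (\<Sum>i<d. P k i j)"
  using P_nonneg by (intro sum.cong) auto

lemma stationary_ratio_ge_1: "d \<ge> 1 \<Longrightarrow> 1 \<le> stationary_ratio \<pi>"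
  using stationary_ratio_ge[of 0 \<pi> 0] pi_pos[of 0] dim_pi by simp

text \<open>Entries at most 1 give \<open>d\<close>. For the ratio, weighting a column by the
  smallest stationary mass and using invariance of \<pi> bounds its sum by a quotient of two
  stationary masses.\<close>

lemma max_col_sum_norm_P_le:
  assumes d: "d \<ge> 1"
  shows "max_col_sum_norm (M ^\<^sub>m k) \<le> min (real d) (stationary_ratio \<pi>)"
proof (rule max_col_sum_norm_le)
  fix j assume "j < dim_col (M ^\<^sub>m k)"
  then have j: "j < d" by (simp only: dim_P)
  have "(\<Sum>i<d. P k i j) \<le> (\<Sum>i<d. 1)"
    using P_le_1 j by (intro sum_mono) auto
  moreover have "(\<Sum>i<d. P k i j) \<le> stationary_ratio \<pi>"
  proof -
    obtain l where l: "l < d" "\<And>i. i < d \<Longrightarrow> \<pi> $ l \<le> \<pi> $ i"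
    proof -
      have ne: "(\<lambda>i. \<pi> $ i) ` {..<d} \<noteq> {}" using d by (auto simp: lessThan_empty_iff)
      from Min_in[OF _ ne] obtain l where l: "l < d" "Min ((\<lambda>i. \<pi> $ i) ` {..<d}) = \<pi> $ l" by auto
      then show thesis by (intro that[of l]) (auto simp: l(2)[symmetric])
    qed
    have "\<pi> $ l * (\<Sum>i<d. P k i j) \<le> (\<Sum>i<d. \<pi> $ i * P k i j)"
      unfolding sum_distrib_left using l P_nonneg j by (intro sum_mono mult_right_mono) auto
    then have "(\<Sum>i<d. P k i j) \<le> \<pi> $ j / \<pi> $ l"
      using pi_P[OF j] pi_pos[OF l(1)] by (simp add: pos_le_divide_eq mult.commute)
    also have "\<dots> \<le> stationary_ratio \<pi>" using j l(1) dim_pi by (intro stationary_ratio_ge) auto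
    finally show ?thesis .
  qed
  ultimately show "(\<Sum>i<dim_row (M ^\<^sub>m k). \<bar>P k i j\<bar>) \<le> min (real d) (stationary_ratio \<pi>)"
    unfolding dim_P col_sum_P[OF j] by simp
next
  show "0 < dim_col (M ^\<^sub>m k)" unfolding dim_P using d by simp
qed

lemma complexity_le:
  assumes d: "d \<ge> 1" and \<epsilon>: "0 < \<epsilon>" "\<epsilon> < 1"
  shows "complexity \<epsilon> \<pi> M \<le> stationary_ratio \<pi> * min (real d) (stationary_ratio \<pi>)"
  unfolding complexity_def
proof (rule mult_left_mono)
  have "1 \<le> nat \<lceil>2 / \<epsilon>\<rceil>" using \<epsilon> by (simp add: Suc_le_eq)
  then have ne: "(\<lambda>k. max_col_sum_norm (M ^\<^sub>m k) / real k) ` {1..nat \<lceil>2 / \<epsilon>\<rceil>} \<noteq> {}" by auto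
  show "Max ((\<lambda>k. max_col_sum_norm (M ^\<^sub>m k) / real k) ` {1..nat \<lceil>2 / \<epsilon>\<rceil>}) \<le> min (real d) (stationary_ratio \<pi>)"
  proof (rule Max.boundedI[OF _ ne])
    fix a assume "a \<in> (\<lambda>k. max_col_sum_norm (M ^\<^sub>m k) / real k) ` {1..nat \<lceil>2 / \<epsilon>\<rceil>}"
    then obtain k where k: "1 \<le> k" "a = max_col_sum_norm (M ^\<^sub>m k) / real k" by auto
    have "a \<le> min (real d) (stationary_ratio \<pi>) / real k"
      unfolding k(2) by (intro divide_right_mono max_col_sum_norm_P_le[OF d]) auto
    also have "\<dots> \<le> min (real d) (stationary_ratio \<pi>) / 1"
      using k(1) stationary_ratio_ge_1[OF d] by (intro divide_left_mono) auto
    finally show "a \<le> min (real d) (stationary_ratio \<pi>)" by simp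
  qed simp
  show "0 \<le> stationary_ratio \<pi>" using stationary_ratio_ge_1[OF d] by simp
qed

lemma col_sum_le_norm: "j < d \<Longrightarrow> (\<Sum>i<d. M $$ (i, j)) \<le> max_col_sum_norm M"
  using max_col_sum_norm_ge[of j M] col_sum_P[of j 1] M_carrier dim_M by simp

lemma max_col_sum_norm_ge_1:
  assumes d: "d \<ge> 1"
  shows "1 \<le> max_col_sum_norm M"
proof -
  have "real d = (\<Sum>i<d. \<Sum>j<d. M $$ (i, j))" using M_row by simp
  also have "\<dots> = (\<Sum>j<d. \<Sum>i<d. M $$ (i, j))" by (rule sum.swap)
  also have "\<dots> \<le> (\<Sum>j<d. max_col_sum_norm M)" by (intro sum_mono col_sum_le_norm) auto
  finally show ?thesis using d by simp
qed

text \<open>The entry \<open>k = 1\<close> of the maximum, multiplied by a ratio that is at least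
  1.\<close>

lemma max_col_sum_norm_le_complexity:
  assumes d: "d \<ge> 1" and \<epsilon>: "0 < \<epsilon>" "\<epsilon> < 1"
  shows "max_col_sum_norm M \<le> complexity \<epsilon> \<pi> M"
proof -
  let ?f = "\<lambda>k. max_col_sum_norm (M ^\<^sub>m k) / real k"
  have "1 \<le> nat \<lceil>2 / \<epsilon>\<rceil>" using \<epsilon> by (simp add: Suc_le_eq)
  then have "?f 1 \<in> ?f ` {1..nat \<lceil>2 / \<epsilon>\<rceil>}" by (intro imageI) simp
  then have "?f 1 \<le> Max (?f ` {1..nat \<lceil>2 / \<epsilon>\<rceil>})" by (intro Max_ge) auto
  then have "max_col_sum_norm M \<le> Max (?f ` {1..nat \<lceil>2 / \<epsilon>\<rceil>})" using M_carrier by simp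
  moreover have "1 * Max (?f ` {1..nat \<lceil>2 / \<epsilon>\<rceil>}) \<le> stationary_ratio \<pi> * Max (?f ` {1..nat \<lceil>2 / \<epsilon>\<rceil>})"
    using calculation max_col_sum_norm_ge_1[OF d] stationary_ratio_ge_1[OF d] by (intro mult_right_mono) auto
  ultimately show ?thesis by (simp add: complexity_def)
qed

lemma min_prob_le: "i < d \<Longrightarrow> min_prob \<pi> \<le> \<pi> $ i"
  unfolding min_prob_def by (intro Min_le) (auto simp: dim_pi)

lemma min_prob_pos: "d \<ge> 1 \<Longrightarrow> 0 < min_prob \<pi>"
  unfolding min_prob_def dim_pi using pi_pos by (subst Min_gr_iff) (auto simp: lessThan_empty_iff)

lemma min_prob_le_1: "d \<ge> 1 \<Longrightarrow> min_prob \<pi> \<le> 1"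
proof -
  assume d: "d \<ge> 1"
  have "\<pi> $ 0 \<le> (\<Sum>i<d. \<pi> $ i)"
    by (rule member_le_sum[of 0 "{..<d}" "\<lambda>i. \<pi> $ i"]) (use d pi_nonneg in auto)
  then show ?thesis using min_prob_le[of 0] pi_sum d by simp
qed

text \<open>Excludes \<open>m = 0\<close>, where the trajectory law is not meaningful.\<close>

lemma sample_bound_pos:
  assumes d: "d \<ge> 1" and \<epsilon>: "0 < \<epsilon>" "\<epsilon> < 1" and \<delta>: "0 < \<delta>" "\<delta> < 1" and C: "0 < C"
  shows "0 < sample_bound C d \<epsilon> \<delta> \<pi> M"
proof -
  have p: "0 < min_prob \<pi>" "min_prob \<pi> \<le> 1" by (rule min_prob_pos[OF d], rule min_prob_le_1[OF d])
  have "1 * 1 \<le> real d * sqrt (1 / min_prob \<pi>)"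
    using d p by (intro mult_mono) auto
  moreover have e: "0 < \<epsilon>\<^sup>2 * \<delta>" using \<epsilon> \<delta> by simp
  moreover have "\<epsilon>\<^sup>2 * \<delta> < 1"
  proof -
    have "\<epsilon>\<^sup>2 * \<delta> \<le> 1 * \<delta>" using \<epsilon> \<delta> by (intro mult_right_mono) (auto simp: power_le_one)
    then show ?thesis using \<delta> by linarith
  qed
  ultimately have "1 < real d * sqrt (1 / min_prob \<pi>) / (\<epsilon>\<^sup>2 * \<delta>)"
    by (simp only: less_divide_eq_1_pos)
  then have "0 < ln (real d * sqrt (1 / min_prob \<pi>) / (\<epsilon>\<^sup>2 * \<delta>))" by (rule ln_gt_zero)
  moreover have "0 < max (1 / pseudo_spectral_gap \<pi> M) (complexity \<epsilon> \<pi> M)"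
    using max_col_sum_norm_ge_1[OF d] max_col_sum_norm_le_complexity[OF d \<epsilon>] by simp
  moreover have "0 < C / (min_prob \<pi> * \<epsilon>\<^sup>2)" using C p \<epsilon> by simp
  ultimately show ?thesis unfolding sample_bound_def by (intro mult_pos_pos)
qed

end

text \<open>With \<open>y = d sqrt (1 / p) / \<delta>\<close> the tails have prefactors at most
  \<open>4 \<delta> y\<close> and \<open>2 \<delta> y\<close>. Exponents of at least
  \<open>4 ln y\<close> leave \<open>6 \<delta> / y^3\<close>, and \<open>y >= 2\<close>, a
  consequence of \<open>d >= 2\<close>, brings this below \<delta>.\<close>

lemma sample_size_arithmetic:
  fixes \<epsilon> \<delta> p \<gamma> c q :: real and d T :: nat
  assumes d: "d \<ge> 2" and \<epsilon>: "0 < \<epsilon>" "\<epsilon> < 1" and \<delta>: "0 < \<delta>" "\<delta> < 1" and p: "0 < p" "p \<le> 1"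
    and \<gamma>: "0 < \<gamma>" "\<gamma> \<le> 1" and c: "1 \<le> c" "c \<le> q"
    and m: "real (Suc T) \<ge> 2000000 / (p * \<epsilon>\<^sup>2) * max (1 / \<gamma>) q * ln (real d * sqrt (1 / p) / (\<epsilon>\<^sup>2 * \<delta>))"
  shows "T \<ge> 1" "real T * \<gamma> \<ge> 2"
    "4 * real d / sqrt p * exp (- ((\<epsilon> / 32)\<^sup>2 * \<gamma> * p * real T / 224)) +
     2 * real d * exp (- ((\<epsilon> / 32)\<^sup>2 * real T * p / (32 * c))) \<le> \<delta>"
proof -
  define y where "y = real d * sqrt (1 / p) / \<delta>"
  define \<Lambda> where "\<Lambda> = ln (real d * sqrt (1 / p) / (\<epsilon>\<^sup>2 * \<delta>))"
  have sq: "1 \<le> sqrt (1 / p)" using p by simp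
  have e2: "0 < \<epsilon>\<^sup>2" "\<epsilon>\<^sup>2 \<le> 1" using \<epsilon> by (auto simp: power_le_one)
  have dy: "real d \<le> \<delta> * y"
  proof -
    have "real d * 1 \<le> real d * sqrt (1 / p)" using sq by (intro mult_left_mono) auto
    then show ?thesis using \<delta> by (simp add: y_def)
  qed
  have "2 * 1 \<le> real d * sqrt (1 / p)" using d sq by (intro mult_mono) auto
  moreover have "real d * sqrt (1 / p) * \<delta> \<le> real d * sqrt (1 / p) * 1"
    using \<delta> p by (intro mult_left_mono mult_nonneg_nonneg) auto
  ultimately have y2: "2 \<le> y" unfolding y_def using \<delta> by (simp add: le_divide_eq)
  have "real d * sqrt (1 / p) / (\<epsilon>\<^sup>2 * \<delta>) = y / \<epsilon>\<^sup>2" by (simp add: y_def)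
  moreover have "y * \<epsilon>\<^sup>2 \<le> y * 1" using e2 y2 by (intro mult_left_mono) auto
  then have "y \<le> y / \<epsilon>\<^sup>2" using e2 by (simp add: le_divide_eq)
  ultimately have L: "ln y \<le> \<Lambda>" unfolding \<Lambda>_def using y2 by simp
  have "ln 2 \<le> ln y" using y2 by simp
  moreover have "(1 :: real) / 2 \<le> ln 2"
    using ln_add_one_self_le_self2[of "- 1 / 2 :: real"] by (simp add: ln_div)
  ultimately have L2: "1 / 2 \<le> \<Lambda>" using L by linarith
  have pe: "0 < p * \<epsilon>\<^sup>2" "p * \<epsilon>\<^sup>2 \<le> 1" using p e2 by (auto intro: mult_le_one)
  have m': "2000000 * (max (1 / \<gamma>) q * \<Lambda>) \<le> real (Suc T) * (p * \<epsilon>\<^sup>2)"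
    using m pe(1) unfolding \<Lambda>_def[symmetric] by (simp add: pos_divide_le_eq mult.assoc)
  have mg: "2000000 * \<Lambda> \<le> real (Suc T) * (p * \<epsilon>\<^sup>2) * \<gamma>"
  proof -
    have "2000000 * (1 / \<gamma> * \<Lambda>) \<le> 2000000 * (max (1 / \<gamma>) q * \<Lambda>)"
      using L2 by (intro mult_left_mono mult_right_mono) auto
    then have "2000000 * (1 / \<gamma> * \<Lambda>) * \<gamma> \<le> real (Suc T) * (p * \<epsilon>\<^sup>2) * \<gamma>"
      using m' \<gamma> by (intro mult_right_mono) linarith+
    then show ?thesis using \<gamma> by simp
  qed
  have mc: "2000000 * (c * \<Lambda>) \<le> real (Suc T) * (p * \<epsilon>\<^sup>2)"
  proof -
    have "2000000 * (c * \<Lambda>) \<le> 2000000 * (max (1 / \<gamma>) q * \<Lambda>)"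
      using L2 c by (intro mult_left_mono mult_right_mono) auto
    then show ?thesis using m' by linarith
  qed
  have "real (Suc T) * (p * \<epsilon>\<^sup>2) * \<gamma> \<le> real (Suc T) * 1 * \<gamma>"
    using pe \<gamma> by (intro mult_right_mono mult_left_mono) auto
  then have mgl: "1000000 \<le> real (Suc T) * \<gamma>" using mg L2 by linarith
  moreover have "real (Suc T) * \<gamma> \<le> real (Suc T) * 1" using \<gamma> by (intro mult_left_mono) auto
  ultimately have "1000000 \<le> real (Suc T) * 1" by (rule order_trans)
  then show T1: "T \<ge> 1" by simp
  then have half: "real (Suc T) \<le> 2 * real T" by simp
  then have "real (Suc T) * \<gamma> \<le> 2 * real T * \<gamma>" using \<gamma> by (intro mult_right_mono) auto
  then show "real T * \<gamma> \<ge> 2" using mgl by simp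
  have E: "exp (- x) \<le> 1 / y ^ 4" if "4 * \<Lambda> \<le> x" for x
  proof -
    have "exp (- x) \<le> exp (- (real 4 * ln y))" using that L by simp
    also have "\<dots> = 1 / exp (real 4 * ln y)" by (simp only: exp_minus inverse_eq_divide)
    also have "exp (real 4 * ln y) = y ^ 4" using y2 by (simp only: exp_of_nat_mult) simp
    finally show ?thesis .
  qed
  have e32: "(\<epsilon> / 32)\<^sup>2 = \<epsilon>\<^sup>2 / 1024" by (simp add: power_divide)
  have 1: "exp (- ((\<epsilon> / 32)\<^sup>2 * \<gamma> * p * real T / 224)) \<le> 1 / y ^ 4"
  proof (rule E)
    have "2000000 * \<Lambda> \<le> 2 * real T * (p * \<epsilon>\<^sup>2) * \<gamma>"
      using mg mult_right_mono[OF mult_right_mono[OF half, of "p * \<epsilon>\<^sup>2"], of \<gamma>] pe \<gamma> by linarith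
    \<comment> \<open>458752 = 2 * 1024 * 224, and four times this is 1835008, which the constant
      2000000 exceeds.\<close>
    moreover have "(\<epsilon> / 32)\<^sup>2 * \<gamma> * p * real T / 224 = 2 * real T * (p * \<epsilon>\<^sup>2) * \<gamma> / 458752"
      unfolding e32 by simp
    ultimately show "4 * \<Lambda> \<le> (\<epsilon> / 32)\<^sup>2 * \<gamma> * p * real T / 224" using L2 by linarith
  qed
  have 2: "exp (- ((\<epsilon> / 32)\<^sup>2 * real T * p / (32 * c))) \<le> 1 / y ^ 4"
  proof (rule E)
    have "2000000 * (c * \<Lambda>) \<le> 2 * real T * (p * \<epsilon>\<^sup>2)"
      using mc mult_right_mono[OF half, of "p * \<epsilon>\<^sup>2"] pe by linarith
    then have "2000000 * \<Lambda> \<le> 2 * real T * (p * \<epsilon>\<^sup>2) / c" using c by (simp add: pos_le_divide_eq mult_ac)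
    moreover have "4 * \<Lambda> \<le> A / 65536" if "2000000 * \<Lambda> \<le> A" for A using that L2 by linarith
    moreover have "(\<epsilon> / 32)\<^sup>2 * real T * p / (32 * c) = 2 * real T * (p * \<epsilon>\<^sup>2) / c / 65536"
      unfolding e32 by simp
    ultimately show "4 * \<Lambda> \<le> (\<epsilon> / 32)\<^sup>2 * real T * p / (32 * c)" by (simp only:)
  qed
  have y3: "8 \<le> y ^ 3" using power_mono[OF y2, of 3] by simp
  have "4 * real d / sqrt p = 4 * \<delta> * y" using \<delta> by (simp add: y_def real_sqrt_divide)
  then have "4 * real d / sqrt p * exp (- ((\<epsilon> / 32)\<^sup>2 * \<gamma> * p * real T / 224)) \<le> 4 * \<delta> * y * (1 / y ^ 4)"
    using 1 \<delta> y2 by (simp only:) (intro mult_left_mono, auto)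
  moreover have "2 * real d * exp (- ((\<epsilon> / 32)\<^sup>2 * real T * p / (32 * c))) \<le> 2 * (\<delta> * y) * (1 / y ^ 4)"
    using 2 dy \<delta> y2 by (intro mult_mono) auto
  moreover have "4 * \<delta> * y * (1 / y ^ 4) + 2 * (\<delta> * y) * (1 / y ^ 4) = 6 * \<delta> / y ^ 3"
    using y2 by (simp add: field_simps eval_nat_numeral)
  moreover have "6 * \<delta> / y ^ 3 \<le> 6 * \<delta> / 8" using y2 y3 \<delta> by (intro divide_left_mono) auto
  ultimately show "4 * real d / sqrt p * exp (- ((\<epsilon> / 32)\<^sup>2 * \<gamma> * p * real T / 224)) +
     2 * real d * exp (- ((\<epsilon> / 32)\<^sup>2 * real T * p / (32 * c))) \<le> \<delta>" using \<delta> by linarith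
qed

text \<open>A failure bound uniform in the initial state carries over to every initial law by
  averaging; \<open>Q\<close> is the controlled event and \<open>R\<close> its consequence.\<close>

lemma prob_trajectory_law_ge:
  assumes mc: "markov_chain d M \<mu>"
    and bad: "\<And>x. x < d \<Longrightarrow> path_exp d M T x (\<lambda>zs. of_bool (\<not> Q zs)) \<le> \<delta>"
    and Q: "\<And>zs. zs \<in> trajectories d (Suc T) \<Longrightarrow> Q zs \<Longrightarrow> R zs"
  shows "\<P>(xs in trajectory_law d M \<mu> (Suc T). R xs) \<ge> 1 - \<delta>"
proof -
  let ?S = "trajectories d (Suc T)" and ?p = "trajectory_prob M \<mu>"
  have p0: "0 \<le> ?p xs" if "xs \<in> ?S" for xs using trajectory_prob_nonneg[OF mc that] by simp
  have "emeasure (trajectory_law d M \<mu> (Suc T)) {xs \<in> ?S. R xs} = (\<Sum>xs\<in>{xs \<in> ?S. R xs}. ennreal (?p xs))"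
    unfolding trajectory_law_def by (rule emeasure_point_measure_finite) (auto simp: finite_trajectories)
  also have "\<dots> = ennreal (\<Sum>xs\<in>{xs \<in> ?S. R xs}. ?p xs)" using p0 by (intro sum_ennreal) auto
  finally have "\<P>(xs in trajectory_law d M \<mu> (Suc T). R xs) = enn2real (ennreal (\<Sum>xs\<in>{xs \<in> ?S. R xs}. ?p xs))"
    by (simp add: measure_def trajectory_law_def space_point_measure)
  also have "\<dots> = (\<Sum>xs\<in>{xs \<in> ?S. R xs}. ?p xs)"
    using p0 by (intro enn2real_ennreal sum_nonneg) auto
  also have "\<dots> \<ge> (\<Sum>xs\<in>?S. ?p xs - ?p xs * of_bool (\<not> Q xs))"
  proof -
    have "(\<Sum>xs\<in>?S. ?p xs - ?p xs * of_bool (\<not> Q xs)) \<le> (\<Sum>xs\<in>?S. if R xs then ?p xs else 0)"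
      using p0 Q by (intro sum_mono) auto
    also have "\<dots> = (\<Sum>xs\<in>{xs \<in> ?S. R xs}. ?p xs)"
      by (simp add: sum.inter_filter finite_trajectories)
    finally show ?thesis .
  qed
  also have "(\<Sum>xs\<in>?S. ?p xs - ?p xs * of_bool (\<not> Q xs)) = 1 - (\<Sum>x<d. \<mu> $ x * path_exp d M T x (\<lambda>zs. of_bool (\<not> Q zs)))"
    by (simp only: sum_subtractf sum_trajectory_prob[OF mc] sum_trajectory_prob_path_exp)
  also have "\<dots> \<ge> 1 - (\<Sum>x<d. \<mu> $ x * \<delta>)"
    using bad mc by (intro diff_left_mono sum_mono mult_left_mono) (auto simp: markov_chain_def prob_vec_def)
  also have "(\<Sum>x<d. \<mu> $ x * \<delta>) = \<delta>"
    using mc by (simp add: sum_distrib_right[symmetric] markov_chain_def prob_vec_def)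
  finally show ?thesis by simp
qed

lemma gap_estimator_accuracy:
  assumes \<epsilon>: "0 < \<epsilon>" "\<epsilon> < 1" and \<delta>: "0 < \<delta>" "\<delta> < 1" and mc: "markov_chain d M \<mu>"
    and C: "ergodic_chain d M \<pi>" and m: "real m \<ge> sample_bound 2000000 d \<epsilon> \<delta> \<pi> M"
  shows "\<P>(xs in trajectory_law d M \<mu> m. \<bar>gap_estimator d xs - pseudo_spectral_gap \<pi> M\<bar> < \<epsilon>) \<ge> 1 - \<delta>"
proof -
  interpret ergodic_chain d M \<pi> by (rule C)
  let ?p = "min_prob \<pi>" and ?\<gamma> = "pseudo_spectral_gap \<pi> M" and ?c = "max_col_sum_norm M"
  have d1: "d \<ge> 1" using d2 by simp
  note p = min_prob_pos[OF d1] min_prob_le_1[OF d1]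
  note arith = sample_size_arithmetic[OF d2 \<epsilon> \<delta> p pseudo_gap_pos pseudo_gap_le_1
      max_col_sum_norm_ge_1[OF d1] max_col_sum_norm_le_complexity[OF d1 \<epsilon>]]
  show ?thesis
  proof (cases m)
    case 0
    have "0 < sample_bound 2000000 d \<epsilon> \<delta> \<pi> M" by (rule sample_bound_pos[OF d1 \<epsilon> \<delta>]) simp
    then show ?thesis using m 0 by simp
  next
    case (Suc T)
    then have m': "real (Suc T) \<ge> 2000000 / (?p * \<epsilon>\<^sup>2) * max (1 / ?\<gamma>) (complexity \<epsilon> \<pi> M) *
        ln (real d * sqrt (1 / ?p) / (\<epsilon>\<^sup>2 * \<delta>))"
      using m by (simp add: sample_bound_def)
    note T = arith[OF m']
    show ?thesis unfolding Suc
    \<comment> \<open>Tolerance \<open>\<epsilon> / 32\<close> gives an error of at most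
      \<open>16 * (\<epsilon> / 32) = \<epsilon> / 2\<close>, strictly below \<epsilon>.\<close>
    proof (rule prob_trajectory_law_ge[OF mc, where Q = "consistent (\<epsilon> / 32)"])
      fix x assume x: "x < d"
      have "path_exp d M T x (\<lambda>zs. of_bool (\<not> consistent (\<epsilon> / 32) zs)) \<le>
          4 * real d / sqrt ?p * exp (- ((\<epsilon> / 32)\<^sup>2 * ?\<gamma> * ?p * real T / 224)) +
          2 * real d * exp (- ((\<epsilon> / 32)\<^sup>2 * real T * ?p / (32 * ?c)))"
        by (rule inconsistent_tail[OF T(1,2) p(1) min_prob_le max_col_sum_norm_ge_1[OF d1] col_sum_le_norm])
          (use \<epsilon> x in auto)
      then show "path_exp d M T x (\<lambda>zs. of_bool (\<not> consistent (\<epsilon> / 32) zs)) \<le> \<delta>"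
        using T(3) by linarith
    next
      fix zs assume "zs \<in> trajectories d (Suc T)" "consistent (\<epsilon> / 32) zs"
      then have "\<bar>gap_estimator d zs - ?\<gamma>\<bar> \<le> 16 * (\<epsilon> / 32)"
        using T(1) by (intro gap_estimator_close[OF C]) (auto simp: trajectories_def)
      then show "\<bar>gap_estimator d zs - ?\<gamma>\<bar> < \<epsilon>" using \<epsilon> by simp
    qed
  qed
qed

text \<open>With the gap of a single state set to 1, the supremum is that of \<open>1 / k\<close>,
  attained at \<open>k = 1\<close>.\<close>

lemma pseudo_spectral_gap_one_state:
  assumes "stationary_distribution 1 M \<pi>"
  shows "pseudo_spectral_gap \<pi> M = 1"
proof -
  have "dim_vec \<pi> = 1" using assms by (auto simp: stationary_distribution_def prob_vec_def)
  then have dim: "dim_row (time_reversal \<pi> M ^\<^sub>m k * M ^\<^sub>m k) = 1" for k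
    by (simp add: time_reversal_def)
  then have eq: "pseudo_spectral_gap \<pi> M = (SUP k\<in>{1..}. 1 / real k)"
    by (simp add: pseudo_spectral_gap_def spectral_gap_def)
  have le: "1 / real k \<le> 1" if "k \<in> {1..}" for k using that by simp
  then have bdd: "bdd_above ((\<lambda>k. 1 / real k) ` {1..})" by (intro bdd_aboveI[of _ 1]) auto
  have "(SUP k\<in>{1..}. 1 / real k) \<le> 1" using le by (intro cSUP_least) auto
  moreover have "1 / real 1 \<le> (SUP k\<in>{1..}. 1 / real k)" by (rule cSUP_upper[OF _ bdd]) simp
  ultimately show ?thesis unfolding eq by simp
qed

theorem theorem5p3:
  shows "(\<exists>C::real. C > 0 \<and>
      (\<forall>d::nat. d \<ge> 1 \<longrightarrow>
        (\<exists>est :: nat \<Rightarrow> nat list \<Rightarrow> real.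
          \<forall>(\<epsilon>::real) (\<delta>::real) M \<mu> \<pi> (m::nat).
            0 < \<epsilon> \<and> \<epsilon> < 1 \<and> 0 < \<delta> \<and> \<delta> < 1 \<and>
            markov_chain d M \<mu> \<and> ergodic d M \<and> stationary_distribution d M \<pi> \<and>
            real m \<ge> sample_bound C d \<epsilon> \<delta> \<pi> M \<longrightarrow>
              \<P>(xs in trajectory_law d M \<mu> m. \<bar>est m xs - pseudo_spectral_gap \<pi> M\<bar> < \<epsilon>)
                \<ge> 1 - \<delta>))) \<and>
    (\<forall>(d::nat) (\<epsilon>::real) M \<pi>.
      d \<ge> 1 \<and> 0 < \<epsilon> \<and> \<epsilon> < 1 \<and> ergodic d M \<and> stationary_distribution d M \<pi> \<longrightarrow>
        complexity \<epsilon> \<pi> M \<le> stationary_ratio \<pi> * min (real d) (stationary_ratio \<pi>))"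
proof (intro conjI exI[of _ 2000000] allI impI)
  fix d :: nat assume d: "d \<ge> 1"
  show "\<exists>est :: nat \<Rightarrow> nat list \<Rightarrow> real. \<forall>(\<epsilon>::real) (\<delta>::real) M \<mu> \<pi> (m::nat).
            0 < \<epsilon> \<and> \<epsilon> < 1 \<and> 0 < \<delta> \<and> \<delta> < 1 \<and>
            markov_chain d M \<mu> \<and> ergodic d M \<and> stationary_distribution d M \<pi> \<and>
            real m \<ge> sample_bound 2000000 d \<epsilon> \<delta> \<pi> M \<longrightarrow>
              \<P>(xs in trajectory_law d M \<mu> m. \<bar>est m xs - pseudo_spectral_gap \<pi> M\<bar> < \<epsilon>) \<ge> 1 - \<delta>"
  proof (cases "d = 1")
    case False
    show ?thesis
    proof (intro exI[of _ "\<lambda>m. gap_estimator d"] allI impI; elim conjE)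
      fix \<epsilon> \<delta> :: real and M \<mu> \<pi> and m :: nat
      assume h: "0 < \<epsilon>" "\<epsilon> < 1" "0 < \<delta>" "\<delta> < 1" "markov_chain d M \<mu>" "ergodic d M"
        "stationary_distribution d M \<pi>" "real m \<ge> sample_bound 2000000 d \<epsilon> \<delta> \<pi> M"
      have "ergodic_chain d M \<pi>"
        using h d False by unfold_locales auto
      then show "\<P>(xs in trajectory_law d M \<mu> m. \<bar>gap_estimator d xs - pseudo_spectral_gap \<pi> M\<bar> < \<epsilon>) \<ge> 1 - \<delta>"
        by (intro gap_estimator_accuracy h)
    qed
  next
    \<comment> \<open>The gap is the same for every one-state chain, so a constant estimator is
      exact; what remains is that the law has total mass 1, which needs
      \<open>m >= 1\<close>.\<close>
    case True
    show ?thesis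
    proof (intro exI[of _ "\<lambda>m xs. 1"] allI impI; elim conjE)
      fix \<epsilon> \<delta> :: real and M \<mu> \<pi> and m :: nat
      assume h: "0 < \<epsilon>" "\<epsilon> < 1" "0 < \<delta>" "\<delta> < 1" "markov_chain d M \<mu>" "ergodic d M"
        "stationary_distribution d M \<pi>" "real m \<ge> sample_bound 2000000 d \<epsilon> \<delta> \<pi> M"
      interpret stationary_chain d M \<pi> using h by unfold_locales
      have \<gamma>: "pseudo_spectral_gap \<pi> M = 1" using h True pseudo_spectral_gap_one_state by simp
      have "0 < sample_bound 2000000 d \<epsilon> \<delta> \<pi> M" by (rule sample_bound_pos[OF d h(1-4)]) simp
      then have "m \<ge> 1" using h(8) by (cases m) auto
      then interpret prob_space "trajectory_law d M \<mu> m" by (rule prob_space_trajectory_law[OF h(5)])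
      show "\<P>(xs in trajectory_law d M \<mu> m. \<bar>1 - pseudo_spectral_gap \<pi> M\<bar> < \<epsilon>) \<ge> 1 - \<delta>"
        using h \<gamma> prob_space by simp
    qed
  qed
next
  fix d :: nat and \<epsilon> :: real and M \<pi>
  assume h: "d \<ge> 1 \<and> 0 < \<epsilon> \<and> \<epsilon> < 1 \<and> ergodic d M \<and> stationary_distribution d M \<pi>"
  then interpret stationary_chain d M \<pi> by unfold_locales auto
  show "complexity \<epsilon> \<pi> M \<le> stationary_ratio \<pi> * min (real d) (stationary_ratio \<pi>)"
    using h by (intro complexity_le) auto
qed simp

end
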